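(* Let $\mathcal{A}$ be an essential central arrangement of $n$ hyperplanes in a vector space over a field $K$, with Orlik-Terao ideal $I(\mathcal{A})\subset S=K[x_1,\ldots,x_n]$, underlying matroid $M(\mathcal{A})$ on $[n]$, and set of circuits $\mathfrak{C}=\mathfrak{C}(M(\mathcal{A}))$. The following conditions are equivalent: (i) $I(\mathcal{A})$ is a complete intersection; (ii) there is an ordering $\prec$ of $[n]$, with an arbitrary induced monomial order on $S$, such that $\mathrm{in}_\prec(I(\mathcal{A}))$ is a complete intersection; (iii) there is an ordering $\prec$ of $[n]$ such that the minimal broken circuits of $(M(\mathcal{A}),\prec)$ are pairwise disjoint; (iv) there is an ordering $\prec$ of $[n]$ and a subset $\mathfrak{D}$ of $\mathfrak{C}$ which is simple with respect to $\prec$ such that $\mathfrak{C}=\{\mathcal{C}(\mathfrak{D}'):\mathfrak{D}'\subseteq\mathfrak{D}\text{ is a tree}\}$.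
   Context: A central arrangement $\mathcal{A}=\{H_1,\ldots,H_n\}$ in a finite-dimensional $K$-vector space $V$ is a set of $n$ distinct linear hyperplanes; it is essential if $\bigcap_iH_i=0$. Choose $\alpha_i\in V^*$ with $\ker\alpha_i=H_i$. $M(\mathcal{A})$ is the matroid on $[n]=\{1,\ldots,n\}$ whose independent sets are the index sets of linearly independent families of the $\alpha_i$. The relation space $F(\mathcal{A})$ is the kernel of $\bigoplus_{i=1}^nKx_i\to V^*$, $x_i\mapsto\alpha_i$. For $r=\sum_{t=1}^ma_tx_{i_t}\in F(\mathcal{A})$ with all $a_t\neq0$ put $\partial(r)=\sum_{t=1}^ma_t\,x_{i_1}\cdots\widehat{x_{i_t}}\cdots x_{i_m}$. The Orlik-Terao ideal is $I(\mathcal{A})=(\partial(r):r\in F(\mathcal{A}))\subset S$. An ordering $\prec$ of $[n]$ means a linear ordering; an induced monomial order on $S$ is a monomial order for which $x_i$ is smaller than $x_j$ whenever $i\prec j$ (the initial ideal $\mathrm{in}_\prec(I(\mathcal{A}))$ depends only on $\prec$). An ideal is a complete intersection if it is generated by a (possibly empty) regular sequence. A circuit is a minimal dependent set; the broken circuit of a circuit $C$ is $C-\{\min_\prec(C)\}$, where $\min_\prec(C)$ is its $\prec$-smallest element; minimal broken circuits are those minimal under inclusion. A subset $\mathfrak{D}\subseteq\mathfrak{C}$ is simple with respect to $\prec$ if for any distinct $C,C'\in\mathfrak{D}$ with $C\cap C'\neq\emptyset$ one has $C\cap C'=\{\min_\prec(C)\}$ or $C\cap C'=\{\min_\prec(C')\}$.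 The intersection graph of $\mathfrak{D}$ has vertex set $\mathfrak{D}$ and edges the pairs of distinct circuits with non-empty intersection; $\mathfrak{D}$ is a tree if this graph is a tree (in particular non-empty). Finally $\mathcal{C}(\mathfrak{D})=\bigcup_{D\in\mathfrak{D}}D-\bigcup_{D,D'\in\mathfrak{D},\,D\neq D'}(D\cap D')$. *)

theory Defs
  imports Complex_Main "HOL-Library.Poly_Mapping" "HOL-Algebra.Ideal"
begin

section \<open>Hyperplanes and the matroid of an arrangement\<close>

definition linear_hyperplane :: "('k::field \<Rightarrow> 'v::ab_group_add \<Rightarrow> 'v) \<Rightarrow> 'v set \<Rightarrow> bool" where
  "linear_hyperplane scale W \<longleftrightarrow>
     module.subspace scale W \<and> vector_space.dim scale W + 1 = vector_space.dim scale UNIV"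

text \<open>Linear independence is that of the indexed family, not of its set of members; an element of
  the dual space vanishes if and only if it vanishes at every vector. The index set is meant to be
  finite.\<close>
definition independent_family :: "('i \<Rightarrow> 'v \<Rightarrow> 'k::field) \<Rightarrow> 'i set \<Rightarrow> bool" where
  "independent_family \<alpha> J \<longleftrightarrow>
     (\<forall>c. (\<forall>v. (\<Sum>i\<in>J. c i * \<alpha> i v) = 0) \<longrightarrow> (\<forall>i\<in>J. c i = 0))"

text \<open>A matroid is given by its ground set and its family of independent sets.\<close>
definition matroid_circuits :: "'i set \<Rightarrow> 'i set set \<Rightarrow> 'i set set" where
  "matroid_circuits E \<I> = {C. C \<subseteq> E \<and> C \<notin> \<I> \<and> (\<forall>D. D \<subset> C \<longrightarrow> D \<in> \<I>)}"

definition arrangement_indep :: "nat \<Rightarrow> (nat \<Rightarrow> 'v \<Rightarrow> 'k::field) \<Rightarrow> nat set set" where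
  "arrangement_indep n \<alpha> = {J. J \<subseteq> {1..n} \<and> independent_family \<alpha> J}"

definition arrangement_circuits :: "nat \<Rightarrow> (nat \<Rightarrow> 'v \<Rightarrow> 'k::field) \<Rightarrow> nat set set" where
  "arrangement_circuits n \<alpha> = matroid_circuits {1..n} (arrangement_indep n \<alpha>)"


section \<open>Broken circuits and simple families of circuits\<close>

text \<open>Orderings are reflexive relations \<open>r\<close> with \<^term>\<open>linear_order_on A r\<close>, where
  \<^term>\<open>(i, j) \<in> r\<close> means that \<open>i\<close> equals or precedes \<open>j\<close>.\<close>
definition min_wrt :: "'i rel \<Rightarrow> 'i set \<Rightarrow> 'i" where
  "min_wrt r C = (THE i. i \<in> C \<and> (\<forall>j\<in>C. (i, j) \<in> r))"

definition broken_circuits :: "'i rel \<Rightarrow> 'i set set \<Rightarrow> 'i set set" where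
  "broken_circuits r \<CC> = (\<lambda>C. C - {min_wrt r C}) ` \<CC>"

definition minimal_broken_circuits :: "'i rel \<Rightarrow> 'i set set \<Rightarrow> 'i set set" where
  "minimal_broken_circuits r \<CC> =
     {B \<in> broken_circuits r \<CC>. \<forall>B'\<in>broken_circuits r \<CC>. \<not> B' \<subset> B}"

definition simple_family :: "'i rel \<Rightarrow> 'i set set \<Rightarrow> bool" where
  "simple_family r \<DD> \<longleftrightarrow>
     (\<forall>C\<in>\<DD>. \<forall>C'\<in>\<DD>. C \<noteq> C' \<and> C \<inter> C' \<noteq> {} \<longrightarrow>
        C \<inter> C' = {min_wrt r C} \<or> C \<inter> C' = {min_wrt r C'})"

text \<open>A simple undirected graph is given by its vertices and a symmetric, irreflexive adjacency
  relation on them.\<close>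
definition intersection_graph :: "'i set set \<Rightarrow> ('i set \<times> 'i set) set" where
  "intersection_graph \<DD> = {(C, C'). C \<in> \<DD> \<and> C' \<in> \<DD> \<and> C \<noteq> C' \<and> C \<inter> C' \<noteq> {}}"

definition graph_cycle :: "'a set \<Rightarrow> ('a \<times> 'a) set \<Rightarrow> 'a list \<Rightarrow> bool" where
  "graph_cycle V E p \<longleftrightarrow>
     set p \<subseteq> V \<and> length p \<ge> 3 \<and> distinct p \<and>
     successively (\<lambda>u v. (u, v) \<in> E) p \<and> (last p, hd p) \<in> E"

definition graph_tree :: "'a set \<Rightarrow> ('a \<times> 'a) set \<Rightarrow> bool" where
  "graph_tree V E \<longleftrightarrow>
     V \<noteq> {} \<and> (\<forall>u\<in>V. \<forall>v\<in>V. (u, v) \<in> E\<^sup>*) \<and> (\<nexists>p. graph_cycle V E p)"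

definition tree_family :: "'i set set \<Rightarrow> bool" where
  "tree_family \<DD> \<longleftrightarrow> graph_tree \<DD> (intersection_graph \<DD>)"

definition combined_circuit :: "'i set set \<Rightarrow> 'i set" where
  "combined_circuit \<DD> = \<Union>\<DD> - \<Union>{D \<inter> D' | D D'. D \<in> \<DD> \<and> D' \<in> \<DD> \<and> D \<noteq> D'}"


section \<open>The polynomial ring and complete intersections\<close>

text \<open>A monomial is its exponent vector, a finitely supported function on the variable indices,
  and a polynomial is a finitely supported function from monomials to coefficients; the
  multiplication of \<^typ>\<open>(nat \<Rightarrow>\<^sub>0 nat) \<Rightarrow>\<^sub>0 'k::field\<close> is the convolution product. The ring in the
  variables indexed by \<^term>\<open>{1..n}\<close> is a subring of this type, and ideals, regular
  sequences etc. are always those of this subring.\<close>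
type_synonym 'k mpolynomial = "(nat \<Rightarrow>\<^sub>0 nat) \<Rightarrow>\<^sub>0 'k"

definition monomials :: "nat \<Rightarrow> (nat \<Rightarrow>\<^sub>0 nat) set" where
  "monomials n = {m. Poly_Mapping.keys m \<subseteq> {1..n}}"

definition polynomial_ring :: "nat \<Rightarrow> 'k::field mpolynomial ring" where
  "polynomial_ring n =
     \<lparr>carrier = {p. Poly_Mapping.keys p \<subseteq> monomials n},
      monoid.mult = (*), one = 1, ring.zero = 0, add = (+)\<rparr>"

definition var_exp :: "nat \<Rightarrow> (nat \<Rightarrow>\<^sub>0 nat)" where
  "var_exp i = Poly_Mapping.single i 1"

definition mono_poly :: "(nat \<Rightarrow>\<^sub>0 nat) \<Rightarrow> 'k::field mpolynomial" where
  "mono_poly m = Poly_Mapping.single m 1"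

definition const_poly :: "'k::field \<Rightarrow> 'k mpolynomial" where
  "const_poly a = Poly_Mapping.single 0 a"

text \<open>Each \<open>f\<^sub>i\<close> is a nonzerodivisor modulo the preceding ones, and the quotient by all of them is
  nonzero.\<close>
definition regular_sequence :: "('a, 'b) ring_scheme \<Rightarrow> 'a list \<Rightarrow> bool" where
  "regular_sequence R fs \<longleftrightarrow>
     set fs \<subseteq> carrier R \<and>
     (\<forall>i<length fs. \<forall>g\<in>carrier R.
        fs ! i \<otimes>\<^bsub>R\<^esub> g \<in> genideal R (set (take i fs)) \<longrightarrow> g \<in> genideal R (set (take i fs))) \<and>
     genideal R (set fs) \<noteq> carrier R"

definition complete_intersection :: "('a, 'b) ring_scheme \<Rightarrow> 'a set \<Rightarrow> bool" where
  "complete_intersection R I \<longleftrightarrow> (\<exists>fs. regular_sequence R fs \<and> I = genideal R (set fs))"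


section \<open>The Orlik-Terao ideal\<close>

text \<open>The formal sum of the \<open>a\<^sub>i x\<^sub>i\<close> is the finitely supported function \<open>i \<mapsto> a\<^sub>i\<close>, whose keys are
  the indices with nonzero coefficient.\<close>
definition relation_space :: "nat \<Rightarrow> (nat \<Rightarrow> 'v \<Rightarrow> 'k::field) \<Rightarrow> (nat \<Rightarrow>\<^sub>0 'k) set" where
  "relation_space n \<alpha> =
     {r. Poly_Mapping.keys r \<subseteq> {1..n} \<and> (\<forall>v. (\<Sum>i\<in>{1..n}. Poly_Mapping.lookup r i * \<alpha> i v) = 0)}"

definition relation_boundary :: "(nat \<Rightarrow>\<^sub>0 'k::field) \<Rightarrow> 'k mpolynomial" where
  "relation_boundary r =
     (\<Sum>i\<in>Poly_Mapping.keys r. const_poly (Poly_Mapping.lookup r i) *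
        (\<Prod>j\<in>Poly_Mapping.keys r - {i}. mono_poly (var_exp j)))"

definition orlik_terao_ideal :: "nat \<Rightarrow> (nat \<Rightarrow> 'v \<Rightarrow> 'k::field) \<Rightarrow> 'k mpolynomial set" where
  "orlik_terao_ideal n \<alpha> = genideal (polynomial_ring n) (relation_boundary ` relation_space n \<alpha>)"


section \<open>Monomial orders and initial ideals\<close>

text \<open>A monomial is multiplied by another one by adding the exponent vectors.\<close>
definition monomial_order :: "nat \<Rightarrow> (nat \<Rightarrow>\<^sub>0 nat) rel \<Rightarrow> bool" where
  "monomial_order n R \<longleftrightarrow>
     linear_order_on (monomials n) R \<and>
     (\<forall>m\<in>monomials n. (0, m) \<in> R) \<and>
     (\<forall>a b. \<forall>c\<in>monomials n. (a, b) \<in> R \<longrightarrow> (a + c, b + c) \<in> R)"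

definition induced_monomial_order :: "nat \<Rightarrow> nat rel \<Rightarrow> (nat \<Rightarrow>\<^sub>0 nat) rel \<Rightarrow> bool" where
  "induced_monomial_order n r R \<longleftrightarrow>
     monomial_order n R \<and>
     (\<forall>i\<in>{1..n}. \<forall>j\<in>{1..n}. (i, j) \<in> r \<longrightarrow> (var_exp i, var_exp j) \<in> R)"

definition leading_monomial :: "(nat \<Rightarrow>\<^sub>0 nat) rel \<Rightarrow> 'k::field mpolynomial \<Rightarrow> (nat \<Rightarrow>\<^sub>0 nat)" where
  "leading_monomial R p =
     (THE m. m \<in> Poly_Mapping.keys p \<and> (\<forall>m'\<in>Poly_Mapping.keys p. (m', m) \<in> R))"

definition initial_ideal :: "nat \<Rightarrow> (nat \<Rightarrow>\<^sub>0 nat) rel \<Rightarrow> 'k::field mpolynomial set \<Rightarrow> 'k mpolynomial set"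
  where
  "initial_ideal n R I =
     genideal (polynomial_ring n) {mono_poly (leading_monomial R p) | p. p \<in> I \<and> p \<noteq> 0}"


section \<open>Well-formedness of the encoding\<close>

lemma monomials_0 [simp]: "0 \<in> monomials n"
  by (simp add: monomials_def)

lemma monomials_add: "a \<in> monomials n \<Longrightarrow> b \<in> monomials n \<Longrightarrow> a + b \<in> monomials n"
  using Poly_Mapping.keys_add[of a b] by (auto simp: monomials_def)

lemma polynomial_ring_simps [simp]:
  "p \<in> carrier (polynomial_ring n) \<longleftrightarrow> Poly_Mapping.keys p \<subseteq> monomials n"
  "p \<otimes>\<^bsub>polynomial_ring n\<^esub> q = p * q" "p \<oplus>\<^bsub>polynomial_ring n\<^esub> q = p + q"
  "\<one>\<^bsub>polynomial_ring n\<^esub> = 1" "\<zero>\<^bsub>polynomial_ring n\<^esub> = 0"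
  by (simp_all add: polynomial_ring_def)

lemma keys_mult_monomials:
  fixes p q :: "'k::field mpolynomial"
  assumes "Poly_Mapping.keys p \<subseteq> monomials n" "Poly_Mapping.keys q \<subseteq> monomials n"
  shows "Poly_Mapping.keys (p * q) \<subseteq> monomials n"
  using Poly_Mapping.keys_mult[of p q] assms monomials_add by blast

lemma cring_polynomial_ring: "cring (polynomial_ring n :: 'k::field mpolynomial ring)"
proof (rule cringI)
  show "abelian_group (polynomial_ring n :: 'k mpolynomial ring)"
  proof (rule abelian_groupI)
    fix x y :: "'k mpolynomial"
    assume "x \<in> carrier (polynomial_ring n)" "y \<in> carrier (polynomial_ring n)"
    then show "x \<oplus>\<^bsub>polynomial_ring n\<^esub> y \<in> carrier (polynomial_ring n)"
      using Poly_Mapping.keys_add[of x y] by auto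
  next
    fix x :: "'k mpolynomial"
    assume "x \<in> carrier (polynomial_ring n)"
    then show "\<exists>y\<in>carrier (polynomial_ring n). y \<oplus>\<^bsub>polynomial_ring n\<^esub> x = \<zero>\<^bsub>polynomial_ring n\<^esub>"
      by (intro bexI[of _ "- x"]) auto
  qed (auto simp: add_ac)
  show "Group.comm_monoid (polynomial_ring n :: 'k mpolynomial ring)"
    by (rule comm_monoidI) (auto simp: mult_ac dest: keys_mult_monomials[THEN subsetD, rotated 2])
qed (auto simp: algebra_simps)

lemma mono_poly_in_carrier:
  "mono_poly m \<in> carrier (polynomial_ring n :: 'k::field mpolynomial ring) \<longleftrightarrow> m \<in> monomials n"
  by (simp add: mono_poly_def)

lemma relation_boundary_in_carrier:
  assumes "Poly_Mapping.keys r \<subseteq> {1..n}"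
  shows "relation_boundary r \<in> carrier (polynomial_ring n)"
proof -
  have v: "Poly_Mapping.keys (\<Prod>j\<in>A. mono_poly (var_exp j) :: 'a mpolynomial) \<subseteq> monomials n"
    if "finite A" "A \<subseteq> {1..n}" for A
    using that
  proof (induction A rule: finite_induct)
    case (insert x A)
    have "Poly_Mapping.keys (mono_poly (var_exp x) :: 'a mpolynomial) \<subseteq> monomials n"
      using insert.prems by (simp add: mono_poly_def var_exp_def monomials_def)
    then show ?case
      using insert keys_mult_monomials by simp
  qed simp
  have "Poly_Mapping.keys (const_poly (Poly_Mapping.lookup r i) *
      (\<Prod>j\<in>Poly_Mapping.keys r - {i}. mono_poly (var_exp j))) \<subseteq> monomials n" for i
    using assms by (intro keys_mult_monomials v) (auto simp: const_poly_def)
  then show ?thesis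
    unfolding relation_boundary_def polynomial_ring_simps
    using Poly_Mapping.keys_sum by (fastforce)
qed

end

theory Submission
  imports Defs
begin

text \<open>Let \<open>F\<close> be the space of linear relations among the functionals \<open>\<alpha>\<^sub>i\<close>. Only two properties of it matter: it is
  a linear space, and a nonzero relation involves at least three functionals because the
  hyperplanes are distinct. The circuits are the minimal supports of nonzero elements of \<open>F\<close>, so everything can
  be said in terms of \<open>F\<close>; this is the setting of the locale \<open>relations\<close>.

  \<^emph>\<open>Disjoint broken circuits suffice.\<close> For every ordering, the boundaries of the relations are a
  Groebner basis of the Orlik-Terao ideal, so the initial ideal is generated by the monomials of the
  broken circuits (\<open>leading_broken_circuit\<close>). The monomials whose support contains no
  broken circuit, the nbc monomials, are therefore a basis of the quotient ring. If the minimal broken circuits are pairwise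
  disjoint, then their monomials are pairwise coprime. Polynomials with pairwise coprime leading monomials
  form a regular sequence (\<open>coprime_leading_regular\<close>). Applied to the boundaries of the corresponding circuits and to
  the monomials themselves, this shows that the Orlik-Terao ideal and the initial ideal are complete intersections.

  \<^emph>\<open>Disjoint broken circuits are necessary.\<close> Dimension theory enters through two counting arguments: a regular
  sequence of length \<open>c\<close> leaves a quotient of dimension at most \<open>n - c\<close> (\<open>regular_bound\<close>), and
  \<open>p\<close> equations without constant term leave one of dimension at least \<open>n - p\<close> (\<open>spanning_bound\<close>). Let the
  Orlik-Terao ideal be generated by a regular sequence of length \<open>c\<close>. By Nakayama's lemma it is
  generated near the origin by boundaries of at most \<open>c\<close> relations (\<open>few_generators\<close>). Fix a
  nonempty set \<open>T\<close> of variables. A boundary whose support meets \<open>T\<close> at least twice lies in the ideal of the variables in \<open>T\<close>. If there were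
  at least \<open>|T|\<close> such generators, replacing them by the variables in \<open>T\<close> would give at most \<open>c\<close> equations whose
  solution set is too small, since nbc sets avoiding the first element of an ordering are not maximal
  (\<open>generators_sparse\<close>). So the supports of the generators form a sparse hypergraph, that is, one without cycles. Such a
  hypergraph can be ordered from the roots to the leaves, and then the broken circuits of its members are disjoint
  (\<open>sparse_ordering\<close>). A dimension count shows that the generating relations span \<open>F\<close>, and then every broken
  circuit contains one of these (\<open>broken_circuit_cover\<close>).
  For the initial ideal the argument is shorter: if two minimal broken circuits share the element \<open>v\<close>, then
  \<open>x\<^sub>v\<close> can replace both generators.

  \<^emph>\<open>Simple families.\<close> Disjointness of the broken circuits says that a family \<open>D\<close> of circuits is a
  rooted forest: a member is attached to its parent at its minimum (locale \<open>broken_forest\<close>). A combination of relations of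
  the members has a minimal support exactly if it is formed along a tree and cancels all common points
  (\<open>circuits_eq_combined\<close>). Conversely, the broken circuit of the combined circuit of a tree contains the
  broken circuit of a member (\<open>broken_circuit_of_once_covered\<close>), because one of the leaves of the tree survives
  untouched.\<close>

section \<open>Finitely supported functions as a vector space\<close>

abbreviation keys :: "('a \<Rightarrow>\<^sub>0 'b::zero) \<Rightarrow> 'a set" where "keys \<equiv> Poly_Mapping.keys"
abbreviation lookup :: "('a \<Rightarrow>\<^sub>0 'b::zero) \<Rightarrow> 'a \<Rightarrow> 'b" where "lookup \<equiv> Poly_Mapping.lookup"
abbreviation single :: "'a \<Rightarrow> 'b::zero \<Rightarrow> 'a \<Rightarrow>\<^sub>0 'b" where "single \<equiv> Poly_Mapping.single"

definition pscale :: "'k::field \<Rightarrow> ('a \<Rightarrow>\<^sub>0 'k) \<Rightarrow> ('a \<Rightarrow>\<^sub>0 'k)" where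
  "pscale c p = Poly_Mapping.map ((*) c) p"

lemma lookup_pscale [simp]: "lookup (pscale c p) x = c * lookup p x"
  by (simp add: pscale_def Poly_Mapping.map.rep_eq when_def)

lemma vector_space_pscale:
  "vector_space (pscale :: 'k::field \<Rightarrow> ('a \<Rightarrow>\<^sub>0 'k) \<Rightarrow> ('a \<Rightarrow>\<^sub>0 'k))"
  by (rule vector_space.intro; rule poly_mapping_eqI;
    simp only: lookup_pscale lookup_add distrib_left distrib_right mult.assoc mult_1)

interpretation pm: vector_space "pscale :: 'k::field \<Rightarrow> ('a \<Rightarrow>\<^sub>0 'k) \<Rightarrow> ('a \<Rightarrow>\<^sub>0 'k)"
  by (rule vector_space_pscale)

interpretation pmp: vector_space_pair "pscale :: 'k::field \<Rightarrow> ('a \<Rightarrow>\<^sub>0 'k) \<Rightarrow> ('a \<Rightarrow>\<^sub>0 'k)"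
  "pscale :: 'k::field \<Rightarrow> ('b \<Rightarrow>\<^sub>0 'k) \<Rightarrow> ('b \<Rightarrow>\<^sub>0 'k)" ..

lemma keys_pscale [simp]: "c \<noteq> 0 \<Longrightarrow> keys (pscale c p) = keys p"
  by (auto simp: in_keys_iff)

lemma keys_pscale_subset: "keys (pscale c p) \<subseteq> keys p"
  by (auto simp: in_keys_iff)

lemma single_eq_pscale: "single m c = pscale c (single m 1)"
  by (rule poly_mapping_eqI) (simp add: lookup_single when_def)

lemma const_poly_mult: "const_poly c * p = pscale c p"
  by (simp add: const_poly_def pscale_def mult_map_scale_conv_mult)

lemma pscale_mult_left: "pscale c p * q = pscale c (p * q :: 'k::field mpolynomial)"
  by (simp add: mult.assoc flip: const_poly_mult)

lemma pscale_mult_right: "p * pscale c q = pscale c (p * q :: 'k::field mpolynomial)"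
  by (metis pscale_mult_left mult.commute)

lemma sum_pscale_single:
  assumes "finite A" "keys p \<subseteq> A"
  shows "(\<Sum>m\<in>A. pscale (lookup p m) (single m 1)) = p"
proof (rule poly_mapping_eqI)
  fix x
  have "lookup (\<Sum>m\<in>A. pscale (lookup p m) (single m 1)) x = (\<Sum>m\<in>A. if m = x then lookup p x else 0)"
    unfolding lookup_sum by (rule sum.cong) (auto simp: lookup_single when_def)
  also have "\<dots> = lookup p x"
    using assms by (auto simp: in_keys_iff)
  finally show "lookup (\<Sum>m\<in>A. pscale (lookup p m) (single m 1)) x = lookup p x" .
qed

lemma single_one_inject [simp]: "single m (1::'k::field) = single m' 1 \<longleftrightarrow> m = m'"
  by (metis keys_single one_neq_zero singleton_inject)

definition proj :: "'a set \<Rightarrow> ('a \<Rightarrow>\<^sub>0 'k::field) \<Rightarrow> ('a \<Rightarrow>\<^sub>0 'k)" where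
  "proj A p = (\<Sum>m\<in>A. pscale (lookup p m) (single m 1))"

lemma lookup_proj: "finite A \<Longrightarrow> lookup (proj A p) x = (if x \<in> A then lookup p x else 0)"
proof -
  assume "finite A"
  have "lookup (proj A p) x = (\<Sum>m\<in>A. if m = x then lookup p x else 0)"
    unfolding proj_def lookup_sum by (rule sum.cong) (auto simp: lookup_single when_def)
  then show ?thesis using \<open>finite A\<close> by simp
qed

lemma proj_in_span: "proj A p \<in> pm.span ((\<lambda>m. single m 1) ` A)"
  unfolding proj_def by (intro pm.span_sum pm.span_scale pm.span_base) auto

lemma linear_proj: "finite A \<Longrightarrow> Vector_Spaces.linear pscale pscale (proj A)"
  unfolding Vector_Spaces.linear_iff
  by (auto intro!: poly_mapping_eqI pm.vector_space_axioms simp: lookup_proj lookup_add)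

lemma independent_singles:
  fixes A :: "'a set"
  shows "pm.independent ((\<lambda>m. single m 1 :: 'a \<Rightarrow>\<^sub>0 'k::field) ` A)"
  unfolding pm.independent_explicit_module
proof (intro allI impI)
  fix S :: "('a \<Rightarrow>\<^sub>0 'k) set" and f x
  assume fin: "finite S" and sub: "S \<subseteq> (\<lambda>m. single m 1) ` A"
    and sum0: "(\<Sum>v\<in>S. pscale (f v) v) = 0" and x: "x \<in> S"
  obtain m where m: "x = single m 1" using sub x by auto
  have "0 = lookup (\<Sum>x\<in>S. pscale (f x) x) m" using sum0 by simp
  also have "\<dots> = (\<Sum>y\<in>S. if y = x then f x else 0)"
    unfolding lookup_sum
  proof (rule sum.cong)
    fix y assume "y \<in> S"
    then obtain m' where "y = single m' 1" using sub by auto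
    then show "lookup (pscale (f y) y) m = (if y = x then f x else 0)"
      using m by (auto simp: lookup_single when_def)
  qed simp
  finally show "f x = 0" using fin x by simp
qed

section \<open>Ideals of the polynomial ring as linear spans\<close>

definition polys :: "nat \<Rightarrow> 'k::field mpolynomial set" where
  "polys n = {p. keys p \<subseteq> monomials n}"

lemma carrier_polynomial_ring [simp]: "carrier (polynomial_ring n) = polys n"
  by (auto simp: polys_def)

lemma mpoly_expand: "p = (\<Sum>m\<in>keys p. pscale (lookup p m) (mono_poly m))"
  unfolding mono_poly_def by (simp add: sum_pscale_single)

lemma subspace_polys [simp]: "pm.subspace (polys n :: 'a::field mpolynomial set)"
proof (rule pm.subspaceI)
  show "x + y \<in> polys n" if "x \<in> polys n" "y \<in> polys n" for x y :: "'a mpolynomial"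
    using that Poly_Mapping.keys_add[of x y] by (auto simp: polys_def)
  show "pscale c x \<in> polys n" if "x \<in> polys n" for c and x :: "'a mpolynomial"
    using that keys_pscale_subset[of c x] by (auto simp: polys_def)
qed (simp add: polys_def)

lemma polys_mult: "p \<in> polys n \<Longrightarrow> q \<in> polys n \<Longrightarrow> p * q \<in> polys n"
  using keys_mult_monomials[of p n q] by (simp add: polys_def)

lemma mono_poly_in_polys [simp]: "mono_poly m \<in> polys n \<longleftrightarrow> m \<in> monomials n"
  by (simp add: polys_def mono_poly_def)

lemma one_in_polys [simp]: "1 \<in> polys n"
  by (simp add: polys_def)

lemma zero_in_polys [simp]: "0 \<in> polys n"
  by (simp add: polys_def)

lemma polys_power: "p \<in> polys n \<Longrightarrow> p ^ k \<in> polys n"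
  by (induction k) (auto intro: polys_mult)

lemma mono_poly_mult: "mono_poly a * mono_poly b = mono_poly (a + b)"
  by (simp add: mono_poly_def mult_single)

lemma polys_eq_span: "(polys n :: 'a::field mpolynomial set) = pm.span (mono_poly ` monomials n)"
proof
  show "(polys n :: 'a mpolynomial set) \<subseteq> pm.span (mono_poly ` monomials n)"
  proof
    fix p :: "'a mpolynomial" assume "p \<in> polys n"
    then show "p \<in> pm.span (mono_poly ` monomials n)"
      by (subst mpoly_expand[of p], intro pm.span_sum pm.span_scale pm.span_base) (auto simp: polys_def)
  qed
  show "pm.span (mono_poly ` monomials n) \<subseteq> (polys n :: 'a mpolynomial set)"
    by (rule pm.span_minimal) auto
qed

definition pideal :: "nat \<Rightarrow> 'k::field mpolynomial set \<Rightarrow> 'k mpolynomial set" where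
  "pideal n A = pm.span {mono_poly m * a | m a. m \<in> monomials n \<and> a \<in> A}"

lemma subspace_pideal [simp]: "pm.subspace (pideal n A)"
  by (simp add: pideal_def)

lemmas pideal_closed = pm.subspace_0[OF subspace_pideal] pm.subspace_add[OF subspace_pideal]
  pm.subspace_diff[OF subspace_pideal] pm.subspace_neg[OF subspace_pideal]
  pm.subspace_scale[OF subspace_pideal] pm.subspace_sum[OF subspace_pideal]

lemma pideal_base: "a \<in> A \<Longrightarrow> a \<in> pideal n A"
proof -
  assume "a \<in> A"
  moreover have "a = mono_poly 0 * a" by (simp add: mono_poly_def)
  ultimately have "a \<in> {mono_poly m * a | m a. m \<in> monomials n \<and> a \<in> A}"
    using monomials_0 by blast
  then show ?thesis unfolding pideal_def by (rule pm.span_base)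
qed

lemma pideal_mono: "A \<subseteq> B \<Longrightarrow> pideal n A \<subseteq> pideal n B"
  unfolding pideal_def by (rule pm.span_mono) auto

lemma pideal_mono_mult:
  assumes "m \<in> monomials n" "q \<in> pideal n A"
  shows "mono_poly m * q \<in> pideal n A"
proof -
  have "pm.subspace {q. mono_poly m * q \<in> pideal n A}"
    unfolding pm.subspace_def
    by (auto simp: distrib_left pscale_mult_right intro: pideal_closed)
  moreover have "mono_poly m * (mono_poly m' * a) \<in> pideal n A" if "m' \<in> monomials n" "a \<in> A" for m' a
    unfolding pideal_def using that assms
    by (auto intro!: pm.span_base exI[of _ "m + m'"] exI[of _ a] monomials_add
      simp: mono_poly_mult mult.assoc[symmetric])
  ultimately have "pideal n A \<subseteq> {q. mono_poly m * q \<in> pideal n A}"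
    by (subst (1) pideal_def) (intro pm.span_minimal, auto)
  then show ?thesis using assms by auto
qed

lemma pideal_mult:
  assumes "p \<in> polys n" "q \<in> pideal n A"
  shows "p * q \<in> pideal n A"
proof -
  have "p * q = (\<Sum>m\<in>keys p. pscale (lookup p m) (mono_poly m * q))"
    by (subst mpoly_expand) (simp add: sum_distrib_right pscale_mult_left)
  also have "\<dots> \<in> pideal n A"
    using assms by (auto intro!: pideal_closed pideal_mono_mult simp: polys_def)
  finally show ?thesis .
qed

lemma pideal_minimal:
  assumes "A \<subseteq> J" "pm.subspace J" "\<And>m q. m \<in> monomials n \<Longrightarrow> q \<in> J \<Longrightarrow> mono_poly m * q \<in> J"
  shows "pideal n A \<subseteq> J"
  unfolding pideal_def using assms by (intro pm.span_minimal) auto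

lemma pideal_subset_iff: "pideal n A \<subseteq> pideal n B \<longleftrightarrow> A \<subseteq> pideal n B"
  by (meson pideal_base pideal_minimal pideal_mono_mult subset_iff subspace_pideal)

lemma pideal_subset_polys: "A \<subseteq> polys n \<Longrightarrow> pideal n A \<subseteq> polys n"
  by (rule pideal_minimal) (auto intro: polys_mult)

lemma pideal_empty [simp]: "pideal n {} = {0}"
  by (simp add: pideal_def)

lemma pideal_insert:
  "p \<in> pideal n (insert a A) \<longleftrightarrow> (\<exists>q\<in>polys n. p - q * a \<in> pideal n A)"
proof
  assume "\<exists>q\<in>polys n. p - q * a \<in> pideal n A"
  then obtain q where q: "q \<in> polys n" "p - q * a \<in> pideal n A" by auto
  have "p - q * a \<in> pideal n (insert a A)" using q pideal_mono[of A "insert a A" n] by auto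
  moreover have "q * a \<in> pideal n (insert a A)" using q by (intro pideal_mult pideal_base) auto
  ultimately show "p \<in> pideal n (insert a A)"
    using pideal_closed(2) by fastforce
next
  let ?J = "{p. \<exists>q\<in>polys n. p - q * a \<in> pideal n A}"
  assume p: "p \<in> pideal n (insert a A)"
  have "pideal n (insert a A) \<subseteq> ?J"
  proof (rule pideal_minimal)
    show "insert a A \<subseteq> ?J"
    proof
      fix x assume "x \<in> insert a A"
      moreover have "a \<in> ?J" by (auto intro!: bexI[of _ 1] pideal_closed(1))
      moreover have "x \<in> ?J" if "x \<in> A" using that by (auto intro!: bexI[of _ 0] pideal_base)
      ultimately show "x \<in> ?J" by auto
    qed
    show "pm.subspace ?J"
    proof (rule pm.subspaceI)
      show "0 \<in> ?J" by (auto intro!: bexI[of _ 0] pideal_closed)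
    next
      fix x y assume "x \<in> ?J" "y \<in> ?J"
      then obtain q r where "q \<in> polys n" "r \<in> polys n" "x - q * a \<in> pideal n A" "y - r * a \<in> pideal n A"
        by auto
      then have "q + r \<in> polys n" "(x + y) - (q + r) * a \<in> pideal n A"
        using pideal_closed(2)[of "x - q * a" n A "y - r * a"] pm.subspace_add[OF subspace_polys]
        by (auto simp: algebra_simps)
      then show "x + y \<in> ?J" by blast
    next
      fix c x assume "x \<in> ?J"
      then obtain q where "q \<in> polys n" "x - q * a \<in> pideal n A" by auto
      then have "pscale c q \<in> polys n" "pscale c x - pscale c q * a \<in> pideal n A"
        using pideal_closed(5)[of "x - q * a" n A c] pm.subspace_scale[OF subspace_polys]
        by (auto simp: pm.scale_right_diff_distrib pscale_mult_left)
      then show "pscale c x \<in> ?J" by blast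
    qed
    fix m x assume "m \<in> monomials n" "x \<in> ?J"
    then obtain q where "q \<in> polys n" "x - q * a \<in> pideal n A" "m \<in> monomials n" by auto
    then have "mono_poly m * q \<in> polys n" "mono_poly m * x - mono_poly m * q * a \<in> pideal n A"
      using pideal_mono_mult[of m n "x - q * a"]
      by (auto simp: algebra_simps intro!: polys_mult)
    then show "mono_poly m * x \<in> ?J" by blast
  qed
  then show "\<exists>q\<in>polys n. p - q * a \<in> pideal n A" using p by auto
qed

lemma genideal_polynomial_ring:
  assumes A: "A \<subseteq> polys n"
  shows "genideal (polynomial_ring n) A = pideal n A"
proof
  interpret cring "polynomial_ring n :: 'a mpolynomial ring" by (rule cring_polynomial_ring)
  have "ideal (pideal n A) (polynomial_ring n)"
  proof (rule idealI)
    show "ring (polynomial_ring n :: 'a mpolynomial ring)" by (rule ring_axioms)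
    show "subgroup (pideal n A) (add_monoid (polynomial_ring n))"
    proof (rule group.subgroupI)
      show "group (add_monoid (polynomial_ring n :: 'a mpolynomial ring))" by (rule a_group)
      show "pideal n A \<subseteq> carrier (add_monoid (polynomial_ring n :: 'a mpolynomial ring))"
        using pideal_subset_polys[OF A] by simp
      show "pideal n A \<noteq> {}" using pideal_closed(1) by auto
      fix p assume p: "p \<in> pideal n A"
      have "inv\<^bsub>add_monoid (polynomial_ring n)\<^esub> p = - p"
        using p pideal_subset_polys[OF A] pm.subspace_neg[OF subspace_polys, of p n]
        by (intro group.inv_equality[OF a_group]) (auto)
      then show "inv\<^bsub>add_monoid (polynomial_ring n)\<^esub> p \<in> pideal n A"
        using p pideal_closed(4) by auto
    qed (auto intro: pideal_closed)
  next
    fix a x :: "'a mpolynomial" assume "a \<in> pideal n A" "x \<in> carrier (polynomial_ring n)"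
    then show "x \<otimes>\<^bsub>polynomial_ring n\<^esub> a \<in> pideal n A" "a \<otimes>\<^bsub>polynomial_ring n\<^esub> x \<in> pideal n A"
      using pideal_mult[of x n a A] by (simp_all add: mult.commute)
  qed
  then show "genideal (polynomial_ring n) A \<subseteq> pideal n A"
    by (rule genideal_minimal) (auto intro: pideal_base)
  have J: "ideal (genideal (polynomial_ring n) A) (polynomial_ring n)"
    using A by (intro genideal_ideal) simp
  interpret J: ideal "genideal (polynomial_ring n) A" "polynomial_ring n" by (rule J)
  have sub: "genideal (polynomial_ring n) A \<subseteq> polys n"
    using J.Icarr by auto
  have mult: "p * q \<in> genideal (polynomial_ring n) A"
    if "p \<in> polys n" "q \<in> genideal (polynomial_ring n) A" for p q
    using J.I_l_closed[of q p] that by simp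
  show "pideal n A \<subseteq> genideal (polynomial_ring n) A"
  proof (rule pideal_minimal)
    show "A \<subseteq> genideal (polynomial_ring n) A" using A genideal_self by simp
    show "pm.subspace (genideal (polynomial_ring n) A)"
    proof (rule pm.subspaceI)
      show "0 \<in> genideal (polynomial_ring n) A"
        using J.zero_closed by simp
      show "x + y \<in> genideal (polynomial_ring n) A"
        if "x \<in> genideal (polynomial_ring n) A" "y \<in> genideal (polynomial_ring n) A" for x y
        using J.a_closed[OF that] by simp
      show "pscale c x \<in> genideal (polynomial_ring n) A"
        if "x \<in> genideal (polynomial_ring n) A" for c x
        using that unfolding const_poly_mult[symmetric]
        by (intro mult) (auto simp: const_poly_def polys_def)
    qed
  qed (auto intro: mult)
qed

lemma mono_poly_nonzero [simp]: "mono_poly m \<noteq> 0"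
  unfolding mono_poly_def by (metis keys_single keys_zero insert_not_empty one_neq_zero)

section \<open>Monomial orders and leading monomials\<close>

definition mdvd :: "(nat \<Rightarrow>\<^sub>0 nat) \<Rightarrow> (nat \<Rightarrow>\<^sub>0 nat) \<Rightarrow> bool" where
  "mdvd a b \<longleftrightarrow> (\<forall>x. lookup a x \<le> lookup b x)"

lemma mdvd_add_diff: "mdvd a b \<Longrightarrow> a + (b - a) = b"
  by (rule poly_mapping_eqI) (simp add: mdvd_def lookup_add lookup_minus)

lemma mdvd_add [simp]: "mdvd a (a + b)" "mdvd b (a + b)"
  by (simp_all add: mdvd_def lookup_add)

lemma diff_in_monomials: "b \<in> monomials n \<Longrightarrow> b - a \<in> monomials n"
  by (auto simp: monomials_def in_keys_iff lookup_minus)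

lemma mdvd_in_monomials: "mdvd a b \<Longrightarrow> b \<in> monomials n \<Longrightarrow> a \<in> monomials n"
  unfolding monomials_def mdvd_def
  by (metis (mono_tags, lifting) in_keys_iff le_zero_eq mem_Collect_eq subset_iff)

lemma mdvd_coprime_cancel:
  assumes "mdvd a (b + c)" "keys a \<inter> keys b = {}"
  shows "mdvd a c"
  unfolding mdvd_def
proof
  fix x
  show "lookup a x \<le> lookup c x"
  proof (cases "x \<in> keys a")
    case True
    then have "lookup b x = 0" using assms(2) by (auto simp: in_keys_iff)
    then show ?thesis using assms(1) by (metis mdvd_def lookup_add add_0)
  qed (simp add: in_keys_iff)
qed

lemma mono_subsequence_nat:
  fixes f :: "nat \<Rightarrow> nat"
  shows "\<exists>g :: nat \<Rightarrow> nat. strict_mono g \<and> mono (\<lambda>k. f (g k))"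
proof -
  obtain g :: "nat \<Rightarrow> nat" where g: "strict_mono g" "monoseq (\<lambda>k. f (g k))" using seq_monosub[of f] by blast
  show ?thesis
  proof (cases "incseq (\<lambda>k. f (g k))")
    case True then show ?thesis using g by auto
  next
    case False
    then have dec: "decseq (\<lambda>k. f (g k))" using g monoseq_iff by blast
    define m where "m = (LEAST x. x \<in> range (\<lambda>k. f (g k)))"
    have "m \<in> range (\<lambda>k. f (g k))" unfolding m_def by (rule LeastI) auto
    then obtain K where K: "f (g K) = m" by auto
    have "f (g (K + k)) = m" for k
    proof (rule antisym)
      show "f (g (K + k)) \<le> m" using dec K by (metis decseqD le_add1)
      show "m \<le> f (g (K + k))" unfolding m_def by (rule Least_le) auto
    qed
    then show ?thesis using g(1)
      by (intro exI[of _ "\<lambda>k. g (K + k)"]) (auto simp: strict_mono_def mono_def)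
  qed
qed

text \<open>This is Dickson's lemma: from any sequence of exponent vectors one can select a subsequence along which
  each exponent increases, one coordinate at a time.\<close>
lemma mono_subsequence_finite:
  fixes f :: "nat \<Rightarrow> 'a \<Rightarrow> nat"
  assumes "finite A"
  shows "\<exists>g :: nat \<Rightarrow> nat. strict_mono g \<and> (\<forall>i\<in>A. mono (\<lambda>k. f (g k) i))"
  using assms
proof (induction A)
  case empty show ?case by (rule exI[of _ id]) (simp add: strict_mono_def)
next
  case (insert x A)
  then obtain g :: "nat \<Rightarrow> nat" where g: "strict_mono g" "\<forall>i\<in>A. mono (\<lambda>k. f (g k) i)" by blast
  obtain h :: "nat \<Rightarrow> nat" where h: "strict_mono h" "mono (\<lambda>k. f (g (h k)) x)"
    using mono_subsequence_nat[of "\<lambda>k. f (g k) x"] by blast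
  have "mono (\<lambda>k. f (g (h k)) i)" if "i \<in> A" for i
    using g(2) h(1) that unfolding mono_def by (meson strict_mono_less_eq)
  then show ?case
    using g h by (intro exI[of _ "g \<circ> h"]) (auto simp: strict_mono_def)
qed

locale monomial_ordering =
  fixes n :: nat and R :: "(nat \<Rightarrow>\<^sub>0 nat) rel"
  assumes order: "monomial_order n R"
begin

abbreviation lt :: "(nat \<Rightarrow>\<^sub>0 nat) \<Rightarrow> (nat \<Rightarrow>\<^sub>0 nat) \<Rightarrow> bool" where
  "lt a b \<equiv> (a, b) \<in> R \<and> a \<noteq> b"

abbreviation lm :: "'k::field mpolynomial \<Rightarrow> (nat \<Rightarrow>\<^sub>0 nat)" where
  "lm p \<equiv> leading_monomial R p"

lemma R_subset: "(a, b) \<in> R \<Longrightarrow> a \<in> monomials n" "(a, b) \<in> R \<Longrightarrow> b \<in> monomials n"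
  using order unfolding monomial_order_def order_on_defs by auto

lemma R_refl: "a \<in> monomials n \<Longrightarrow> (a, a) \<in> R"
  using order unfolding monomial_order_def order_on_defs refl_on_def by auto

lemma R_trans: "(a, b) \<in> R \<Longrightarrow> (b, c) \<in> R \<Longrightarrow> (a, c) \<in> R"
  using order unfolding monomial_order_def order_on_defs trans_def by blast

lemma R_antisym: "(a, b) \<in> R \<Longrightarrow> (b, a) \<in> R \<Longrightarrow> a = b"
  using order unfolding monomial_order_def order_on_defs antisym_def by blast

lemma R_total: "a \<in> monomials n \<Longrightarrow> b \<in> monomials n \<Longrightarrow> (a, b) \<in> R \<or> lt b a"
  using order R_refl unfolding monomial_order_def order_on_defs total_on_def by metis

lemma R_add: "(a, b) \<in> R \<Longrightarrow> c \<in> monomials n \<Longrightarrow> (a + c, b + c) \<in> R"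
  using order unfolding monomial_order_def by blast

lemma lt_add: "lt a b \<Longrightarrow> c \<in> monomials n \<Longrightarrow> lt (a + c) (b + c)"
  using R_add by auto

lemma lt_trans: "lt a b \<Longrightarrow> (b, c) \<in> R \<Longrightarrow> lt a c" "(a, b) \<in> R \<Longrightarrow> lt b c \<Longrightarrow> lt a c"
  using R_trans R_antisym by blast+

lemma mdvd_R: "mdvd a b \<Longrightarrow> b \<in> monomials n \<Longrightarrow> (a, b) \<in> R"
proof -
  assume ab: "mdvd a b" "b \<in> monomials n"
  have "(0, b - a) \<in> R"
    using order ab diff_in_monomials unfolding monomial_order_def by blast
  from R_add[OF this mdvd_in_monomials[OF ab]] show ?thesis
    using mdvd_add_diff[OF ab(1)] by (simp add: add.commute)
qed

text \<open>An infinite descending sequence would, by Dickson's lemma, contain a monomial that divides a later one.\<close>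
lemma wf_lt: "wf {(a, b). lt a b}"
  unfolding wf_iff_no_infinite_down_chain
proof
  assume "\<exists>f. \<forall>i. (f (Suc i), f i) \<in> {(a, b). lt a b}"
  then obtain f where f: "\<And>i. lt (f (Suc i)) (f i)" by auto
  have desc: "lt (f j) (f i)" if "i < j" for i j
    using that
  proof (induction j)
    case (Suc j)
    show ?case
    proof (cases "i = j")
      case True then show ?thesis using f[of j] by simp
    next
      case False
      then have "(f j, f i) \<in> R" using Suc by simp
      with f[of j] show ?thesis by (rule lt_trans(1))
    qed
  qed simp
  obtain g :: "nat \<Rightarrow> nat" where g: "strict_mono g" "\<forall>i\<in>{1..n}. mono (\<lambda>k. lookup (f (g k)) i)"
    using mono_subsequence_finite[of "{1..n}" "\<lambda>k. lookup (f k)"] by blast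
  have "f (g 0) \<in> monomials n" "f (g 1) \<in> monomials n" using f R_subset by blast+
  moreover have "mdvd (f (g 0)) (f (g 1))"
    unfolding mdvd_def
  proof
    fix x
    show "lookup (f (g 0)) x \<le> lookup (f (g 1)) x"
    proof (cases "x \<in> {1..n}")
      case True
      then have "mono (\<lambda>k. lookup (f (g k)) x)" using g by blast
      then show ?thesis by (rule monoD) simp
    next
      case False
      then have "x \<notin> keys (f (g 0))" using \<open>f (g 0) \<in> monomials n\<close> unfolding monomials_def by blast
      then show ?thesis by (simp add: in_keys_iff)
    qed
  qed
  ultimately have "(f (g 0), f (g 1)) \<in> R" using mdvd_R by auto
  moreover have "lt (f (g 1)) (f (g 0))" using desc g(1) by (simp add: strict_mono_def)
  ultimately show False using R_antisym by blast
qed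

lemma lm_eqI: "m \<in> keys p \<Longrightarrow> (\<And>m'. m' \<in> keys p \<Longrightarrow> (m', m) \<in> R) \<Longrightarrow> lm p = m"
  unfolding leading_monomial_def using R_antisym by (intro the_equality) blast+

lemma ex_greatest: "finite A \<Longrightarrow> A \<noteq> {} \<Longrightarrow> A \<subseteq> monomials n \<Longrightarrow> \<exists>m\<in>A. \<forall>m'\<in>A. (m', m) \<in> R"
proof (induction A rule: finite_ne_induct)
  case (singleton x) then show ?case by (simp add: R_refl)
next
  case (insert x A)
  then obtain m where m: "m \<in> A" "\<forall>m'\<in>A. (m', m) \<in> R" by auto
  show ?case
  proof (cases "(x, m) \<in> R")
    case True then show ?thesis using m by auto
  next
    case False
    then have mx: "(m, x) \<in> R" using R_total[of x m] m insert.prems by auto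
    have "(m', x) \<in> R" if "m' \<in> insert x A" for m'
      using that m mx R_trans R_refl insert.prems by blast
    then show ?thesis by blast
  qed
qed

lemma lm_props:
  assumes "p \<in> polys n" "p \<noteq> 0"
  shows "lm p \<in> keys p" "m \<in> keys p \<Longrightarrow> (m, lm p) \<in> R"
proof -
  obtain m0 where m0: "m0 \<in> keys p" "\<forall>m'\<in>keys p. (m', m0) \<in> R"
    using ex_greatest[of "keys p"] assms unfolding polys_def by auto
  then have "lm p = m0" by (intro lm_eqI) auto
  then show "lm p \<in> keys p" "m \<in> keys p \<Longrightarrow> (m, lm p) \<in> R" using m0 by auto
qed

lemma lm_in_monomials: "p \<in> polys n \<Longrightarrow> p \<noteq> 0 \<Longrightarrow> lm p \<in> monomials n"
  using lm_props(1) unfolding polys_def by blast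

lemma lm_mono_poly [simp]: "m \<in> monomials n \<Longrightarrow> lm (mono_poly m) = m"
  by (rule lm_eqI) (auto simp: mono_poly_def R_refl)

lemma mult_expand:
  fixes p q :: "'k::field mpolynomial"
  shows "p * q = (\<Sum>a\<in>keys p. \<Sum>b\<in>keys q. single (a + b) (lookup p a * lookup q b))"
proof -
  have e: "p = (\<Sum>a\<in>keys p. single a (lookup p a))" for p :: "'k mpolynomial"
    by (subst (1) mpoly_expand[of p]) (simp add: mono_poly_def flip: single_eq_pscale)
  show ?thesis
    by (subst e[of p], subst e[of q]) (simp add: sum_product mult_single)
qed

lemma lm_mult:
  fixes p q :: "'k::field mpolynomial"
  assumes p: "p \<in> polys n" "p \<noteq> 0" and q: "q \<in> polys n" "q \<noteq> 0"
  shows "lm (p * q) = lm p + lm q" "p * q \<noteq> 0"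
    "lookup (p * q) (lm p + lm q) = lookup p (lm p) * lookup q (lm q)"
proof -
  have le: "(a + b, lm p + lm q) \<in> R \<and> (a + b = lm p + lm q \<longrightarrow> a = lm p \<and> b = lm q)"
    if "a \<in> keys p" "b \<in> keys q" for a b
  proof -
    have mon: "a \<in> monomials n" "b \<in> monomials n" "lm p \<in> monomials n"
      using that p q lm_in_monomials unfolding polys_def by auto
    have 1: "(a + b, lm p + b) \<in> R" using R_add lm_props(2)[OF p] that mon by auto
    have 2: "(lm p + b, lm p + lm q) \<in> R"
      using R_add[of b "lm q" "lm p"] lm_props(2)[OF q] that mon by (simp add: add.commute)
    have "a = lm p \<and> b = lm q" if "a + b = lm p + lm q"
    proof -
      have "lm p + b = lm p + lm q" using R_antisym[OF 2] 1 that by simp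
      then have "b = lm q" by simp
      then show ?thesis using that by simp
    qed
    then show ?thesis using 1 2 R_trans by blast
  qed
  have keys_le: "(m, lm p + lm q) \<in> R" if "m \<in> keys (p * q)" for m
  proof -
    obtain a b where "a \<in> keys p" "b \<in> keys q" "m = a + b"
      using \<open>m \<in> keys (p * q)\<close> Poly_Mapping.keys_mult[of p q] by blast
    then show ?thesis using le by auto
  qed
  have "lookup (p * q) (lm p + lm q) = (\<Sum>a\<in>keys p. \<Sum>b\<in>keys q.
      if a + b = lm p + lm q then lookup p a * lookup q b else 0)"
    unfolding mult_expand[of p q] lookup_sum by (auto intro!: sum.cong simp: lookup_single when_def)
  also have "\<dots> = (\<Sum>a\<in>keys p. if a = lm p then
      (\<Sum>b\<in>keys q. if b = lm q then lookup p (lm p) * lookup q (lm q) else 0) else 0)"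
    using le by (intro sum.cong) (auto intro!: sum.cong sum.neutral)
  also have "\<dots> = lookup p (lm p) * lookup q (lm q)"
    using lm_props(1)[OF p] lm_props(1)[OF q] by simp
  finally show l: "lookup (p * q) (lm p + lm q) = lookup p (lm p) * lookup q (lm q)" .
  moreover have "lookup p (lm p) * lookup q (lm q) \<noteq> 0"
    using lm_props(1)[OF p] lm_props(1)[OF q] by (simp add: in_keys_iff)
  ultimately have "lm p + lm q \<in> keys (p * q)" by (simp add: in_keys_iff)
  then show "lm (p * q) = lm p + lm q" "p * q \<noteq> 0"
    using keys_le by (auto intro: lm_eqI)
qed

lemma lm_less_cancel:
  fixes p q :: "'k::field mpolynomial"
  assumes p: "p \<in> polys n" "p \<noteq> 0" and q: "q \<in> polys n" "q \<noteq> 0" and eq: "lm p = lm q"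
    and d: "d = p - pscale (lookup p (lm p) / lookup q (lm q)) q"
  shows "d \<in> polys n" "d = 0 \<or> lt (lm d) (lm p)"
proof -
  show dp: "d \<in> polys n"
    unfolding d using p q by (intro pm.subspace_diff[OF subspace_polys] pm.subspace_scale[OF subspace_polys])
  show "d = 0 \<or> lt (lm d) (lm p)"
  proof (cases "d = 0")
    case False
    have "lookup d (lm p) = 0"
      unfolding d using eq lm_props(1)[OF q] by (simp add: lookup_minus in_keys_iff)
    then have "lm d \<noteq> lm p" using lm_props(1)[OF dp False] by (auto simp: in_keys_iff)
    moreover have "keys d \<subseteq> keys p \<union> keys q"
      unfolding d by (auto simp: in_keys_iff lookup_minus)
    then have "(lm d, lm p) \<in> R"
      using lm_props(1)[OF dp False] lm_props(2)[OF p] lm_props(2)[OF q] eq by auto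
    ultimately show ?thesis by simp
  qed simp
qed

text \<open>Division with remainder. Only the leading monomial of the remainder is controlled, which is all that is
  needed to detect membership in an ideal.\<close>
lemma reduce:
  fixes g :: "'k::field mpolynomial"
  assumes "\<And>f. f \<in> B \<Longrightarrow> f \<in> polys n \<and> f \<noteq> 0 \<and> f \<in> pideal n A"
    and "g \<in> polys n"
  shows "\<exists>g'\<in>polys n. g - g' \<in> pideal n A \<and> (g' = 0 \<or> (\<forall>f\<in>B. \<not> mdvd (lm f) (lm g')))"
  using assms(2)
proof (induction "lm g" arbitrary: g rule: wf_induct_rule[OF wf_lt])
  case (1 g)
  show ?case
  proof (cases "g = 0 \<or> (\<forall>f\<in>B. \<not> mdvd (lm f) (lm g))")
    case True
    then show ?thesis using 1 by (intro bexI[of _ g]) (auto simp: pideal_closed(1))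
  next
    case False
    then obtain f where f: "f \<in> B" "mdvd (lm f) (lm g)" and g0: "g \<noteq> 0" by auto
    note fB = assms(1)[OF f(1)]
    define c where "c = lm g - lm f"
    have c: "c \<in> monomials n"
      unfolding c_def using diff_in_monomials lm_in_monomials 1 g0 by auto
    let ?q = "mono_poly c * f"
    have q: "?q \<in> polys n" "?q \<noteq> 0" "lm ?q = lm g"
      using lm_mult[of "mono_poly c" f] fB c mdvd_add_diff[OF f(2)]
      by (auto simp: c_def add.commute intro: polys_mult)
    define d where "d = g - pscale (lookup g (lm g) / lookup ?q (lm ?q)) ?q"
    have d: "d \<in> polys n" "d = 0 \<or> lt (lm d) (lm g)"
      using lm_less_cancel[OF _ g0 q(1,2) q(3)[symmetric] d_def] 1 by auto
    have gd: "g - d \<in> pideal n A"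
      using fB c by (auto simp: d_def intro!: pideal_closed(5) pideal_mono_mult)
    show ?thesis
    proof (cases "d = 0")
      case True
      then show ?thesis using gd by (intro bexI[of _ 0]) auto
    next
      case False
      then obtain g' where "g' \<in> polys n" "d - g' \<in> pideal n A"
        "g' = 0 \<or> (\<forall>f\<in>B. \<not> mdvd (lm f) (lm g'))"
        using 1(1)[of d] d by auto
      moreover have "g - g' \<in> pideal n A"
        using pideal_closed(2)[OF gd \<open>d - g' \<in> pideal n A\<close>] by simp
      ultimately show ?thesis by blast
    qed
  qed
qed

text \<open>Division of an element of \<open>J\<close> by \<open>B\<close> leaves a remainder in \<open>J\<close> whose leading monomial is not divisible by those
  of \<open>B\<close>, so it vanishes.\<close>
lemma pideal_eqI_leading:
  fixes J :: "'k::field mpolynomial set"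
  assumes "J = pideal n A" "A \<subseteq> polys n" "B \<subseteq> J" "0 \<notin> B"
    and "\<And>p. p \<in> J \<Longrightarrow> p \<noteq> 0 \<Longrightarrow> \<exists>f\<in>B. mdvd (lm f) (lm p)"
  shows "J = pideal n B"
proof
  have J: "J \<subseteq> polys n" using assms pideal_subset_polys by blast
  show "pideal n B \<subseteq> J" using assms pideal_subset_iff by blast
  show "J \<subseteq> pideal n B"
  proof
    fix g assume g: "g \<in> J"
    have "f \<in> polys n \<and> f \<noteq> 0 \<and> f \<in> pideal n B" if "f \<in> B" for f
      using that assms J pideal_base by blast
    then obtain g' where g': "g - g' \<in> pideal n B" "g' = 0 \<or> (\<forall>f\<in>B. \<not> mdvd (lm f) (lm g'))"
      using reduce[of B B g] g J by blast
    have "g - (g - g') \<in> J"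
      using g g' \<open>pideal n B \<subseteq> J\<close> assms(1) pideal_closed(3) by blast
    then have "g' = 0" using assms(5)[of g'] g'(2) by auto
    then show "g \<in> pideal n B" using g' by simp
  qed
qed

text \<open>Write an element of the ideal as \<open>u + g f\<^sub>i\<close> with \<open>u\<close> in the ideal of the preceding elements and \<open>g\<close> reduced
  modulo it. The leading terms of the summands cannot cancel: otherwise the leading monomial of a preceding
  element would divide that of \<open>g f\<^sub>i\<close>, and, being coprime to that of \<open>f\<^sub>i\<close>, that of \<open>g\<close>.\<close>
lemma coprime_leading:
  fixes fs :: "'k::field mpolynomial list"
  assumes fs: "set fs \<subseteq> polys n" "0 \<notin> set fs"
    and cop: "\<And>i j. i < j \<Longrightarrow> j < length fs \<Longrightarrow> keys (lm (fs ! i)) \<inter> keys (lm (fs ! j)) = {}"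
    and "i \<le> length fs" "p \<in> pideal n (set (take i fs))" "p \<noteq> 0"
  shows "\<exists>f\<in>set (take i fs). mdvd (lm f) (lm p)"
  using assms(4-)
proof (induction i arbitrary: p)
  case (Suc i)
  let ?A = "set (take i fs)" and ?f = "fs ! i"
  have i: "i < length fs" using Suc by simp
  have f: "?f \<in> polys n" "?f \<noteq> 0" using fs i nth_mem by fastforce+
  have A: "?A \<subseteq> polys n" "0 \<notin> ?A" using fs set_take_subset[of i fs] by blast+
  have "set (take (Suc i) fs) = insert ?f ?A" using i by (simp add: take_Suc_conv_app_nth)
  then obtain q where q: "q \<in> polys n" "p - q * ?f \<in> pideal n ?A"
    using Suc.prems pideal_insert by metis
  have "f \<in> polys n \<and> f \<noteq> 0 \<and> f \<in> pideal n ?A" if "f \<in> ?A" for f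
    using that A pideal_base by blast
  then obtain g where g: "g \<in> polys n" "q - g \<in> pideal n ?A"
    "g = 0 \<or> (\<forall>f\<in>?A. \<not> mdvd (lm f) (lm g))"
    using reduce[of ?A ?A q] q by blast
  define u where "u = p - g * ?f"
  have "u = (p - q * ?f) + ?f * (q - g)" by (simp add: u_def algebra_simps)
  then have u: "u \<in> pideal n ?A" using q g f pideal_closed(2) pideal_mult by metis
  then have up: "u \<in> polys n" using pideal_subset_polys A by blast
  have sub: "?A \<subseteq> set (take (Suc i) fs)" by (simp add: set_take_subset_set_take)
  have fin: "?f \<in> set (take (Suc i) fs)" using i by (simp add: take_Suc_conv_app_nth)
  show ?case
  proof (cases "g = 0 \<or> u = 0")
    case True
    then consider "g = 0" | "g \<noteq> 0" "u = 0" by auto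
    then show ?thesis
    proof cases
      case 1 then have "p = u" by (simp add: u_def)
      then show ?thesis using Suc.IH[of u] u Suc.prems sub by auto
    next
      case 2 then have "p = g * ?f" by (simp add: u_def)
      then show ?thesis using lm_mult(1)[of g ?f] 2 g f by (intro bexI[OF _ fin]) simp
    qed
  next
    case False
    let ?v = "g * ?f"
    have v: "?v \<in> polys n" "?v \<noteq> 0" "lm ?v = lm g + lm ?f"
      using lm_mult[of g ?f] False f g by (auto intro: polys_mult)
    obtain h where h: "h \<in> ?A" "mdvd (lm h) (lm u)" using Suc.IH[of u] u False Suc.prems by auto
    obtain j where j: "j < i" "h = fs ! j" using h(1) i by (auto simp: in_set_conv_nth)
    have ne: "lm u \<noteq> lm ?v"
    proof
      assume "lm u = lm ?v"
      then have "mdvd (lm h) (lm ?f + lm g)" using h v by (simp add: add.commute)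
      then have "mdvd (lm h) (lm g)" using mdvd_coprime_cancel cop[of j i] j i by auto
      then show False using g(3) False h by auto
    qed
    have p: "p = u + ?v" by (simp add: u_def)
    have big: "lm (a + b) = lm b" if "a \<in> polys n" "b \<in> polys n" "a \<noteq> 0" "b \<noteq> 0" "lt (lm a) (lm b)"
      for a b :: "'k mpolynomial"
    proof (rule lm_eqI)
      have "lm b \<notin> keys a" using lm_props(2)[of a "lm b"] that R_antisym by blast
      then show "lm b \<in> keys (a + b)" using lm_props(1)[of b] that by (simp add: in_keys_iff lookup_add)
      fix m assume "m \<in> keys (a + b)"
      then have "m \<in> keys a \<or> m \<in> keys b" using Poly_Mapping.keys_add[of a b] by blast
      then show "(m, lm b) \<in> R" using lm_props(2) that R_trans by blast
    qed
    have "lt (lm u) (lm ?v) \<or> lt (lm ?v) (lm u)"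
      using R_total[of "lm u" "lm ?v"] lm_in_monomials up v False ne by blast
    then show ?thesis
    proof
      assume "lt (lm u) (lm ?v)"
      then have "lm p = lm ?f + lm g" using big[of u ?v] up v False p by (simp add: add.commute)
      then show ?thesis by (intro bexI[OF _ fin]) simp
    next
      assume "lt (lm ?v) (lm u)"
      then have "lm p = lm u" using big[of ?v u] up v False p by (simp add: add.commute)
      then show ?thesis using h sub by auto
    qed
  qed
qed simp

text \<open>If \<open>f\<^sub>i g\<close> lies in the ideal of the preceding elements, reduce \<open>g\<close> modulo this ideal. The leading monomial of a preceding
  element divides that of \<open>f\<^sub>i g\<close>, hence that of the reduced \<open>g\<close>, which must therefore be zero.\<close>
lemma coprime_leading_regular:
  fixes fs :: "'k::field mpolynomial list"
  assumes fs: "set fs \<subseteq> polys n" "0 \<notin> set fs"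
    and cop: "\<And>i j. i < j \<Longrightarrow> j < length fs \<Longrightarrow> keys (lm (fs ! i)) \<inter> keys (lm (fs ! j)) = {}"
    and proper: "\<And>f. f \<in> set fs \<Longrightarrow> lm f \<noteq> 0"
  shows "regular_sequence (polynomial_ring n) fs"
proof -
  have take: "genideal (polynomial_ring n) (set (take i fs)) = pideal n (set (take i fs))" for i
    using fs set_take_subset[of i fs] by (intro genideal_polynomial_ring) blast
  have full: "genideal (polynomial_ring n) (set fs) = pideal n (set fs)"
    using fs by (intro genideal_polynomial_ring)
  have nzd: "g \<in> pideal n (set (take i fs))"
    if i: "i < length fs" and g: "g \<in> polys n" and fg: "fs ! i * g \<in> pideal n (set (take i fs))" for i g
  proof -
    let ?A = "set (take i fs)" and ?f = "fs ! i"
    have f: "?f \<in> polys n" "?f \<noteq> 0" using fs i nth_mem by fastforce+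
    have A: "?A \<subseteq> polys n" "0 \<notin> ?A" using fs set_take_subset[of i fs] by blast+
    have "f \<in> polys n \<and> f \<noteq> 0 \<and> f \<in> pideal n ?A" if "f \<in> ?A" for f
      using that A pideal_base by blast
    then obtain g' where g': "g' \<in> polys n" "g - g' \<in> pideal n ?A"
      "g' = 0 \<or> (\<forall>f\<in>?A. \<not> mdvd (lm f) (lm g'))"
      using reduce[of ?A ?A g] g by blast
    have "?f * g - ?f * (g - g') \<in> pideal n ?A"
      using fg pideal_mult[OF f(1) g'(2)] by (rule pideal_closed(3))
    then have fg': "?f * g' \<in> pideal n ?A" by (simp add: algebra_simps)
    have "g' = 0"
    proof (rule ccontr)
      assume "g' \<noteq> 0"
      then have m: "lm (?f * g') = lm ?f + lm g'" "?f * g' \<noteq> 0" using lm_mult[of ?f g'] f g' by auto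
      obtain h where h: "h \<in> ?A" "mdvd (lm h) (lm (?f * g'))"
        using coprime_leading[OF fs cop _ fg' m(2)] i by auto
      obtain j where j: "j < i" "h = fs ! j" using h(1) i by (auto simp: in_set_conv_nth)
      have "mdvd (lm h) (lm g')" using mdvd_coprime_cancel cop[of j i] j i h m by auto
      then show False using g' h \<open>g' \<noteq> 0\<close> by auto
    qed
    then show ?thesis using g' by simp
  qed
  have "1 \<notin> pideal n (set fs)"
  proof
    assume "1 \<in> pideal n (set fs)"
    then obtain f where f: "f \<in> set fs" "mdvd (lm f) (lm (1 :: 'k mpolynomial))"
      using coprime_leading[OF fs cop, of "length fs" 1] by auto
    have "lm (1 :: 'k mpolynomial) = 0" using lm_mono_poly[of 0] by (simp add: mono_poly_def)
    then have "lm f = 0" using f(2) by (intro poly_mapping_eqI) (simp add: mdvd_def)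
    then show False using proper f by blast
  qed
  then have "pideal n (set fs) \<noteq> polys n" using one_in_polys by blast
  then show ?thesis unfolding regular_sequence_def using nzd fs by (auto simp: take full)
qed

end

section \<open>Orderings given by ranks\<close>

text \<open>Ranks in \<open>nat\<close> are easier to compute with than relations: minima, maxima and weights are those of numbers.\<close>
definition rank_order :: "nat \<Rightarrow> (nat \<Rightarrow> nat) \<Rightarrow> nat rel" where
  "rank_order n \<rho> = {(i, j). i \<in> {1..n} \<and> j \<in> {1..n} \<and> \<rho> i \<le> \<rho> j}"

lemma linear_order_rank_order:
  assumes "inj_on \<rho> {1..n}"
  shows "linear_order_on {1..n} (rank_order n \<rho>)"
  unfolding order_on_defs
proof (intro conjI)
  show "rank_order n \<rho> \<subseteq> {1..n} \<times> {1..n}" by (auto simp: rank_order_def)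
  show "refl_on {1..n} (rank_order n \<rho>)" by (simp add: refl_on_def rank_order_def)
  show "trans (rank_order n \<rho>)" by (rule transI) (auto simp: rank_order_def)
  show "antisym (rank_order n \<rho>)"
    by (rule antisymI) (auto simp: rank_order_def intro: inj_onD[OF assms])
  show "total_on {1..n} (rank_order n \<rho>)" by (auto simp: total_on_def rank_order_def)
qed

lemma ex_rank_order:
  assumes r: "linear_order_on {1..n} r"
  shows "\<exists>\<rho>. inj_on \<rho> {1..n} \<and> r = rank_order n \<rho>"
proof -
  define \<rho> where "\<rho> i = card {j. (j, i) \<in> r}" for i
  have sub: "(i, j) \<in> r \<Longrightarrow> i \<in> {1..n} \<and> j \<in> {1..n}" for i j
    using r unfolding order_on_defs by blast
  have fin: "finite {j. (j, i) \<in> r}" for i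
    by (rule finite_subset[of _ "{1..n}"]) (use sub in auto)
  have tr: "(i, j) \<in> r \<Longrightarrow> (j, k) \<in> r \<Longrightarrow> (i, k) \<in> r" for i j k
    using r unfolding order_on_defs trans_def by blast
  have as: "(i, j) \<in> r \<Longrightarrow> (j, i) \<in> r \<Longrightarrow> i = j" for i j
    using r unfolding order_on_defs antisym_def by blast
  have rf: "i \<in> {1..n} \<Longrightarrow> (i, i) \<in> r" for i
    using r unfolding order_on_defs refl_on_def by blast
  have tot: "i \<in> {1..n} \<Longrightarrow> j \<in> {1..n} \<Longrightarrow> (i, j) \<in> r \<or> (j, i) \<in> r" for i j
    using r rf[of i] by (cases "i = j") (auto simp: linear_order_on_def total_on_def)
  have le: "\<rho> i \<le> \<rho> j" if "(i, j) \<in> r" for i j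
    unfolding \<rho>_def using fin that tr by (intro card_mono) blast+
  have lt: "\<rho> i < \<rho> j" if "(i, j) \<in> r" "i \<noteq> j" for i j
    unfolding \<rho>_def
  proof (rule psubset_card_mono[OF fin], rule psubsetI)
    show "{k. (k, i) \<in> r} \<subseteq> {k. (k, j) \<in> r}" using that tr by blast
    have "(j, j) \<in> r" "(j, i) \<notin> r" using that as sub rf by blast+
    then show "{k. (k, i) \<in> r} \<noteq> {k. (k, j) \<in> r}" by blast
  qed
  have "inj_on \<rho> {1..n}"
  proof (rule inj_onI, rule ccontr)
    fix i j assume "i \<in> {1..n}" "j \<in> {1..n}" "\<rho> i = \<rho> j" "i \<noteq> j"
    then show False using tot[of i j] lt[of i j] lt[of j i] by auto
  qed
  moreover have "(i, j) \<in> r \<longleftrightarrow> (i, j) \<in> rank_order n \<rho>" for i j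
    unfolding rank_order_def using sub[of i j] le[of i j] tot[of i j] lt[of j i] rf[of i] by fastforce
  then have "r = rank_order n \<rho>" by auto
  ultimately show ?thesis by blast
qed

lemma lookup_relabel:
  assumes "inj_on \<sigma> A" "finite A" "i \<in> A"
  shows "lookup (\<Sum>i\<in>A. single (\<sigma> i) (lookup m i :: nat)) (\<sigma> i) = lookup m i"
proof -
  have "lookup (\<Sum>i\<in>A. single (\<sigma> i) (lookup m i :: nat)) (\<sigma> i) = (\<Sum>j\<in>A. if j = i then lookup m i else 0)"
    unfolding lookup_sum using assms by (intro sum.cong) (auto simp: lookup_single when_def inj_on_def)
  then show ?thesis using assms by simp
qed

lemma zero_le_poly_mapping_nat: "(0 :: nat \<Rightarrow>\<^sub>0 nat) \<le> m"
proof (cases "m = 0")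
  case False
  then have "keys m \<noteq> {}" by simp
  define k where "k = Min (keys m)"
  have k: "k \<in> keys m" "\<And>j. j < k \<Longrightarrow> j \<notin> keys m"
    using \<open>keys m \<noteq> {}\<close> Min_in[of "keys m"] Min_le[of "keys m"] unfolding k_def
    by (auto simp: not_less[symmetric])
  have "less_fun (lookup (0 :: nat \<Rightarrow>\<^sub>0 nat)) (lookup m)"
    using k by (intro less_funI exI[of _ k]) (auto simp: in_keys_iff)
  then show ?thesis by (simp add: less_eq_poly_mapping.rep_eq)
qed simp

text \<open>The lexicographic order in which the variable of largest rank is most significant.\<close>
lemma ex_induced_monomial_order:
  assumes \<rho>: "inj_on \<rho> {1..n}"
  shows "\<exists>R. induced_monomial_order n (rank_order n \<rho>) R"
proof -
  define \<sigma> where "\<sigma> i = Max (\<rho> ` {1..n}) - \<rho> i" for i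
  have le: "\<rho> i \<le> Max (\<rho> ` {1..n})" if "i \<in> {1..n}" for i using that by (intro Max_ge) auto
  have \<sigma>: "inj_on \<sigma> {1..n}"
    using \<rho> le unfolding inj_on_def \<sigma>_def by (metis diff_diff_cancel)
  have \<sigma>_le: "\<sigma> j \<le> \<sigma> i" if "\<rho> i \<le> \<rho> j" for i j
    using that by (simp add: \<sigma>_def diff_le_mono2)
  define L where "L m = (\<Sum>i\<in>{1..n}. single (\<sigma> i) (lookup m i))" for m :: "nat \<Rightarrow>\<^sub>0 nat"
  have L_add: "L (a + b) = L a + L b" for a b
    by (simp add: L_def lookup_add single_add sum.distrib)
  have L0: "L 0 = 0" by (simp add: L_def)
  have L_inj: "a = b" if "L a = L b" "a \<in> monomials n" "b \<in> monomials n" for a b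
  proof (rule poly_mapping_eqI)
    fix i show "lookup a i = lookup b i"
    proof (cases "i \<in> {1..n}")
      case True
      then show ?thesis using lookup_relabel[OF \<sigma> _ True] that(1) unfolding L_def by (metis finite_atLeastAtMost)
    next
      case False
      then have "i \<notin> keys a" "i \<notin> keys b" using that unfolding monomials_def by blast+
      then show ?thesis by (simp add: in_keys_iff)
    qed
  qed
  define R where "R = {(a, b). a \<in> monomials n \<and> b \<in> monomials n \<and> L a \<le> L b}"
  have "linear_order_on (monomials n) R"
    unfolding order_on_defs R_def refl_on_def trans_def antisym_def total_on_def
    using L_inj by auto
  moreover have "(0, m) \<in> R" if "m \<in> monomials n" for m
    using that by (simp add: R_def L0 zero_le_poly_mapping_nat)
  moreover have "(a + c, b + c) \<in> R" if "(a, b) \<in> R" "c \<in> monomials n" for a b c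
    using that by (auto simp: R_def L_add monomials_add)
  moreover have "(var_exp i, var_exp j) \<in> R" if "(i, j) \<in> rank_order n \<rho>" for i j
  proof -
    have ij: "i \<in> {1..n}" "j \<in> {1..n}" "\<rho> i \<le> \<rho> j" using that by (auto simp: rank_order_def)
    have Lv: "L (var_exp i) = single (\<sigma> i) 1" if "i \<in> {1..n}" for i
    proof -
      have "L (var_exp i) = (\<Sum>j\<in>{1..n}. if j = i then single (\<sigma> i) 1 else 0)"
        unfolding L_def by (rule sum.cong) (auto simp: var_exp_def lookup_single when_def)
      then show ?thesis using that by simp
    qed
    have "single (\<sigma> i) (1 :: nat) \<le> single (\<sigma> j) 1"
    proof (cases "\<sigma> i = \<sigma> j")
      case False
      then have "\<sigma> j < \<sigma> i" using \<sigma>_le ij by (simp add: order_less_le)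
      then have "less_fun (lookup (single (\<sigma> i) (1 :: nat))) (lookup (single (\<sigma> j) 1))"
        by (intro less_funI exI[of _ "\<sigma> j"]) (auto simp: lookup_single when_def)
      then show ?thesis by (simp add: less_eq_poly_mapping.rep_eq)
    qed simp
    then show ?thesis using ij by (simp add: R_def Lv) (auto simp: var_exp_def monomials_def)
  qed
  ultimately show ?thesis
    unfolding induced_monomial_order_def monomial_order_def by blast
qed

section \<open>Spaces of relations and their circuits\<close>

text \<open>For a finite nonempty set \<open>C\<close> on which \<open>\<rho>\<close> is injective this is the element that is removed to form a broken
  circuit.\<close>
definition first :: "(nat \<Rightarrow> nat) \<Rightarrow> nat set \<Rightarrow> nat" where
  "first \<rho> C = arg_min_on \<rho> C"

lemma first_in: "finite C \<Longrightarrow> C \<noteq> {} \<Longrightarrow> first \<rho> C \<in> C"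
  unfolding first_def by (rule arg_min_if_finite(1))

lemma first_le: "finite C \<Longrightarrow> j \<in> C \<Longrightarrow> \<rho> (first \<rho> C) \<le> \<rho> j"
  unfolding first_def by (metis arg_min_if_finite(2) empty_iff linorder_not_less)

lemma first_eqI: "inj_on \<rho> C \<Longrightarrow> finite C \<Longrightarrow> i \<in> C \<Longrightarrow> (\<And>j. j \<in> C \<Longrightarrow> \<rho> i \<le> \<rho> j) \<Longrightarrow> first \<rho> C = i"
  by (metis inj_on_def first_in first_le empty_iff le_antisym)

lemma first_less: "inj_on \<rho> A \<Longrightarrow> C \<subseteq> A \<Longrightarrow> finite C \<Longrightarrow> j \<in> C \<Longrightarrow> j \<noteq> first \<rho> C \<Longrightarrow> \<rho> (first \<rho> C) < \<rho> j"
  by (metis inj_on_def first_in first_le empty_iff order_less_le subsetD)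

lemma min_wrt_rank_order:
  assumes "inj_on \<rho> {1..n}" "C \<subseteq> {1..n}" "C \<noteq> {}"
  shows "min_wrt (rank_order n \<rho>) C = first \<rho> C"
proof -
  have fin: "finite C" using assms finite_subset by blast
  show ?thesis
    unfolding min_wrt_def
  proof (rule the_equality)
    show "first \<rho> C \<in> C \<and> (\<forall>j\<in>C. (first \<rho> C, j) \<in> rank_order n \<rho>)"
      using first_in[OF fin assms(3), of \<rho>] first_le[OF fin] assms(2) subsetD[OF assms(2)]
      by (auto simp: rank_order_def simp del: atLeastAtMost_iff)
    fix i assume "i \<in> C \<and> (\<forall>j\<in>C. (i, j) \<in> rank_order n \<rho>)"
    then show "i = first \<rho> C"
      using first_eqI[of \<rho> C i] fin assms inj_on_subset by (auto simp: rank_order_def)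
  qed
qed

lemma subspace_keys: "pm.subspace {p :: 'a \<Rightarrow>\<^sub>0 'k::field. keys p \<subseteq> A}"
proof (rule pm.subspaceI)
  show "x + y \<in> {p. keys p \<subseteq> A}" if "x \<in> {p. keys p \<subseteq> A}" "y \<in> {p. keys p \<subseteq> A}" for x y :: "'a \<Rightarrow>\<^sub>0 'k"
    using that Poly_Mapping.keys_add[of x y] by blast
  show "pscale c x \<in> {p. keys p \<subseteq> A}" if "x \<in> {p. keys p \<subseteq> A}" for c and x :: "'a \<Rightarrow>\<^sub>0 'k"
    using that keys_pscale_subset[of c x] by blast
qed simp

lemma span_monos_keys:
  fixes p :: "'k::field mpolynomial"
  assumes "p \<in> pm.span (mono_poly ` A)"
  shows "keys p \<subseteq> A"
proof -
  have "pm.span (mono_poly ` A) \<subseteq> {p :: 'k mpolynomial. keys p \<subseteq> A}"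
    by (intro pm.span_minimal subspace_keys) (auto simp: mono_poly_def)
  then show ?thesis using assms by blast
qed

text \<open>The squarefree monomial with support \<open>A\<close>.\<close>
definition sqf :: "nat set \<Rightarrow> (nat \<Rightarrow>\<^sub>0 nat)" where
  "sqf A = (\<Sum>j\<in>A. var_exp j)"

lemma lookup_var_exp: "lookup (var_exp i) j = (if j = i then 1 else 0)"
  by (simp add: var_exp_def lookup_single when_def)

lemma keys_var_exp [simp]: "keys (var_exp i) = {i}"
  by (simp add: var_exp_def)

lemma var_exp_eq [simp]: "var_exp i = var_exp j \<longleftrightarrow> i = j"
  by (metis keys_var_exp singleton_inject)

lemma lookup_sqf: "finite A \<Longrightarrow> lookup (sqf A) j = (if j \<in> A then 1 else 0)"
  unfolding sqf_def lookup_sum lookup_var_exp by simp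

lemma sqf_minus_var:
  assumes "finite A" "i \<in> A"
  shows "sqf A - var_exp i = sqf (A - {i})"
proof (rule poly_mapping_eqI)
  fix j show "lookup (sqf A - var_exp i) j = lookup (sqf (A - {i})) j"
    using assms by (cases "j = i") (simp_all add: lookup_minus lookup_sqf lookup_var_exp)
qed

lemma keys_sqf: "finite A \<Longrightarrow> keys (sqf A) = A"
  by (auto simp: in_keys_iff lookup_sqf split: if_splits)

lemma sqf_in_monomials: "finite A \<Longrightarrow> sqf A \<in> monomials n \<longleftrightarrow> A \<subseteq> {1..n}"
  by (simp add: monomials_def keys_sqf)

lemma mdvd_sqf: "finite A \<Longrightarrow> mdvd (sqf A) m \<longleftrightarrow> A \<subseteq> keys m"
  by (auto simp: mdvd_def lookup_sqf in_keys_iff Suc_le_eq)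

lemma keys_add_nat: "keys (a + b :: nat \<Rightarrow>\<^sub>0 nat) = keys a \<union> keys b"
  by (auto simp: in_keys_iff lookup_add)

lemma keys_diff_var: "keys m - {t} \<subseteq> keys (m - var_exp t)"
  by (auto simp: in_keys_iff lookup_minus lookup_var_exp split: if_splits)

text \<open>For \<open>keys r \<subseteq> keys M\<close> this is \<open>\<Sum>\<^sub>t r\<^sub>t M / x\<^sub>t\<close>, that is, the boundary of \<open>r\<close> multiplied by a
  monomial. In contrast to the boundary it is linear in \<open>r\<close> for fixed \<open>M\<close>, which is what makes
  the cancellations below transparent.\<close>
definition multiple :: "(nat \<Rightarrow>\<^sub>0 nat) \<Rightarrow> (nat \<Rightarrow>\<^sub>0 'k::field) \<Rightarrow> 'k mpolynomial" where
  "multiple M r = (\<Sum>t\<in>keys r. pscale (lookup r t) (mono_poly (M - var_exp t)))"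

lemma multiple_superset:
  "finite A \<Longrightarrow> keys r \<subseteq> A \<Longrightarrow> multiple M r = (\<Sum>t\<in>A. pscale (lookup r t) (mono_poly (M - var_exp t)))"
  unfolding multiple_def by (intro sum.mono_neutral_left) (auto simp: in_keys_iff)

lemma multiple_diff: "multiple M (r - s) = multiple M r - multiple M s"
proof -
  let ?A = "keys r \<union> keys s"
  have "keys (r - s) \<subseteq> ?A" by (auto simp: in_keys_iff lookup_minus)
  then show ?thesis
    by (simp add: multiple_superset[of ?A] lookup_minus pm.scale_left_diff_distrib sum_subtractf)
qed

lemma multiple_pscale: "multiple M (pscale c r) = pscale c (multiple M r)"
  by (simp add: multiple_superset[of "keys r", OF _ keys_pscale_subset] multiple_superset[of "keys r" r]
    pm.scale_sum_right)

lemma multiple_zero [simp]: "multiple M 0 = 0"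
  by (simp add: multiple_def)

lemma mono_poly_0 [simp]: "mono_poly 0 = 1"
  by (simp add: mono_poly_def)

lemma prod_mono_poly: "finite A \<Longrightarrow> (\<Prod>j\<in>A. mono_poly (f j)) = mono_poly (\<Sum>j\<in>A. f j)"
  by (induction A rule: finite_induct) (auto simp: mono_poly_mult)

lemma multiple_eq_boundary:
  assumes "keys r \<subseteq> keys M"
  shows "multiple M r = mono_poly (M - sqf (keys r)) * relation_boundary r"
proof -
  have "mono_poly (M - sqf (keys r)) * (const_poly (lookup r i) * (\<Prod>j\<in>keys r - {i}. mono_poly (var_exp j)))
      = pscale (lookup r i) (mono_poly (M - var_exp i))" if i: "i \<in> keys r" for i
  proof -
    have "M - sqf (keys r) + sqf (keys r - {i}) = M - var_exp i"
    proof (rule poly_mapping_eqI)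
      fix j
      have "1 \<le> lookup M j" if "j \<in> keys r" using that assms by (auto simp: in_keys_iff Suc_le_eq)
      then show "lookup (M - sqf (keys r) + sqf (keys r - {i})) j = lookup (M - var_exp i) j"
        using i by (auto simp: lookup_add lookup_minus lookup_sqf lookup_var_exp)
    qed
    moreover have "(\<Prod>j\<in>keys r - {i}. mono_poly (var_exp j)) = (mono_poly (sqf (keys r - {i})) :: 'a mpolynomial)"
      unfolding sqf_def by (rule prod_mono_poly) simp
    ultimately show ?thesis
      by (simp add: const_poly_mult pscale_mult_right mono_poly_mult)
  qed
  then show ?thesis
    unfolding multiple_def relation_boundary_def sum_distrib_left by (intro sum.cong) auto
qed

lemma multiple_sqf: "relation_boundary r = multiple (sqf (keys r)) r"
proof -
  have "sqf (keys r) - sqf (keys r) = 0" by simp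
  then show ?thesis
    using multiple_eq_boundary[of r "sqf (keys r)"] by (simp add: keys_sqf mono_poly_def)
qed

text \<open>The relations of an arrangement, with everything else forgotten. The bound on the supports says that no
  functional vanishes and that no two of them are proportional.\<close>
locale relations =
  fixes n :: nat and F :: "(nat \<Rightarrow>\<^sub>0 'k::field) set"
  assumes subspace_F: "pm.subspace F"
    and keys_F: "r \<in> F \<Longrightarrow> keys r \<subseteq> {1..n}"
    and card_F: "r \<in> F \<Longrightarrow> r \<noteq> 0 \<Longrightarrow> 3 \<le> card (keys r)"
begin

definition circuits :: "nat set set" where
  "circuits = {keys r | r. r \<in> F \<and> r \<noteq> 0 \<and> (\<forall>s\<in>F. s \<noteq> 0 \<longrightarrow> \<not> keys s \<subset> keys r)}"

text \<open>The sets that contain no broken circuit, which are the faces of the broken circuit complex.\<close>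
definition nbc :: "(nat \<Rightarrow> nat) \<Rightarrow> nat set \<Rightarrow> bool" where
  "nbc \<rho> B \<longleftrightarrow> B \<subseteq> {1..n} \<and> (\<forall>K\<in>circuits. \<not> K - {first \<rho> K} \<subseteq> B)"

definition ot_ideal :: "'k mpolynomial set" where
  "ot_ideal = pideal n (relation_boundary ` F)"

lemma circuits_sub: "K \<in> circuits \<Longrightarrow> K \<subseteq> {1..n}"
  unfolding circuits_def using keys_F by blast

lemma circuits_finite: "K \<in> circuits \<Longrightarrow> finite K"
  unfolding circuits_def by auto

lemma finite_circuits: "finite circuits"
  by (rule finite_subset[of _ "Pow {1..n}"]) (use circuits_sub in auto)

lemma circuits_card: "K \<in> circuits \<Longrightarrow> 3 \<le> card K"
  unfolding circuits_def using card_F by blast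

lemma circuit_relation:
  "K \<in> circuits \<Longrightarrow> \<exists>r\<in>F. keys r = K \<and> r \<noteq> 0"
  unfolding circuits_def by blast

lemma circuit_minimal: "K \<in> circuits \<Longrightarrow> s \<in> F \<Longrightarrow> s \<noteq> 0 \<Longrightarrow> keys s \<subseteq> K \<Longrightarrow> keys s = K"
  unfolding circuits_def by blast

lemma ex_circuit_subset:
  assumes "r \<in> F" "r \<noteq> 0"
  shows "\<exists>K\<in>circuits. K \<subseteq> keys r"
  using assms
proof (induction "card (keys r)" arbitrary: r rule: less_induct)
  case less
  show ?case
  proof (cases "\<exists>s\<in>F. s \<noteq> 0 \<and> keys s \<subset> keys r")
    case True
    then obtain s where s: "s \<in> F" "s \<noteq> 0" "keys s \<subset> keys r" by auto
    then have "card (keys s) < card (keys r)" by (simp add: psubset_card_mono)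
    then show ?thesis using less(1)[of s] s by blast
  next
    case False
    then have "keys r \<in> circuits" unfolding circuits_def using less by blast
    then show ?thesis by blast
  qed
qed

lemma circuitI:
  "r \<in> F \<Longrightarrow> r \<noteq> 0 \<Longrightarrow> (\<And>s. s \<in> F \<Longrightarrow> s \<noteq> 0 \<Longrightarrow> keys s \<subseteq> keys r \<Longrightarrow> keys s = keys r) \<Longrightarrow> keys r \<in> circuits"
  unfolding circuits_def by blast

lemma boundary_in_polys: "r \<in> F \<Longrightarrow> relation_boundary r \<in> polys n"
  using relation_boundary_in_carrier[OF keys_F] by simp

lemma multiple_in_polys: "M \<in> monomials n \<Longrightarrow> multiple M r \<in> polys n"
  unfolding multiple_def
  by (intro pm.subspace_sum[OF subspace_polys] pm.subspace_scale[OF subspace_polys])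
    (simp add: diff_in_monomials)

lemma multiple_in_ot: "r \<in> F \<Longrightarrow> keys r \<subseteq> keys M \<Longrightarrow> M \<in> monomials n \<Longrightarrow> multiple M r \<in> ot_ideal"
  unfolding ot_ideal_def
  by (subst multiple_eq_boundary, assumption)
    (rule pideal_mono_mult[OF diff_in_monomials pideal_base[OF imageI]])

lemma ot_ideal_sub: "ot_ideal \<subseteq> polys n"
  unfolding ot_ideal_def by (rule pideal_subset_polys) (auto intro: boundary_in_polys)

lemma nbc_subset: "nbc \<rho> B \<Longrightarrow> A \<subseteq> B \<Longrightarrow> nbc \<rho> A"
  unfolding nbc_def by blast

end

section \<open>The broken circuits generate the initial ideal\<close>

locale ordered_relations = relations n F + monomial_ordering n R
  for n F R +
  fixes \<rho> :: "nat \<Rightarrow> nat"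
  assumes inj: "inj_on \<rho> {1..n}"
    and induced: "induced_monomial_order n (rank_order n \<rho>) R"
begin

lemma var_in_monomials: "i \<in> {1..n} \<Longrightarrow> var_exp i \<in> monomials n"
  by (simp add: monomials_def)

lemma var_le: "i \<in> {1..n} \<Longrightarrow> j \<in> {1..n} \<Longrightarrow> \<rho> i \<le> \<rho> j \<Longrightarrow> (var_exp i, var_exp j) \<in> R"
  using induced unfolding induced_monomial_order_def rank_order_def by auto

lemma var_lt: "i \<in> {1..n} \<Longrightarrow> j \<in> {1..n} \<Longrightarrow> \<rho> i < \<rho> j \<Longrightarrow> lt (var_exp i) (var_exp j)"
  using var_le[of i j] by auto

lemma lt_cancel:
  assumes "a \<in> monomials n" "b \<in> monomials n" "c \<in> monomials n" "lt (a + c) (b + c)"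
  shows "lt a b"
  using R_total[OF assms(2,1)] R_add[OF _ assms(3), of b a] R_antisym[of "a + c" "b + c"] assms(4) by auto

lemma minus_var_add: "t \<in> keys M \<Longrightarrow> M - var_exp t + var_exp t = (M :: nat \<Rightarrow>\<^sub>0 nat)"
  by (rule poly_mapping_eqI) (auto simp: lookup_add lookup_minus lookup_var_exp in_keys_iff)

lemma exchange_lt:
  assumes "M \<in> monomials n" "i \<in> keys M" "t \<in> keys M" "\<rho> i < \<rho> t"
  shows "lt (M - var_exp t) (M - var_exp i)"
proof -
  have n: "i \<in> {1..n}" "t \<in> {1..n}" using assms unfolding monomials_def by auto
  have "lt (M - var_exp i + var_exp i) (M - var_exp i + var_exp t)"
    using lt_add[OF var_lt[OF n assms(4)], of "M - var_exp i"] assms diff_in_monomials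
    by (simp add: add.commute)
  then have "lt (M - var_exp t + var_exp t) (M - var_exp i + var_exp t)"
    using assms minus_var_add by simp
  then show ?thesis using lt_cancel diff_in_monomials assms var_in_monomials n by blast
qed

abbreviation lead :: "(nat \<Rightarrow>\<^sub>0 nat) \<Rightarrow> (nat \<Rightarrow>\<^sub>0 'a) \<Rightarrow> (nat \<Rightarrow>\<^sub>0 nat)" where
  "lead N r \<equiv> N - var_exp (first \<rho> (keys r))"

lemma inj_keys: "r \<in> F \<Longrightarrow> inj_on \<rho> (keys r)"
  using inj keys_F inj_on_subset by blast

lemma multiple_keys:
  assumes "r \<in> F" "r \<noteq> 0" "N \<in> monomials n" "keys r \<subseteq> keys N"
  shows "m \<in> keys (multiple N r) \<Longrightarrow> (m, lead N r) \<in> R"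
    "lookup (multiple N r) (lead N r) = lookup r (first \<rho> (keys r))"
proof -
  let ?i = "first \<rho> (keys r)"
  have i: "?i \<in> keys r" using assms by (intro first_in) auto
  have lt: "lt (N - var_exp t) (lead N r)" if "t \<in> keys r" "t \<noteq> ?i" for t
  proof (rule exchange_lt[OF assms(3)])
    show "?i \<in> keys N" "t \<in> keys N" using i that assms by auto
    show "\<rho> ?i < \<rho> t" using first_less[OF inj keys_F[OF assms(1)] _ that] by simp
  qed
  have "(N - var_exp t, lead N r) \<in> R" if "t \<in> keys r" for t
    using lt[OF that] R_refl[OF diff_in_monomials[OF assms(3)]] by (cases "t = ?i") auto
  moreover have "keys (multiple N r) \<subseteq> (\<Union>t\<in>keys r. {N - var_exp t})"
    unfolding multiple_def
    by (rule order_trans[OF Poly_Mapping.keys_sum])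
      (use keys_pscale_subset in \<open>fastforce simp: mono_poly_def\<close>)
  ultimately show "m \<in> keys (multiple N r) \<Longrightarrow> (m, lead N r) \<in> R" by auto
  have "lookup (multiple N r) (lead N r) = (\<Sum>t\<in>keys r. if t = ?i then lookup r ?i else 0)"
    unfolding multiple_def lookup_sum
    by (rule sum.cong) (use lt in \<open>auto simp: mono_poly_def lookup_single when_def\<close>)
  then show "lookup (multiple N r) (lead N r) = lookup r ?i" using i by simp
qed

lemma lm_multiple:
  assumes "r \<in> F" "r \<noteq> 0" "N \<in> monomials n" "keys r \<subseteq> keys N"
  shows "lm (multiple N r) = lead N r" "multiple N r \<noteq> 0"
proof -
  have "first \<rho> (keys r) \<in> keys r" using assms by (intro first_in) auto
  then have "lead N r \<in> keys (multiple N r)"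
    using multiple_keys(2)[OF assms] by (simp add: in_keys_iff)
  then show "lm (multiple N r) = lead N r" "multiple N r \<noteq> 0"
    using multiple_keys(1)[OF assms] by (auto intro: lm_eqI)
qed

text \<open>The generators of the Orlik-Terao ideal, as a vector space, whose leading monomial satisfies \<open>P\<close>. Filtering
  the ideal by bounds on the leading monomials of generators, as opposed to those of elements, is what makes
  cancellation visible.\<close>
definition gens :: "((nat \<Rightarrow>\<^sub>0 nat) \<Rightarrow> bool) \<Rightarrow> 'a mpolynomial set" where
  "gens P = {multiple N r | N r. r \<in> F \<and> r \<noteq> 0 \<and> N \<in> monomials n \<and> keys r \<subseteq> keys N \<and> P (lead N r)}"

abbreviation below :: "(nat \<Rightarrow>\<^sub>0 nat) \<Rightarrow> 'a mpolynomial set" where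
  "below M \<equiv> pm.span (gens (\<lambda>L. lt L M))"

abbreviation upto :: "(nat \<Rightarrow>\<^sub>0 nat) \<Rightarrow> 'a mpolynomial set" where
  "upto M \<equiv> pm.span (gens (\<lambda>L. (L, M) \<in> R))"

lemma below_base:
  assumes "r \<in> F" "N \<in> monomials n" "keys r \<subseteq> keys N" "r \<noteq> 0 \<Longrightarrow> lt (lead N r) M"
  shows "multiple N r \<in> below M"
proof (cases "r = 0")
  case True then show ?thesis by (simp add: pm.span_zero)
next
  case False then show ?thesis using assms unfolding gens_def by (intro pm.span_base) blast
qed

lemma swap_lt:
  assumes "M \<in> monomials n" "i \<in> {1..n}" "t \<in> keys (M + var_exp i)" "\<rho> i < \<rho> t"
  shows "lt (M + var_exp i - var_exp t) M"
proof -
  have "M + var_exp i \<in> monomials n" using assms monomials_add var_in_monomials by blast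
  from exchange_lt[OF this _ assms(3,4)] show ?thesis by (simp add: keys_add_nat)
qed

text \<open>Two monic generators with the same leading monomial \<open>M\<close>. If the minima \<open>i\<close>, \<open>j\<close> of their
  supports agree, the difference is again a generator, by linearity. Otherwise consider the double sum of
  the \<open>(r\<^sub>t s\<^sub>u - s\<^sub>t r\<^sub>u) N / x\<^sub>t x\<^sub>u\<close> with \<open>N = M x\<^sub>i x\<^sub>j\<close>, which vanishes by antisymmetry: summing over \<open>u\<close>
  first, each \<open>t\<close> contributes a multiple of the relation \<open>r\<^sub>t s - s\<^sub>t r\<close>, and
  the contributions of \<open>t = i\<close> and \<open>t = j\<close> contain the two given generators.\<close>
lemma cancel_leading:
  assumes M: "M \<in> monomials n"
    and r: "r \<in> F" "r \<noteq> 0" "lookup r (first \<rho> (keys r)) = 1" "keys r \<subseteq> keys (M + var_exp (first \<rho> (keys r)))"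
    and s: "s \<in> F" "s \<noteq> 0" "lookup s (first \<rho> (keys s)) = 1" "keys s \<subseteq> keys (M + var_exp (first \<rho> (keys s)))"
    and le: "\<rho> (first \<rho> (keys r)) \<le> \<rho> (first \<rho> (keys s))"
  shows "multiple (M + var_exp (first \<rho> (keys r))) r - multiple (M + var_exp (first \<rho> (keys s))) s \<in> below M"
proof -
  define i j where "i = first \<rho> (keys r)" and "j = first \<rho> (keys s)"
  have i: "i \<in> keys r" and j: "j \<in> keys s" using r s by (auto simp: i_def j_def intro!: first_in)
  have ijn: "i \<in> {1..n}" "j \<in> {1..n}" using i j r s keys_F by blast+
  have less_r: "\<rho> i < \<rho> t" if "t \<in> keys r" "t \<noteq> i" for t
    using first_less[OF inj keys_F[OF r(1)] _ that(1)] that by (simp add: i_def)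
  have less_s: "\<rho> j < \<rho> t" if "t \<in> keys s" "t \<noteq> j" for t
    using first_less[OF inj keys_F[OF s(1)] _ that(1)] that by (simp add: j_def)
  note r' = r[folded i_def] and s' = s[folded j_def]
  have mons: "M + var_exp i \<in> monomials n" "M + var_exp j \<in> monomials n"
    using M ijn monomials_add var_in_monomials by blast+
  show ?thesis
  proof (cases "i = j")
    case True
    have "multiple (M + var_exp i) (r - s) \<in> below M"
    proof (rule below_base)
      show "r - s \<in> F" using r s pm.subspace_diff[OF subspace_F] by blast
      show "M + var_exp i \<in> monomials n" by fact
      have sub: "keys (r - s) \<subseteq> keys r \<union> keys s" by (auto simp: in_keys_iff lookup_minus)
      then show k: "keys (r - s) \<subseteq> keys (M + var_exp i)" using r' s' True by blast
      assume "r - s \<noteq> 0"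
      then have t: "first \<rho> (keys (r - s)) \<in> keys (r - s)" by (intro first_in) auto
      moreover have "i \<notin> keys (r - s)" using r'(3) s'(3) True by (simp add: in_keys_iff lookup_minus)
      ultimately have "\<rho> i < \<rho> (first \<rho> (keys (r - s)))"
        using sub less_r less_s True by blast
      then show "lt (lead (M + var_exp i) (r - s)) M"
        using swap_lt[OF M ijn(1)] k t by blast
    qed
    then show ?thesis using True by (simp add: multiple_diff flip: i_def j_def)
  next
    case False
    have ij: "\<rho> i < \<rho> j"
      using le False inj_onD[OF inj _ ijn] by (auto simp: i_def j_def order_less_le)
    have i_s: "i \<notin> keys s" using less_s[of i] ij by fastforce
    define N where "N = M + var_exp i + var_exp j"
    define V where "V = keys r \<union> keys s"
    define q where "q t = pscale (lookup r t) s - pscale (lookup s t) r" for t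
    have V: "finite V" "V \<subseteq> {1..n}" "i \<in> V" "j \<in> V"
      using i j keys_F r s by (auto simp: V_def)
    have q_F: "q t \<in> F" for t
      unfolding q_def using r s by (intro pm.subspace_diff[OF subspace_F] pm.subspace_scale[OF subspace_F])
    have q_keys: "keys (q t) \<subseteq> V - {t}" for t
      by (auto simp: q_def V_def in_keys_iff lookup_minus)
    have "(\<Sum>t\<in>V. multiple (N - var_exp t) (q t)) = (\<Sum>t\<in>V. \<Sum>u\<in>V.
        pscale (lookup r t * lookup s u - lookup s t * lookup r u) (mono_poly (N - var_exp t - var_exp u)))"
      using q_keys V by (intro sum.cong refl)
        (simp add: multiple_superset[of V] subset_iff q_def lookup_minus)
    also have "\<dots> = (\<Sum>t\<in>V. \<Sum>u\<in>V. pscale (lookup r t * lookup s u) (mono_poly (N - var_exp t - var_exp u)))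
        - (\<Sum>t\<in>V. \<Sum>u\<in>V. pscale (lookup s t * lookup r u) (mono_poly (N - var_exp t - var_exp u)))"
      by (simp add: pm.scale_left_diff_distrib sum_subtractf)
    also have "(\<Sum>t\<in>V. \<Sum>u\<in>V. pscale (lookup s t * lookup r u) (mono_poly (N - var_exp t - var_exp u)))
        = (\<Sum>t\<in>V. \<Sum>u\<in>V. pscale (lookup r t * lookup s u) (mono_poly (N - var_exp t - var_exp u)))"
      by (subst sum.swap) (simp add: mult.commute diff_right_commute)
    finally have zero: "(\<Sum>t\<in>V. multiple (N - var_exp t) (q t)) = 0" by simp
    have Ni: "N - var_exp i = M + var_exp j" and Nj: "N - var_exp j = M + var_exp i"
      by (auto simp: N_def intro!: poly_mapping_eqI simp: lookup_add lookup_minus)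
    have qi: "q i = s" using r'(3) i_s by (simp add: q_def in_keys_iff)
    have qj: "q j = pscale (lookup r j) s - r" using s'(3) by (simp add: q_def)
    have "(\<Sum>t\<in>V. multiple (N - var_exp t) (q t)) = multiple (N - var_exp i) (q i)
        + (multiple (N - var_exp j) (q j) + (\<Sum>t\<in>V - {i} - {j}. multiple (N - var_exp t) (q t)))"
      using V False by (subst sum.remove[of V i], simp, simp) (subst sum.remove[of "V - {i}" j], auto)
    then have eq: "multiple (M + var_exp i) r - multiple (M + var_exp j) s
        = pscale (lookup r j) (multiple (M + var_exp i) s) + (\<Sum>t\<in>V - {i} - {j}. multiple (N - var_exp t) (q t))"
      unfolding zero by (simp add: Ni Nj qi qj multiple_diff multiple_pscale algebra_simps)
    have 1: "pscale (lookup r j) (multiple (M + var_exp i) s) \<in> below M"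
    proof (cases "j \<in> keys r")
      case True
      have "multiple (M + var_exp i) s \<in> below M"
      proof (rule below_base[OF s(1) mons(1)])
        have "j \<in> keys (M + var_exp i)" using True r' by blast
        then show "keys s \<subseteq> keys (M + var_exp i)" using s'(4) by (auto simp: keys_add_nat)
        show "lt (lead (M + var_exp i) s) M"
          using swap_lt[OF M ijn(1) \<open>j \<in> keys (M + var_exp i)\<close> ij] by (simp add: j_def)
      qed
      then show ?thesis by (rule pm.span_scale)
    next
      case False
      then show ?thesis by (simp add: in_keys_iff pm.span_zero)
    qed
    have 2: "multiple (N - var_exp t) (q t) \<in> below M" if t: "t \<in> V - {i} - {j}" for t
    proof (rule below_base[OF q_F])
      have NV: "V \<subseteq> keys N" using r' s' by (auto simp: V_def N_def keys_add_nat)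
      have Nm: "N \<in> monomials n" unfolding N_def using mons ijn monomials_add var_in_monomials by blast
      show Nt: "N - var_exp t \<in> monomials n" using Nm by (rule diff_in_monomials)
      show k: "keys (q t) \<subseteq> keys (N - var_exp t)" using q_keys[of t] NV keys_diff_var[of N t] by blast
      assume "q t \<noteq> 0"
      define m where "m = first \<rho> (keys (q t))"
      have m: "m \<in> keys (q t)" unfolding m_def using \<open>q t \<noteq> 0\<close> by (intro first_in) auto
      have tn: "t \<in> {1..n}" "m \<in> {1..n}" "m \<in> V" using t m q_keys[of t] V by auto
      have restore: "N - var_exp t - var_exp m + (var_exp m + var_exp t) = N"
        using minus_var_add[of m "N - var_exp t"] minus_var_add[of t N] k m t NV
        by (simp add: add.assoc[symmetric] subset_iff)
      have "lt (var_exp i + var_exp j) (var_exp m + var_exp t)"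
      proof (cases "t \<in> keys s")
        case True
        have "\<rho> i \<le> \<rho> m" using tn(3) less_r[of m] less_s[of m] ij unfolding V_def by fastforce
        then have a: "(var_exp i + var_exp j, var_exp m + var_exp j) \<in> R"
          using var_le R_add ijn tn var_in_monomials by blast
        have "lt (var_exp j) (var_exp t)" using less_s[of t] True t var_lt ijn tn by blast
        then have "lt (var_exp m + var_exp j) (var_exp m + var_exp t)"
          using lt_add[of "var_exp j" "var_exp t" "var_exp m"] tn var_in_monomials by (simp add: add.commute)
        then show ?thesis using lt_trans(2)[OF a] by blast
      next
        case False
        then have "t \<in> keys r" "keys (q t) = keys s"
          using t by (auto simp: V_def q_def in_keys_iff)
        then have "m = j" "lt (var_exp i) (var_exp t)"
          using less_r[of t] t var_lt ijn tn by (auto simp: m_def j_def)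
        then show ?thesis
          using lt_add[of "var_exp i" "var_exp t" "var_exp j"] ijn var_in_monomials by (simp add: add.commute)
      qed
      then have "lt ((var_exp i + var_exp j) + M) ((var_exp m + var_exp t) + M)"
        using lt_add M by blast
      moreover have "(var_exp i + var_exp j) + M = N - var_exp t - var_exp m + (var_exp m + var_exp t)"
        using restore by (simp add: N_def add_ac)
      moreover have "(var_exp m + var_exp t) + M = M + (var_exp m + var_exp t)" by (rule add.commute)
      ultimately have "lt (N - var_exp t - var_exp m + (var_exp m + var_exp t)) (M + (var_exp m + var_exp t))"
        by metis
      then show "lt (lead (N - var_exp t) (q t)) M"
        unfolding m_def[symmetric] using Nt M tn var_in_monomials monomials_add diff_in_monomials
        by (intro lt_cancel[of _ M "var_exp m + var_exp t"]) blast+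
    qed
    show ?thesis
      unfolding i_def[symmetric] j_def[symmetric] eq using 1 2 by (intro pm.span_add pm.span_sum)
  qed
qed

lemma below_keys:
  assumes "p \<in> below M" "m \<in> keys p"
  shows "lt m M"
proof -
  have "gens (\<lambda>L. lt L M) \<subseteq> {p. keys p \<subseteq> {m. lt m M}}"
  proof
    fix x assume "x \<in> gens (\<lambda>L. lt L M)"
    then obtain N r where x: "x = multiple N r" "r \<in> F" "r \<noteq> 0" "N \<in> monomials n"
      "keys r \<subseteq> keys N" "lt (lead N r) M"
      unfolding gens_def by blast
    have "lt m M" if "m \<in> keys x" for m
      using multiple_keys(1)[OF x(2-5)] that x(1) lt_trans(2)[OF _ x(6)] by simp
    then show "x \<in> {p. keys p \<subseteq> {m. lt m M}}" by blast
  qed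
  then have "below M \<subseteq> {p. keys p \<subseteq> {m. lt m M}}"
    using subspace_keys by (rule pm.span_minimal)
  then show ?thesis using assms by blast
qed

lemma monic_difference:
  assumes "r \<in> F" "r \<noteq> 0" "N \<in> monomials n" "keys r \<subseteq> keys N" "lead N r = M"
    and "s \<in> F" "s \<noteq> 0" "N' \<in> monomials n" "keys s \<subseteq> keys N'" "lead N' s = M"
  shows "\<exists>c. multiple N r - pscale c (multiple N' s) \<in> below M"
proof -
  have norm: "\<exists>r'\<in>F. \<exists>c. r' \<noteq> 0 \<and> keys r' = keys r \<and> lookup r' (first \<rho> (keys r')) = 1 \<and> c \<noteq> 0 \<and>
      r = pscale c r' \<and> N = M + var_exp (first \<rho> (keys r'))"
    if "r \<in> F" "r \<noteq> 0" "N \<in> monomials n" "keys r \<subseteq> keys N" "lead N r = M" for r N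
  proof -
    let ?i = "first \<rho> (keys r)"
    have i: "?i \<in> keys r" using that by (intro first_in) auto
    then have c: "lookup r ?i \<noteq> 0" by (simp add: in_keys_iff)
    let ?r = "pscale (1 / lookup r ?i) r"
    have k: "keys ?r = keys r" using c by simp
    have "?i \<in> keys N" using i that by blast
    then have "N = M + var_exp ?i" using that minus_var_add by metis
    moreover have "pscale (lookup r ?i) ?r = r" "?r \<noteq> 0" using c that by simp_all
    moreover have "lookup ?r ?i = 1" using c by simp
    ultimately show ?thesis
      using c k that pm.subspace_scale[OF subspace_F]
      by (intro bexI[of _ ?r] exI[of _ "lookup r ?i"]) auto
  qed
  obtain r' c where r': "r' \<in> F" "r' \<noteq> 0" "keys r' = keys r" "lookup r' (first \<rho> (keys r')) = 1"
    "c \<noteq> 0" "r = pscale c r'" "N = M + var_exp (first \<rho> (keys r'))"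
    using norm[OF assms(1-5)] by blast
  obtain s' d where s': "s' \<in> F" "s' \<noteq> 0" "keys s' = keys s" "lookup s' (first \<rho> (keys s')) = 1"
    "d \<noteq> 0" "s = pscale d s'" "N' = M + var_exp (first \<rho> (keys s'))"
    using norm[OF assms(6-10)] by blast
  have M: "M \<in> monomials n" using assms diff_in_monomials by blast
  let ?d = "multiple N r' - multiple N' s'"
  have kr: "keys r' \<subseteq> keys (M + var_exp (first \<rho> (keys r')))" using r'(3,7) assms(4) by metis
  have ks: "keys s' \<subseteq> keys (M + var_exp (first \<rho> (keys s')))" using s'(3,7) assms(9) by metis
  have "?d \<in> below M"
  proof (cases "\<rho> (first \<rho> (keys r')) \<le> \<rho> (first \<rho> (keys s'))")
    case True
    show ?thesis unfolding r'(7) s'(7)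
      by (rule cancel_leading[OF M r'(1,2,4) kr s'(1,2,4) ks True])
  next
    case False
    then have "\<rho> (first \<rho> (keys s')) \<le> \<rho> (first \<rho> (keys r'))" by simp
    then have "multiple N' s' - multiple N r' \<in> below M" unfolding r'(7) s'(7)
      by (rule cancel_leading[OF M s'(1,2,4) ks r'(1,2,4) kr])
    then have "- (multiple N' s' - multiple N r') \<in> below M" by (rule pm.span_neg)
    then show ?thesis by simp
  qed
  then have "pscale c ?d \<in> below M" by (rule pm.span_scale)
  moreover have "pscale c ?d = multiple N r - pscale (c / d) (multiple N' s)"
    using s'(5) unfolding r'(6) s'(6) by (simp add: multiple_pscale pm.scale_right_diff_distrib)
  ultimately have "multiple N r - pscale (c / d) (multiple N' s) \<in> below M" by argo
  then show ?thesis by (rule exI)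
qed

text \<open>Modulo generators with smaller leading monomials, all generators with leading monomial \<open>M\<close> are proportional.\<close>
lemma upto_cases:
  assumes "p \<in> upto M"
  shows "p \<in> below M \<or> (\<exists>N r c. r \<in> F \<and> r \<noteq> 0 \<and> N \<in> monomials n \<and> keys r \<subseteq> keys N \<and> lead N r = M \<and>
    p - pscale c (multiple N r) \<in> below M)"
proof (cases "\<exists>N r. r \<in> F \<and> r \<noteq> 0 \<and> N \<in> monomials n \<and> keys r \<subseteq> keys N \<and> lead N r = M")
  case False
  then have "gens (\<lambda>L. (L, M) \<in> R) \<subseteq> gens (\<lambda>L. lt L M)" unfolding gens_def by blast
  then show ?thesis using assms pm.span_mono by blast
next
  case True
  then obtain N r where r: "r \<in> F" "r \<noteq> 0" "N \<in> monomials n" "keys r \<subseteq> keys N" "lead N r = M" by blast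
  let ?q = "multiple N r"
  have "gens (\<lambda>L. (L, M) \<in> R) \<subseteq> pm.span (insert ?q (gens (\<lambda>L. lt L M)))"
  proof
    fix x assume "x \<in> gens (\<lambda>L. (L, M) \<in> R)"
    then obtain N' s where x: "x = multiple N' s" "s \<in> F" "s \<noteq> 0" "N' \<in> monomials n" "keys s \<subseteq> keys N'"
      "(lead N' s, M) \<in> R" unfolding gens_def by blast
    show "x \<in> pm.span (insert ?q (gens (\<lambda>L. lt L M)))"
    proof (cases "lead N' s = M")
      case True
      then show ?thesis using monic_difference[OF x(2-5) True r] x(1) by (simp add: pm.span_breakdown_eq)
    next
      case False
      then have "x \<in> gens (\<lambda>L. lt L M)" using x unfolding gens_def by blast
      then show ?thesis by (simp add: pm.span_base)
    qed
  qed
  then have "upto M \<subseteq> pm.span (insert ?q (gens (\<lambda>L. lt L M)))"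
    by (rule pm.span_minimal) simp
  then have "\<exists>c. p - pscale c ?q \<in> below M" using assms pm.span_breakdown_eq by blast
  then show ?thesis using r by blast
qed

lemma span_gens_upto:
  assumes "p \<in> pm.span (gens P)"
  shows "p = 0 \<or> (\<exists>M. P M \<and> M \<in> monomials n \<and> p \<in> upto M)"
  using assms
proof (induction rule: pm.span_induct_alt)
  case (step c x y)
  obtain N r where x: "x = multiple N r" "r \<in> F" "r \<noteq> 0" "N \<in> monomials n" "keys r \<subseteq> keys N" "P (lead N r)"
    using step(1) unfolding gens_def by blast
  let ?L = "lead N r"
  have L: "?L \<in> monomials n" using x diff_in_monomials by blast
  have xg: "x \<in> upto M" if "(?L, M) \<in> R" for M
    using x that unfolding gens_def by (intro pm.span_base) blast
  show ?case
  proof (cases "y = 0")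
    case True
    then show ?thesis using x(6) L xg[OF R_refl[OF L]] pm.span_scale by fastforce
  next
    case False
    then obtain M where M: "P M" "M \<in> monomials n" "y \<in> upto M" using step by blast
    show ?thesis
    proof (cases "(?L, M) \<in> R")
      case True
      then show ?thesis using M xg[OF True] by (metis pm.span_add pm.span_scale)
    next
      case False
      then have "(M, ?L) \<in> R" using R_total[OF L M(2)] by blast
      then have "gens (\<lambda>L. (L, M) \<in> R) \<subseteq> gens (\<lambda>L. (L, ?L) \<in> R)"
        unfolding gens_def using R_trans by blast
      then have "y \<in> upto ?L" using M(3) pm.span_mono by blast
      then show ?thesis using x(6) L xg[OF R_refl[OF L]] by (metis pm.span_add pm.span_scale)
    qed
  qed
qed simp

text \<open>If the coefficient of the generator with the largest leading monomial vanishes, the bound \<open>M\<close> can be lowered;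
  otherwise nothing cancels \<open>M\<close>.\<close>
lemma upto_leading:
  assumes "p \<in> upto M" "p \<noteq> 0" "M \<in> monomials n"
  shows "\<exists>N r. r \<in> F \<and> r \<noteq> 0 \<and> N \<in> monomials n \<and> keys r \<subseteq> keys N \<and> lm p = lead N r"
  using assms
proof (induction M arbitrary: p rule: wf_induct_rule[OF wf_lt])
  case (1 M)
  have below: ?case if pb: "p \<in> below M"
  proof -
    obtain M' where "lt M' M" "M' \<in> monomials n" "p \<in> upto M'"
      using span_gens_upto[OF pb] 1 by blast
    then show ?thesis using 1(1)[of M' p] 1(3) by blast
  qed
  from upto_cases[OF 1(2)] show ?case
  proof
    assume "\<exists>N r c. r \<in> F \<and> r \<noteq> 0 \<and> N \<in> monomials n \<and> keys r \<subseteq> keys N \<and> lead N r = M \<and>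
      p - pscale c (multiple N r) \<in> below M"
    then obtain N r c where r: "r \<in> F" "r \<noteq> 0" "N \<in> monomials n" "keys r \<subseteq> keys N" "lead N r = M"
      and d: "p - pscale c (multiple N r) \<in> below M" by blast
    show ?thesis
    proof (cases "c = 0")
      case True then show ?thesis using d below by simp
    next
      case False
      let ?d = "p - pscale c (multiple N r)" and ?q = "multiple N r"
      have p: "p = ?d + pscale c ?q" by (rule diff_add_cancel[symmetric])
      have "lm p = M"
      proof (rule lm_eqI)
        have "M \<notin> keys ?d" using below_keys[OF d] by blast
        moreover have "M \<in> keys ?q"
          using lm_props(1)[OF multiple_in_polys[OF r(3)] lm_multiple(2)[OF r(1-4)]] lm_multiple(1)[OF r(1-4)] r(5)
          by simp
        ultimately show "M \<in> keys p"
          using False by (simp add: in_keys_iff lookup_minus)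
        fix m assume "m \<in> keys p"
        moreover have "keys p \<subseteq> keys ?d \<union> keys ?q"
          using Poly_Mapping.keys_add[of ?d "pscale c ?q"] keys_pscale_subset[of c ?q] unfolding p[symmetric]
          by blast
        ultimately have "m \<in> keys ?d \<or> m \<in> keys ?q" by blast
        then show "(m, M) \<in> R"
          using below_keys[OF d, of m] multiple_keys(1)[OF r(1-4)] r(5) by blast
      qed
      then have "lm p = lead N r" using r(5) by simp
      then show ?thesis using r(1-4) by blast
    qed
  qed (rule below)
qed

lemma ot_ideal_span: "ot_ideal = pm.span (gens (\<lambda>_. True))"
proof
  show "ot_ideal \<subseteq> pm.span (gens (\<lambda>_. True))"
    unfolding ot_ideal_def pideal_def
  proof (rule pm.span_minimal)
    show "{mono_poly m * a | m a. m \<in> monomials n \<and> a \<in> relation_boundary ` F} \<subseteq> pm.span (gens (\<lambda>_. True))"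
    proof clarify
      fix m r assume m: "m \<in> monomials n" and r: "r \<in> F"
      have eq: "mono_poly m * relation_boundary r = multiple (m + sqf (keys r)) r"
        using multiple_eq_boundary[of r "m + sqf (keys r)"] by (simp add: keys_add_nat keys_sqf)
      have N: "m + sqf (keys r) \<in> monomials n"
        using m keys_F[OF r] by (intro monomials_add) (auto simp: sqf_in_monomials)
      show "mono_poly m * relation_boundary r \<in> pm.span (gens (\<lambda>_. True))"
      proof (cases "r = 0")
        case True then show ?thesis unfolding eq by (simp add: pm.span_zero)
      next
        case False
        have k: "keys r \<subseteq> keys (m + sqf (keys r))" by (simp add: keys_add_nat keys_sqf)
        from False have "multiple (m + sqf (keys r)) r \<in> gens (\<lambda>_. True)"
          unfolding gens_def using r N k by blast
        then show ?thesis unfolding eq by (rule pm.span_base)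
      qed
    qed
  qed simp
  show "pm.span (gens (\<lambda>_. True)) \<subseteq> ot_ideal"
  proof (rule pm.span_minimal)
    show "gens (\<lambda>_. True) \<subseteq> ot_ideal" unfolding gens_def using multiple_in_ot by blast
    show "pm.subspace ot_ideal" by (simp add: ot_ideal_def)
  qed
qed

text \<open>The Groebner basis property. The leading monomial belongs to a multiple of the boundary of a
  single relation \<open>r\<close>, hence is divisible by all variables of \<open>r\<close> but the first one; these contain the broken
  circuit of any circuit inside the support of \<open>r\<close>.\<close>
theorem leading_broken_circuit:
  assumes "p \<in> ot_ideal" "p \<noteq> 0"
  shows "\<exists>K\<in>circuits. K - {first \<rho> K} \<subseteq> keys (lm p)"
proof -
  obtain M where "M \<in> monomials n" "p \<in> upto M"
    using span_gens_upto[of p "\<lambda>_. True"] assms ot_ideal_span by auto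
  from upto_leading[OF this(2) assms(2) this(1)] obtain N r where
    r: "r \<in> F" "r \<noteq> 0" "N \<in> monomials n" "keys r \<subseteq> keys N" "lm p = lead N r" by blast
  let ?i = "first \<rho> (keys r)"
  obtain K where K: "K \<in> circuits" "K \<subseteq> keys r" using ex_circuit_subset r by blast
  have i: "first \<rho> K = ?i" if "?i \<in> K"
    using that K first_le[of "keys r"] inj_on_subset[OF inj_keys[OF r(1)] K(2)] circuits_finite
    by (intro first_eqI) auto
  have "K - {first \<rho> K} \<subseteq> keys N - {?i}" using i subset_trans[OF K(2) r(4)] by auto
  also have "\<dots> \<subseteq> keys (lm p)" unfolding r(5) by (rule keys_diff_var)
  finally show ?thesis using K by blast
qed

lemma lm_boundary:
  assumes "r \<in> F" "r \<noteq> 0"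
  shows "lm (relation_boundary r) = sqf (keys r - {first \<rho> (keys r)})" "relation_boundary r \<noteq> 0"
proof -
  let ?i = "first \<rho> (keys r)"
  have N: "sqf (keys r) \<in> monomials n" "keys r \<subseteq> keys (sqf (keys r))"
    using keys_F[OF assms(1)] by (simp_all add: sqf_in_monomials keys_sqf)
  have i: "?i \<in> keys r" using assms(2) by (intro first_in) simp_all
  note lead = sqf_minus_var[OF finite_keys i]
  show "lm (relation_boundary r) = sqf (keys r - {?i})"
    unfolding multiple_sqf lm_multiple(1)[OF assms N] by (rule lead)
  show "relation_boundary r \<noteq> 0"
    unfolding multiple_sqf by (rule lm_multiple(2)[OF assms N])
qed

definition nbc_monos :: "'a mpolynomial set" where
  "nbc_monos = {mono_poly m | m. m \<in> monomials n \<and> nbc \<rho> (keys m)}"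

text \<open>A monomial divisible by a broken circuit is, up to a scalar, the leading term of a multiple of
  the boundary of the circuit, which rewrites it into smaller monomials.\<close>
lemma mono_in_span_nbc:
  assumes "m \<in> monomials n"
  shows "mono_poly m \<in> pm.span (ot_ideal \<union> nbc_monos)"
  using assms
proof (induction m rule: wf_induct_rule[OF wf_lt])
  case (1 m)
  show ?case
  proof (cases "nbc \<rho> (keys m)")
    case True
    then show ?thesis using 1 unfolding nbc_monos_def by (intro pm.span_base) blast
  next
    case False
    then obtain K where K: "K \<in> circuits" "K - {first \<rho> K} \<subseteq> keys m"
      using 1 unfolding nbc_def monomials_def by blast
    then obtain r where r: "r \<in> F" "r \<noteq> 0" "keys r = K" using circuit_relation by blast
    let ?i = "first \<rho> K"
    have i: "?i \<in> K" using K circuits_finite circuits_card[of K] by (intro first_in) auto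
    then have i_n: "?i \<in> {1..n}" using circuits_sub K by blast
    define N where "N = m + var_exp ?i"
    have N: "N \<in> monomials n" unfolding N_def using 1 i_n monomials_add var_in_monomials by blast
    have kN: "keys r \<subseteq> keys N" using K r by (auto simp: N_def keys_add_nat)
    have lead: "lead N r = m" by (simp add: N_def r)
    define c where "c = lookup r ?i"
    have c: "c \<noteq> 0" using i r by (auto simp: c_def in_keys_iff)
    define q where "q = pscale (1 / c) (multiple N r)"
    have q: "q \<in> ot_ideal"
      unfolding q_def using multiple_in_ot[OF r(1) kN N] pideal_closed(5) by (simp add: ot_ideal_def)
    define d where "d = mono_poly m - q"
    have "lookup d m = 0"
      using multiple_keys(2)[OF r(1,2) N kN, unfolded lead, unfolded r(3)] c
      by (simp add: d_def lookup_minus q_def c_def mono_poly_def)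
    have "mono_poly m' \<in> pm.span (ot_ideal \<union> nbc_monos)" if m': "m' \<in> keys d" for m'
    proof -
      have "m' \<noteq> m" using m' \<open>lookup d m = 0\<close> by (auto simp: in_keys_iff)
      then have "m' \<in> keys (multiple N r)"
        using m' by (auto simp: d_def q_def in_keys_iff lookup_minus mono_poly_def lookup_single when_def)
      then have "(m', m) \<in> R" using multiple_keys(1)[OF r(1,2) N kN] lead by simp
      then show ?thesis using 1(1)[of m'] \<open>m' \<noteq> m\<close> R_subset by blast
    qed
    then have "d \<in> pm.span (ot_ideal \<union> nbc_monos)"
      by (subst mpoly_expand[of d]) (intro pm.span_sum pm.span_scale)
    moreover have "q \<in> pm.span (ot_ideal \<union> nbc_monos)" using q by (simp add: pm.span_base)
    ultimately have "d + q \<in> pm.span (ot_ideal \<union> nbc_monos)" by (rule pm.span_add)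
    then show ?thesis by (simp add: d_def)
  qed
qed

lemma nbc_span: "polys n \<subseteq> pm.span (ot_ideal \<union> nbc_monos)"
  unfolding polys_eq_span using mono_in_span_nbc by (intro pm.span_minimal) auto

lemma nbc_independent:
  assumes "p \<in> pm.span nbc_monos" "p \<in> ot_ideal"
  shows "p = 0"
proof (rule ccontr)
  assume "p \<noteq> 0"
  have "nbc_monos = mono_poly ` {m \<in> monomials n. nbc \<rho> (keys m)}" unfolding nbc_monos_def by blast
  then have k: "keys p \<subseteq> {m \<in> monomials n. nbc \<rho> (keys m)}" using span_monos_keys assms(1) by simp
  have "lm p \<in> keys p" using lm_props(1) ot_ideal_sub assms \<open>p \<noteq> 0\<close> by blast
  then have "nbc \<rho> (keys (lm p))" using k by blast
  then show False using leading_broken_circuit[OF assms(2) \<open>p \<noteq> 0\<close>] unfolding nbc_def by blast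
qed

end

section \<open>Counting monomials\<close>

definition box :: "nat set \<Rightarrow> nat \<Rightarrow> (nat \<Rightarrow>\<^sub>0 nat) set" where
  "box A b = {m. keys m \<subseteq> A \<and> (\<forall>i. lookup m i \<le> b)}"

lemma box_card:
  assumes A: "finite A"
  shows "card (box A b) = (b + 1) ^ card A" "finite (box A b)"
proof -
  have "bij_betw (\<lambda>m. restrict (lookup m) A) (box A b) (A \<rightarrow>\<^sub>E {..b})"
  proof (rule bij_betwI[of _ _ _ "\<lambda>f. \<Sum>i\<in>A. single i (f i)"])
    have l: "lookup (\<Sum>i\<in>A. single i (f i)) j = (if j \<in> A then f j else 0)" for f :: "nat \<Rightarrow> nat" and j
    proof -
      have "lookup (\<Sum>i\<in>A. single i (f i)) j = (\<Sum>i\<in>A. if i = j then f j else 0)"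
        unfolding lookup_sum by (rule sum.cong) (auto simp: lookup_single when_def)
      then show ?thesis using A by simp
    qed
    show "(\<lambda>m. restrict (lookup m) A) \<in> box A b \<rightarrow> A \<rightarrow>\<^sub>E {..b}"
      by (auto simp: box_def)
    show "(\<lambda>f. \<Sum>i\<in>A. single i (f i)) \<in> (A \<rightarrow>\<^sub>E {..b}) \<rightarrow> box A b"
      by (auto simp: box_def l in_keys_iff split: if_splits)
    show "(\<Sum>i\<in>A. single i (restrict (lookup m) A i)) = m" if "m \<in> box A b" for m
      by (rule poly_mapping_eqI) (use that in \<open>auto simp: l box_def in_keys_iff\<close>)
    show "restrict (lookup (\<Sum>i\<in>A. single i (f i))) A = f" if "f \<in> A \<rightarrow>\<^sub>E {..b}" for f
      using that by (auto simp: l PiE_def extensional_def)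
  qed
  moreover have "card (A \<rightarrow>\<^sub>E {..b}) = (b + 1) ^ card A" "finite (A \<rightarrow>\<^sub>E {..b})"
    using A by (simp_all add: card_PiE finite_PiE)
  ultimately show "card (box A b) = (b + 1) ^ card A" "finite (box A b)"
    by (simp_all add: bij_betw_same_card bij_betw_finite)
qed

text \<open>Dimensions are compared through the growth of numbers of monomials.\<close>
lemma exponent_le_of_power_bound:
  fixes a q C :: nat
  assumes "\<And>x. 1 \<le> x \<Longrightarrow> x ^ a \<le> C * x ^ q"
  shows "a \<le> q"
proof (rule ccontr)
  assume "\<not> a \<le> q"
  define x :: nat where "x = C + 1"
  have x: "1 \<le> x" by (simp add: x_def)
  have "x ^ (q + 1) \<le> x ^ a" using \<open>\<not> a \<le> q\<close> x by (intro power_increasing) auto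
  also have "\<dots> \<le> C * x ^ q" using assms x by blast
  finally have "x * x ^ q \<le> C * x ^ q" by simp
  then have "x \<le> C" using x by (simp add: mult_le_cancel2)
  then show False by (simp add: x_def)
qed

definition tdeg :: "nat \<Rightarrow> (nat \<Rightarrow>\<^sub>0 nat) \<Rightarrow> nat" where
  "tdeg n m = (\<Sum>i\<in>{1..n}. lookup m i)"

lemma tdeg_add: "tdeg n (a + b) = tdeg n a + tdeg n b"
  by (simp add: tdeg_def lookup_add sum.distrib)

lemma tdeg_zero_iff: "m \<in> monomials n \<Longrightarrow> tdeg n m = 0 \<longleftrightarrow> m = 0"
proof
  assume m: "m \<in> monomials n" "tdeg n m = 0"
  have "lookup m i = 0" for i
  proof (cases "i \<in> {1..n}")
    case True then show ?thesis using m(2) unfolding tdeg_def by simp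
  next
    case False
    then have "i \<notin> keys m" using m(1) unfolding monomials_def by blast
    then show ?thesis by (simp add: in_keys_iff)
  qed
  then show "m = 0" by (rule poly_mapping_eqI[where g = 0, simplified])
qed (simp add: tdeg_def)

lemma box_subset_tdeg: "box {1..n} b \<subseteq> {m \<in> monomials n. tdeg n m < n * b + 1}"
proof
  fix m assume m: "m \<in> box {1..n} b"
  have "tdeg n m \<le> (\<Sum>i\<in>{1..n}. b)" unfolding tdeg_def using m by (intro sum_mono) (simp add: box_def)
  then show "m \<in> {m \<in> monomials n. tdeg n m < n * b + 1}" using m by (simp add: box_def monomials_def)
qed

lemma lookup_le_tdeg:
  assumes "m \<in> monomials n"
  shows "lookup m i \<le> tdeg n m"
proof (cases "i \<in> {1..n}")
  case True then show ?thesis unfolding tdeg_def by (intro member_le_sum) auto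
next
  case False
  then have "i \<notin> keys m" using assms unfolding monomials_def by blast
  then show ?thesis by (simp add: in_keys_iff)
qed

lemma tdeg_subset_box: "{m \<in> monomials n. tdeg n m < k} \<subseteq> box {1..n} (k - 1)"
proof
  fix m assume m: "m \<in> {m \<in> monomials n. tdeg n m < k}"
  have "lookup m i \<le> k - 1" for i using lookup_le_tdeg[of m n i] m by simp linarith
  then show "m \<in> box {1..n} (k - 1)" using m by (simp add: box_def monomials_def)
qed

lemma finite_tdeg: "finite {m \<in> monomials n. tdeg n m < k}"
  using finite_subset[OF tdeg_subset_box] box_card by blast

text \<open>Within the polynomial ring this is the \<open>k\<close>-th power of the ideal of the origin.\<close>
definition high :: "nat \<Rightarrow> nat \<Rightarrow> 'k::field mpolynomial set" where
  "high n k = {p. keys p \<subseteq> {m. k \<le> tdeg n m}}"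

lemma subspace_high [simp]: "pm.subspace (high n k)"
  unfolding high_def by (rule subspace_keys)

lemma high_mult: "p \<in> high n a \<Longrightarrow> q \<in> high n b \<Longrightarrow> p * q \<in> high n (a + b)"
  using Poly_Mapping.keys_mult[of p q] by (fastforce simp: high_def tdeg_add)

lemma high_0 [simp]: "p \<in> high n 0"
  by (simp add: high_def)

lemma pideal_finite:
  assumes "finite G" "q \<in> pideal n G"
  shows "\<exists>h. (\<forall>g\<in>G. h g \<in> polys n) \<and> q = (\<Sum>g\<in>G. h g * g)"
  using assms
proof (induction G arbitrary: q rule: finite_induct)
  case (insert a G)
  then obtain u where u: "u \<in> polys n" "q - u * a \<in> pideal n G" using pideal_insert by blast
  then obtain h where h: "\<forall>g\<in>G. h g \<in> polys n" "q - u * a = (\<Sum>g\<in>G. h g * g)"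
    using insert.IH by blast
  have "(\<Sum>g\<in>G. (h(a := u)) g * g) = (\<Sum>g\<in>G. h g * g)"
    using insert.hyps by (intro sum.cong) auto
  then have "q = (\<Sum>g\<in>insert a G. (h(a := u)) g * g)"
    using insert.hyps h(2) by (simp add: algebra_simps)
  then show ?case using u h by (intro exI[of _ "h(a := u)"]) auto
qed simp

text \<open>If \<open>N\<close> spans the polynomial ring modulo the ideal of a finite set \<open>G\<close> of polynomials without constant
  term, up to terms of arbitrarily high order, then iterating the expansion shows that the
  products of \<open>N\<close> with the monomials in \<open>G\<close> span everything. So \<open>N\<close> cannot be too small.\<close>
lemma spanning_count:
  fixes G :: "'k::field mpolynomial set"
  assumes G: "finite G" "G \<subseteq> polys n" "G \<subseteq> high n 1" and N: "N \<subseteq> monomials n"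
    and span: "\<And>k p. p \<in> polys n \<Longrightarrow> \<exists>q\<in>pideal n G. \<exists>a\<in>pm.span (mono_poly ` N). p - q - a \<in> high n k"
  shows "card {m \<in> monomials n. tdeg n m < k} \<le> card {m \<in> N. tdeg n m < k} * k ^ card G"
proof -
  define E where "E k N = (\<lambda>(\<nu>, \<beta>). mono_poly \<nu> * (\<Prod>g\<in>G. g ^ \<beta> g)) ` (N \<times> (G \<rightarrow>\<^sub>E {..<k}))" for k :: nat and N
  have E_mult: "a * g \<in> pm.span (E (Suc k) N)" if "g \<in> G" "a \<in> pm.span (E k N)" for a g k
  proof -
    have "pm.subspace {a. a * g \<in> pm.span (E (Suc k) N)}"
      by (rule pm.subspaceI)
        (auto simp: distrib_right pscale_mult_left intro: pm.span_zero pm.span_add pm.span_scale)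
    moreover have "E k N \<subseteq> {a. a * g \<in> pm.span (E (Suc k) N)}"
    proof
      fix a assume "a \<in> E k N"
      then obtain \<nu> \<beta> where a: "a = mono_poly \<nu> * (\<Prod>g\<in>G. g ^ \<beta> g)" "\<nu> \<in> N" "\<beta> \<in> G \<rightarrow>\<^sub>E {..<k}"
        unfolding E_def by auto
      define \<beta>' where "\<beta>' = \<beta>(g := Suc (\<beta> g))"
      have "\<beta>' \<in> G \<rightarrow>\<^sub>E {..<Suc k}"
        using a(3) \<open>g \<in> G\<close> unfolding \<beta>'_def by (auto simp: PiE_iff extensional_def less_Suc_eq)
      moreover have "(\<Prod>g\<in>G. g ^ \<beta>' g) = (\<Prod>g\<in>G. g ^ \<beta> g) * g"
      proof -
        have "(\<Prod>h\<in>G - {g}. h ^ \<beta>' h) = (\<Prod>h\<in>G - {g}. h ^ \<beta> h)"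
          by (rule prod.cong) (auto simp: \<beta>'_def)
        then show ?thesis using G(1) \<open>g \<in> G\<close>
          by (simp add: prod.remove[of G g] \<beta>'_def mult_ac)
      qed
      ultimately have "a * g \<in> E (Suc k) N"
        unfolding E_def using a by (intro image_eqI[of _ _ "(\<nu>, \<beta>')"]) (auto simp: mult.assoc)
      then show "a \<in> {a. a * g \<in> pm.span (E (Suc k) N)}" by (simp add: pm.span_base)
    qed
    ultimately have "pm.span (E k N) \<subseteq> {a. a * g \<in> pm.span (E (Suc k) N)}"
      by (intro pm.span_minimal)
    then show ?thesis using that by blast
  qed
  have expand: "\<exists>a\<in>pm.span (E k N). p - a \<in> high n k" if "p \<in> polys n" for p k
    using that
  proof (induction k arbitrary: p)
    case 0 then show ?case by (auto intro: bexI[of _ 0] pm.span_zero)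
  next
    case (Suc k)
    obtain q a where q: "q \<in> pideal n G" and a: "a \<in> pm.span (mono_poly ` N)" and d: "p - q - a \<in> high n (Suc k)"
      using span[OF Suc.prems] by blast
    obtain h where h: "\<forall>g\<in>G. h g \<in> polys n" "q = (\<Sum>g\<in>G. h g * g)" using pideal_finite[OF G(1) q] by blast
    have "\<exists>c. \<forall>g\<in>G. c g \<in> pm.span (E k N) \<and> h g - c g \<in> high n k"
      using Suc.IH h(1) by (intro bchoice) blast
    then obtain c where c: "\<And>g. g \<in> G \<Longrightarrow> c g \<in> pm.span (E k N) \<and> h g - c g \<in> high n k" by blast
    have "mono_poly ` N \<subseteq> E (Suc k) N"
    proof
      fix x :: "'k mpolynomial" assume "x \<in> mono_poly ` N"
      then obtain \<nu> where \<nu>: "\<nu> \<in> N" "x = mono_poly \<nu>" by blast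
      have "restrict (\<lambda>_. 0) G \<in> G \<rightarrow>\<^sub>E {..<Suc k}" by auto
      then show "x \<in> E (Suc k) N"
        unfolding E_def using \<nu> by (intro image_eqI[of _ _ "(\<nu>, restrict (\<lambda>_. 0) G)"]) auto
    qed
    then have a': "a \<in> pm.span (E (Suc k) N)" using a pm.span_mono by blast
    have "(h g - c g) * g \<in> high n (Suc k)" if "g \<in> G" for g
      using high_mult[of "h g - c g" n k g 1] c[OF that] G(3) that by auto
    then have "(p - q - a) + (\<Sum>g\<in>G. (h g - c g) * g) \<in> high n (Suc k)"
      using d by (intro pm.subspace_add[OF subspace_high] pm.subspace_sum[OF subspace_high])
    also have "(p - q - a) + (\<Sum>g\<in>G. (h g - c g) * g) = p - (a + (\<Sum>g\<in>G. c g * g))"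
      by (simp add: h(2) left_diff_distrib sum_subtractf)
    finally have "p - (a + (\<Sum>g\<in>G. c g * g)) \<in> high n (Suc k)" .
    moreover have "a + (\<Sum>g\<in>G. c g * g) \<in> pm.span (E (Suc k) N)"
      using a' E_mult c by (intro pm.span_add pm.span_sum) auto
    ultimately show ?case by (rule bexI)
  qed
  let ?A = "{m \<in> monomials n. tdeg n m < k}" and ?N = "{m \<in> N. tdeg n m < k}"
  have fA: "finite ?A" by (rule finite_tdeg)
  have fN: "finite ?N" by (rule finite_subset[OF _ fA]) (use N in blast)
  interpret P: Vector_Spaces.linear pscale pscale "proj ?A :: 'k mpolynomial \<Rightarrow> _" by (rule linear_proj[OF fA])
  have proj_high: "proj ?A p = 0" if "p \<in> high n k" for p :: "'k mpolynomial"
  proof (rule poly_mapping_eqI)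
    fix m show "lookup (proj ?A p) m = lookup 0 m"
      using that by (auto simp: lookup_proj[OF fA] high_def in_keys_iff)
  qed
  have E_high: "x \<in> E k ?N \<or> proj ?A x = 0" if xE: "x \<in> E k N" for x
  proof -
    obtain \<nu> \<beta> where x: "x = mono_poly \<nu> * (\<Prod>g\<in>G. g ^ \<beta> g)" "\<nu> \<in> N" "\<beta> \<in> G \<rightarrow>\<^sub>E {..<k}"
      using xE unfolding E_def by auto
    show ?thesis
    proof (cases "tdeg n \<nu> < k")
      case True then show ?thesis using x unfolding E_def by auto
    next
      case False
      then have "mono_poly \<nu> \<in> (high n k :: 'k mpolynomial set)" by (simp add: high_def mono_poly_def)
      then have "x \<in> high n k"
        using high_mult[of "mono_poly \<nu>" n k "\<Prod>g\<in>G. g ^ \<beta> g" 0] x(1) by simp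
      then show ?thesis using proj_high by simp
    qed
  qed
  have sub: "(\<lambda>m. single m (1::'k)) ` ?A \<subseteq> pm.span (proj ?A ` E k ?N)"
  proof
    fix x :: "'k mpolynomial" assume "x \<in> (\<lambda>m. single m 1) ` ?A"
    then obtain m where m: "m \<in> ?A" "x = single m 1" by blast
    obtain a where a: "a \<in> pm.span (E k N)" "x - a \<in> high n k"
      using expand[of x] m by (auto simp: polys_def)
    have "proj ?A x = x"
      using m by (intro poly_mapping_eqI) (auto simp: lookup_proj[OF fA] lookup_single when_def)
    moreover have "proj ?A x = proj ?A a" using proj_high[OF a(2)] P.diff[of x a] by simp
    moreover have "proj ?A a \<in> pm.span (proj ?A ` E k N)" using a(1) P.span_image[of "E k N"] by blast
    moreover have "pm.span (proj ?A ` E k N) \<subseteq> pm.span (insert 0 (proj ?A ` E k ?N))"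
      using E_high by (intro pm.span_mono) blast
    ultimately show "x \<in> pm.span (proj ?A ` E k ?N)" unfolding pm.span_insert_0 by (simp only: subset_iff)
  qed
  have fPi: "finite (G \<rightarrow>\<^sub>E {..<k})" by (rule finite_PiE[OF G(1)]) (rule finite_lessThan)
  have fNP: "finite (?N \<times> (G \<rightarrow>\<^sub>E {..<k}))" by (rule finite_cartesian_product[OF fN fPi])
  have fE: "finite (E k ?N)" unfolding E_def by (rule finite_imageI[OF fNP])
  have "card ((\<lambda>m. single m (1::'k)) ` ?A) \<le> card (proj ?A ` E k ?N)"
    by (rule conjunct2[OF pm.independent_span_bound[OF finite_imageI[OF fE] independent_singles sub]])
  moreover have "card ((\<lambda>m. single m (1::'k)) ` ?A) = card ?A"
    by (intro card_image inj_onI) simp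
  moreover have "card (proj ?A ` E k ?N) \<le> card (E k ?N)" using fE by (rule card_image_le)
  moreover have "card (E k ?N) \<le> card (?N \<times> (G \<rightarrow>\<^sub>E {..<k}))"
    unfolding E_def by (rule card_image_le[OF fNP])
  moreover have "card (?N \<times> (G \<rightarrow>\<^sub>E {..<k})) = card ?N * k ^ card G"
    unfolding card_cartesian_product card_PiE[OF G(1)] by simp
  ultimately show ?thesis by simp
qed

text \<open>The counterpart of Krull's height theorem. If the quotient is spanned by monomials in at most \<open>s\<close> variables at a
  time, its monomials of degree less than \<open>k\<close> number \<open>O(k\<^sup>s)\<close>, so that, by the previous count, all monomials
  number \<open>O(k\<^sup>s\<^sup>+\<^sup>p)\<close>, where \<open>p\<close> is the number of equations.\<close>
lemma spanning_bound:
  fixes G :: "'k::field mpolynomial set"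
  assumes "finite G" "G \<subseteq> polys n" "G \<subseteq> high n 1" and N: "N \<subseteq> monomials n" "\<And>m. m \<in> N \<Longrightarrow> card (keys m) \<le> s"
    and "\<And>k p. p \<in> polys n \<Longrightarrow> \<exists>q\<in>pideal n G. \<exists>a\<in>pm.span (mono_poly ` N). p - q - a \<in> high n k"
  shows "n \<le> s + card G"
proof (rule exponent_le_of_power_bound)
  fix x :: nat assume x: "1 \<le> x"
  define b where "b = x - 1"
  define k where "k = n * b + 1"
  let ?S = "{B. B \<subseteq> {1..n} \<and> card B \<le> s}"
  have fS: "finite ?S" by (rule finite_subset[of _ "Pow {1..n}"]) auto
  have "{m \<in> N. tdeg n m < k} \<subseteq> (\<Union>B\<in>?S. box B (k - 1))"
  proof
    fix m assume m: "m \<in> {m \<in> N. tdeg n m < k}"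
    then have mon: "m \<in> monomials n" using N by blast
    have "lookup m i \<le> k - 1" for i using lookup_le_tdeg[OF mon, of i] m by simp linarith
    then show "m \<in> (\<Union>B\<in>?S. box B (k - 1))"
      using m N(2) mon by (intro UN_I[of "keys m"]) (auto simp: box_def monomials_def)
  qed
  then have "card {m \<in> N. tdeg n m < k} \<le> card (\<Union>B\<in>?S. box B (k - 1))"
    using fS box_card(2) finite_subset[of _ "{1..n}"] by (intro card_mono finite_UN_I) blast+
  also have "\<dots> \<le> (\<Sum>B\<in>?S. card (box B (k - 1)))" using fS by (rule card_UN_le)
  also have "\<dots> \<le> (\<Sum>B\<in>?S. k ^ s)"
  proof (rule sum_mono)
    fix B assume B: "B \<in> ?S"
    then have "card (box B (k - 1)) = k ^ card B" using box_card(1)[of B "k - 1"] finite_subset[of B "{1..n}"] by (simp add: k_def)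
    also have "\<dots> \<le> k ^ s" using B by (intro power_increasing) (auto simp: k_def)
    finally show "card (box B (k - 1)) \<le> k ^ s" .
  qed
  also have "\<dots> \<le> 2 ^ n * k ^ s"
  proof -
    have "card ?S \<le> card (Pow {1..n})" by (intro card_mono) auto
    then show ?thesis by (simp add: card_Pow)
  qed
  finally have N_le: "card {m \<in> N. tdeg n m < k} \<le> 2 ^ n * k ^ s" .
  have "x ^ n = card (box {1..n} b)" using x by (simp add: box_card b_def)
  also have "\<dots> \<le> card {m \<in> monomials n. tdeg n m < k}"
    unfolding k_def by (rule card_mono[OF finite_tdeg box_subset_tdeg])
  also have "\<dots> \<le> card {m \<in> N. tdeg n m < k} * k ^ card G"
    by (rule spanning_count[OF assms(1-4,6)])
  also have "\<dots> \<le> 2 ^ n * k ^ s * k ^ card G" using N_le by (rule mult_le_mono1)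
  also have "\<dots> = 2 ^ n * k ^ (s + card G)" by (simp add: power_add)
  also have "\<dots> \<le> 2 ^ n * ((n + 1) * x) ^ (s + card G)"
    using x by (intro mult_le_mono power_mono) (auto simp: k_def b_def algebra_simps)
  finally show "x ^ n \<le> (2 ^ n * (n + 1) ^ (s + card G)) * x ^ (s + card G)"
    by (simp only: power_mult_distrib mult.assoc)
qed

section \<open>Regular sequences cut down the dimension\<close>

text \<open>Linear independence in the quotient by \<open>J\<close>, stated without forming the quotient.\<close>
definition indep_mod :: "'k::field mpolynomial set \<Rightarrow> 'k mpolynomial set \<Rightarrow> bool" where
  "indep_mod J X \<longleftrightarrow> (\<forall>c. (\<Sum>x\<in>X. pscale (c x) x) \<in> J \<longrightarrow> (\<forall>x\<in>X. c x = 0))"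

text \<open>In a relation among the \<open>x f\<^sup>b\<close>, the terms with \<open>b = 0\<close> vanish modulo \<open>f\<close>, so their coefficients are zero. The
  rest is divisible by \<open>f\<close>, which can be cancelled.\<close>
lemma indep_mod_powers:
  fixes f :: "'k::field mpolynomial"
  assumes X: "finite X" "X \<subseteq> polys n" and f: "f \<in> polys n"
    and nzd: "\<And>g. g \<in> polys n \<Longrightarrow> f * g \<in> pideal n A \<Longrightarrow> g \<in> pideal n A"
    and ind: "indep_mod (pideal n (insert f A)) X"
    and "(\<Sum>x\<in>X. \<Sum>b<k. pscale (c x b) (x * f ^ b)) \<in> pideal n A" "x \<in> X" "b < k"
  shows "c x b = 0"
  using assms(6-)
proof (induction k arbitrary: c b)
  case (Suc k)
  let ?Y = "\<Sum>x\<in>X. \<Sum>b<k. pscale (c x (Suc b)) (x * f ^ b)"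
  have eq: "(\<Sum>x\<in>X. \<Sum>b<Suc k. pscale (c x b) (x * f ^ b)) = (\<Sum>x\<in>X. pscale (c x 0) x) + f * ?Y"
    by (simp add: sum.lessThan_Suc_shift sum.distrib sum_distrib_left pscale_mult_right mult_ac del: sum.lessThan_Suc)
  have Y: "?Y \<in> polys n"
    using X f by (intro pm.subspace_sum[OF subspace_polys] pm.subspace_scale[OF subspace_polys] polys_mult polys_power) auto
  have "(\<Sum>x\<in>X. pscale (c x 0) x) - (- ?Y) * f \<in> pideal n A"
    using Suc.prems(1) unfolding eq by (simp add: mult.commute)
  then have "(\<Sum>x\<in>X. pscale (c x 0) x) \<in> pideal n (insert f A)"
    using pm.subspace_neg[OF subspace_polys Y] by (subst pideal_insert) blast
  then have c0: "\<forall>x\<in>X. c x 0 = 0"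
    using spec[OF ind[unfolded indep_mod_def], of "\<lambda>x. c x 0"] by blast
  then have "f * ?Y \<in> pideal n A" using Suc.prems(1) unfolding eq by simp
  then have "?Y \<in> pideal n A" using nzd Y by blast
  then have "c x (Suc b) = 0" if "b < k" for b
    using Suc.IH[of "\<lambda>x b. c x (Suc b)" b] Suc.prems(2) that by blast
  then show ?case using c0 Suc.prems(2,3) by (cases b) auto
qed simp

lemma indep_mod_step:
  fixes f :: "'k::field mpolynomial"
  assumes X: "finite X" "X \<subseteq> polys n" "\<And>x. x \<in> X \<Longrightarrow> keys x \<subseteq> box {1..n} D"
    and f: "f \<in> polys n" "keys f \<subseteq> box {1..n} e"
    and nzd: "\<And>g. g \<in> polys n \<Longrightarrow> f * g \<in> pideal n A \<Longrightarrow> g \<in> pideal n A"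
    and ind: "indep_mod (pideal n (insert f A)) X"
  shows "\<exists>X'. finite X' \<and> X' \<subseteq> polys n \<and> (\<forall>x\<in>X'. keys x \<subseteq> box {1..n} (D + k * e)) \<and>
    card X' = card X * k \<and> indep_mod (pideal n A) X'"
proof -
  define \<phi> where "\<phi> = (\<lambda>(x, b). x * f ^ b)"
  let ?I = "X \<times> {..<k}"
  have fin: "finite ?I" using X by simp
  have indep: "c i = 0" if "(\<Sum>i\<in>?I. pscale (c i) (\<phi> i)) \<in> pideal n A" "i \<in> ?I" for c i
  proof -
    have "(\<Sum>i\<in>?I. pscale (c i) (\<phi> i)) = (\<Sum>x\<in>X. \<Sum>b<k. pscale (c (x, b)) (x * f ^ b))"
      using X by (simp add: sum.cartesian_product \<phi>_def case_prod_unfold)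
    then show ?thesis
      using indep_mod_powers[OF X(1,2) f(1) nzd ind, where k = k and c = "\<lambda>x b. c (x, b)" and x = "fst i" and b = "snd i"] that by auto
  qed
  have inj: "inj_on \<phi> ?I"
  proof (rule inj_onI, rule ccontr)
    fix i j assume ij: "i \<in> ?I" "j \<in> ?I" "\<phi> i = \<phi> j" "i \<noteq> j"
    define c where "c = (\<lambda>l. if l = i then 1 else if l = j then - 1 else (0::'k))"
    have "(\<Sum>l\<in>?I. pscale (c l) (\<phi> l)) = pscale (c i) (\<phi> i) + (pscale (c j) (\<phi> j) + (\<Sum>l\<in>?I - {i} - {j}. pscale (c l) (\<phi> l)))"
      using fin ij by (subst sum.remove[of _ i], simp, simp) (subst sum.remove[of _ j], auto)
    also have "(\<Sum>l\<in>?I - {i} - {j}. pscale (c l) (\<phi> l)) = 0"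
      by (rule sum.neutral) (auto simp: c_def)
    finally have "(\<Sum>l\<in>?I. pscale (c l) (\<phi> l)) = 0" using ij by (simp add: c_def)
    then have "c i = 0" using indep[of c i] ij pideal_closed(1) by metis
    then show False by (simp add: c_def)
  qed
  have pow: "keys (f ^ b) \<subseteq> box {1..n} (b * e)" for b
  proof (induction b)
    case 0 then show ?case by (simp add: box_def)
  next
    case (Suc b)
    have "keys (f * f ^ b) \<subseteq> box {1..n} (Suc b * e)"
    proof
      fix m assume "m \<in> keys (f * f ^ b)"
      then obtain u v where "m = u + v" "u \<in> keys f" "v \<in> keys (f ^ b)"
        using Poly_Mapping.keys_mult[of f "f ^ b"] by blast
      then have uv: "m = u + v" "u \<in> box {1..n} e" "v \<in> box {1..n} (b * e)" using Suc f(2) by blast+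
      then have "lookup m i \<le> Suc b * e" for i
        by (simp add: box_def lookup_add add_mono)
      then show "m \<in> box {1..n} (Suc b * e)"
        using uv Poly_Mapping.keys_add[of u v] by (auto simp: box_def)
    qed
    then show ?case by simp
  qed
  have box: "keys y \<subseteq> box {1..n} (D + k * e)" if yI: "y \<in> \<phi> ` ?I" for y
  proof
    fix m assume m: "m \<in> keys y"
    obtain x b where y: "y = x * f ^ b" "x \<in> X" "b < k" using yI by (auto simp: \<phi>_def)
    obtain u v where "m = u + v" "u \<in> keys x" "v \<in> keys (f ^ b)"
      using m y(1) Poly_Mapping.keys_mult[of x "f ^ b"] by blast
    then have uv: "m = u + v" "u \<in> box {1..n} D" "v \<in> box {1..n} (b * e)" using X(3)[OF y(2)] pow by blast+
    have "b * e \<le> k * e" using y(3) by simp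
    then have "lookup m i \<le> D + k * e" for i
    proof -
      have "lookup u i \<le> D" "lookup v i \<le> b * e" using uv by (auto simp: box_def)
      then show ?thesis unfolding uv(1) lookup_add using \<open>b * e \<le> k * e\<close> by linarith
    qed
    then show "m \<in> box {1..n} (D + k * e)"
      using uv Poly_Mapping.keys_add[of u v] by (auto simp: box_def)
  qed
  have "indep_mod (pideal n A) (\<phi> ` ?I)"
    unfolding indep_mod_def
  proof (intro allI impI ballI)
    fix c y assume s: "(\<Sum>x\<in>\<phi> ` ?I. pscale (c x) x) \<in> pideal n A" and y: "y \<in> \<phi> ` ?I"
    have "(\<Sum>x\<in>\<phi> ` ?I. pscale (c x) x) = (\<Sum>i\<in>?I. pscale ((c \<circ> \<phi>) i) (\<phi> i))"
      by (simp add: sum.reindex[OF inj])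
    then have z: "(c \<circ> \<phi>) i = 0" if "i \<in> ?I" for i using indep[of "c \<circ> \<phi>" i] s that by metis
    obtain i where "i \<in> ?I" "y = \<phi> i" using y by blast
    then show "c y = 0" using z[of i] by simp
  qed
  moreover have "\<phi> ` ?I \<subseteq> polys n" using X f by (auto simp: \<phi>_def intro!: polys_mult polys_power)
  moreover have "card (\<phi> ` ?I) = card X * k" using inj by (simp add: card_image card_cartesian_product)
  ultimately show ?thesis using fin box by (intro exI[of _ "\<phi> ` ?I"]) auto
qed

text \<open>Going down the sequence, each element multiplies the size of the independent set by \<open>k\<close>. In the end the set
  is independent in the polynomial ring and lies in a box.\<close>
lemma regular_count:
  fixes fs :: "'k::field mpolynomial list"
  assumes fs: "set fs \<subseteq> polys n" "\<And>f. f \<in> set fs \<Longrightarrow> keys f \<subseteq> box {1..n} e"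
    and nzd: "\<And>i g. i < length fs \<Longrightarrow> g \<in> polys n \<Longrightarrow> fs ! i * g \<in> pideal n (set (take i fs)) \<Longrightarrow>
      g \<in> pideal n (set (take i fs))"
    and X: "finite X" "X \<subseteq> polys n" "\<And>x. x \<in> X \<Longrightarrow> keys x \<subseteq> box {1..n} D" "indep_mod (pideal n (set fs)) X"
  shows "card X * k ^ length fs \<le> (D + length fs * (k * e) + 1) ^ n"
proof -
  have "\<exists>X'. finite X' \<and> X' \<subseteq> polys n \<and> (\<forall>x\<in>X'. keys x \<subseteq> box {1..n} (D + i * (k * e))) \<and>
      card X' = card X * k ^ i \<and> indep_mod (pideal n (set (take (length fs - i) fs))) X'"
    if "i \<le> length fs" for i
    using that
  proof (induction i)
    case 0 then show ?case using X by auto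
  next
    case (Suc i)
    let ?j = "length fs - Suc i"
    have j: "?j < length fs" "length fs - i = Suc ?j" using Suc.prems by auto
    obtain X' :: "'k mpolynomial set" where X': "finite X'" "X' \<subseteq> polys n" "\<And>x. x \<in> X' \<Longrightarrow> keys x \<subseteq> box {1..n} (D + i * (k * e))"
      "card X' = card X * k ^ i" "indep_mod (pideal n (set (take (Suc ?j) fs))) X'"
      using Suc.IH Suc.prems j(2) by (metis Suc_leD)
    have "set (take (Suc ?j) fs) = insert (fs ! ?j) (set (take ?j fs))"
      using j(1) by (simp add: take_Suc_conv_app_nth)
    then have ind: "indep_mod (pideal n (insert (fs ! ?j) (set (take ?j fs)))) X'" using X'(5) by simp
    have f: "fs ! ?j \<in> polys n" "keys (fs ! ?j) \<subseteq> box {1..n} e" using fs nth_mem[OF j(1)] by blast+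
    have "D + i * (k * e) + k * e = D + Suc i * (k * e)" "card X * k ^ i * k = card X * k ^ Suc i" by simp_all
    then show ?case
      using indep_mod_step[OF X'(1-3) f nzd[OF j(1)] ind, of k] unfolding X'(4) by metis
  qed
  from this[of "length fs"] obtain X' :: "'k mpolynomial set" where X': "finite X'" "\<And>x. x \<in> X' \<Longrightarrow> keys x \<subseteq> box {1..n} (D + length fs * (k * e))"
    "card X' = card X * k ^ length fs" "indep_mod {0} X'" by auto
  let ?B = "box {1..n} (D + length fs * (k * e))"
  have ind: "pm.independent X'"
    using X'(1,4) by (intro pm.independent_if_scalars_zero) (auto simp: indep_mod_def)
  have sub: "X' \<subseteq> pm.span ((\<lambda>m. single m 1) ` ?B)"
  proof
    fix x assume "x \<in> X'"
    then have "x = proj ?B x"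
      using X'(2)[of x] by (intro poly_mapping_eqI) (auto simp: lookup_proj[OF box_card(2)] in_keys_iff)
    then show "x \<in> pm.span ((\<lambda>m. single m 1) ` ?B)" using proj_in_span by metis
  qed
  have "card X' \<le> card ((\<lambda>m. single m (1::'k)) ` ?B)"
    by (rule conjunct2[OF pm.independent_span_bound[OF finite_imageI[OF box_card(2)[OF finite_atLeastAtMost]] ind sub]])
  also have "\<dots> \<le> card ?B" by (intro card_image_le box_card(2)) simp
  finally show ?thesis using X'(3) by (simp add: box_card)
qed

text \<open>The monomials in the variables of \<open>B\<close> with exponents less than \<open>x\<close>, multiplied by powers less than \<open>x\<close> of the elements of the
  sequence, are independent and have exponents \<open>O(x)\<close>.\<close>
lemma regular_bound:
  fixes fs :: "'k::field mpolynomial list"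
  assumes fs: "set fs \<subseteq> polys n"
    and nzd: "\<And>i g. i < length fs \<Longrightarrow> g \<in> polys n \<Longrightarrow> fs ! i * g \<in> pideal n (set (take i fs)) \<Longrightarrow>
      g \<in> pideal n (set (take i fs))"
    and B: "B \<subseteq> {1..n}"
    and ind: "\<And>p. p \<in> pm.span (mono_poly ` {m. keys m \<subseteq> B}) \<Longrightarrow> p \<in> pideal n (set fs) \<Longrightarrow> p = 0"
  shows "card B + length fs \<le> n"
proof (rule exponent_le_of_power_bound)
  let ?U = "\<Union>f\<in>set fs. \<Union>m\<in>keys f. lookup m ` {1..n}"
  define e where "e = Max (insert 0 ?U)"
  have e: "keys f \<subseteq> box {1..n} e" if "f \<in> set fs" for f
  proof
    fix m assume m: "m \<in> keys f"
    then have mk: "keys m \<subseteq> {1..n}" using fs that by (auto simp: polys_def monomials_def)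
    have "lookup m i \<le> e" for i
    proof (cases "i \<in> {1..n}")
      case True
      then have "lookup m i \<in> insert 0 ?U" using that m by blast
      then show ?thesis unfolding e_def by (intro Max_ge) auto
    next
      case False
      then have "i \<notin> keys m" using mk by blast
      then show ?thesis by (simp add: in_keys_iff)
    qed
    then show "m \<in> box {1..n} e" using mk by (simp add: box_def)
  qed
  have fB: "finite B" using B finite_subset by blast
  fix x :: nat assume x: "1 \<le> x"
  let ?X = "mono_poly ` box B (x - 1) :: 'k mpolynomial set"
  have inj: "inj_on (mono_poly :: _ \<Rightarrow> 'k mpolynomial) (box B (x - 1))" by (rule inj_onI) (simp add: mono_poly_def)
  have "indep_mod (pideal n (set fs)) ?X"
    unfolding indep_mod_def
  proof (intro allI impI)
    fix c assume c: "(\<Sum>y\<in>?X. pscale (c y) y) \<in> pideal n (set fs)"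
    have "(\<Sum>y\<in>?X. pscale (c y) y) \<in> pm.span (mono_poly ` {m. keys m \<subseteq> B})"
      by (intro pm.span_sum pm.span_scale pm.span_base) (auto simp: box_def)
    then have "(\<Sum>y\<in>?X. pscale (c y) y) = 0" using ind c by blast
    then show "\<forall>y\<in>?X. c y = 0"
      using pm.independentD[OF independent_singles[of "box B (x - 1)"], of ?X c] box_card(2)[OF fB]
      by (auto simp: mono_poly_def)
  qed
  then have "card ?X * x ^ length fs \<le> (x - 1 + length fs * (x * e) + 1) ^ n"
    using B box_card(2)[OF fB] by (intro regular_count[OF fs e nzd])
      (auto simp: box_def mono_poly_def polys_def monomials_def)
  also have "card ?X = x ^ card B" using x box_card(1)[OF fB, of "x - 1"] card_image[OF inj] by simp
  also have "x - 1 + length fs * (x * e) + 1 = (1 + length fs * e) * x" using x by (simp add: algebra_simps)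
  finally show "x ^ (card B + length fs) \<le> (1 + length fs * e) ^ n * x ^ n"
    by (simp only: power_add power_mult_distrib)
qed

section \<open>Few generators suffice\<close>

text \<open>Choose a linear map with kernel \<open>W'\<close> and select from the image of \<open>G\<close> a basis; it is no larger than the
  image of \<open>T\<close>.\<close>
lemma relative_exchange:
  fixes W' :: "('a \<Rightarrow>\<^sub>0 'k::field) set"
  assumes W': "pm.subspace W'" and T: "finite T" and G: "G \<subseteq> pm.span (W' \<union> T)"
  shows "\<exists>D\<subseteq>G. finite D \<and> card D \<le> card T \<and> G \<subseteq> pm.span (W' \<union> D)"
proof -
  obtain B' where B': "B' \<subseteq> W'" "pm.independent B'" "W' \<subseteq> pm.span B'"
    using pm.maximal_independent_subset[of W'] by blast
  have span_B': "pm.span B' = W'" using B' W' pm.span_minimal by blast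
  obtain B where B: "B' \<subseteq> B" "pm.independent B" "UNIV \<subseteq> pm.span B"
    by (rule pm.maximal_independent_subset_extend[OF subset_UNIV B'(2)])
  define \<phi> where "\<phi> = pmp.construct B (\<lambda>b. if b \<in> B' then 0 else b)"
  have lin: "Vector_Spaces.linear pscale pscale \<phi>"
    unfolding \<phi>_def by (rule pmp.linear_construct[OF B(2)])
  interpret \<phi>: Vector_Spaces.linear pscale pscale \<phi> by (rule lin)
  have basis: "\<phi> b = (if b \<in> B' then 0 else b)" if "b \<in> B" for b
    unfolding \<phi>_def using pmp.construct_basis[OF B(2) that] .
  have "x \<in> {x. \<phi> x - x \<in> W'}" for x
  proof -
    have "pm.subspace {x. \<phi> x - x \<in> W'}"
    proof (rule pm.subspaceI)
      show "x + y \<in> {x. \<phi> x - x \<in> W'}" if "x \<in> {x. \<phi> x - x \<in> W'}" "y \<in> {x. \<phi> x - x \<in> W'}" for x y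
        using pm.subspace_add[OF W', of "\<phi> x - x" "\<phi> y - y"] that by (simp add: \<phi>.add algebra_simps)
      show "pscale c x \<in> {x. \<phi> x - x \<in> W'}" if "x \<in> {x. \<phi> x - x \<in> W'}" for c x
        using pm.subspace_scale[OF W', of "\<phi> x - x" c] that by (simp add: \<phi>.scale pm.scale_right_diff_distrib)
    qed (use W' in \<open>simp add: pm.subspace_0\<close>)
    moreover have "B \<subseteq> {x. \<phi> x - x \<in> W'}"
      using basis B'(1) pm.subspace_0[OF W'] pm.subspace_neg[OF W'] by auto
    ultimately show ?thesis using B(3) pm.span_minimal by blast
  qed
  then have near: "\<phi> x - x \<in> W'" for x by blast
  have ker: "x \<in> W'" if "\<phi> x = 0" for x
    using near[of x] that pm.subspace_neg[OF W', of "- x"] by simp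
  have zero: "\<phi> x = 0" if "x \<in> W'" for x
  proof (rule \<phi>.eq_0_on_span[of B'])
    show "\<phi> b = 0" if "b \<in> B'" for b using basis[OF subsetD[OF B(1) that]] that by simp
    show "x \<in> pm.span B'" using that unfolding span_B' .
  qed
  have GT: "\<phi> ` G \<subseteq> pm.span (\<phi> ` T)"
  proof -
    have "\<phi> ` G \<subseteq> pm.span (\<phi> ` (W' \<union> T))" using G \<phi>.span_image by blast
    moreover have "pm.span (\<phi> ` (W' \<union> T)) \<subseteq> pm.span (insert 0 (\<phi> ` T))"
      using zero by (intro pm.span_mono) auto
    ultimately show ?thesis unfolding pm.span_insert_0 by (rule order_trans)
  qed
  obtain D0 where D0: "D0 \<subseteq> \<phi> ` G" "pm.independent D0" "\<phi> ` G \<subseteq> pm.span D0"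
    using pm.maximal_independent_subset[of "\<phi> ` G"] by blast
  have D0_card: "finite D0" "card D0 \<le> card (\<phi> ` T)"
    using pm.independent_span_bound[of "\<phi> ` T" D0] T D0 GT by auto
  obtain D where D: "D \<subseteq> G" "inj_on \<phi> D" "D0 = \<phi> ` D"
    using D0(1) subset_image_inj[of D0 \<phi> G] by blast
  then have fD: "finite D" using D0_card(1) finite_imageD by blast
  have "card D = card D0" using card_image[OF D(2)] D(3) by simp
  then have "card D \<le> card T" using D0_card(2) card_image_le[OF T, of \<phi>] by linarith
  moreover have "G \<subseteq> pm.span (W' \<union> D)"
  proof
    fix g assume "g \<in> G"
    then have "\<phi> g \<in> \<phi> ` pm.span D" using D0(3) D(3) \<phi>.span_image[of D] by blast
    then obtain d where d: "d \<in> pm.span D" "\<phi> g = \<phi> d" by blast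
    then have "g - d \<in> W'" using ker[of "g - d"] \<phi>.diff by simp
    then have "(g - d) + d \<in> pm.span (W' \<union> D)"
      using d(1) pm.span_mono[of D "W' \<union> D"] by (intro pm.span_add) (auto intro: pm.span_base)
    then show "g \<in> pm.span (W' \<union> D)" by simp
  qed
  ultimately show ?thesis using D(1) fD by blast
qed

text \<open>The product of \<open>J\<close> with the ideal of the origin, if \<open>J\<close> is an ideal.\<close>
definition higher_multiples :: "nat \<Rightarrow> 'k::field mpolynomial set \<Rightarrow> 'k mpolynomial set" where
  "higher_multiples n J = pm.span {mono_poly m * p | m p. m \<in> monomials n \<and> m \<noteq> 0 \<and> p \<in> J}"

lemma pideal_higher: "pideal n A \<subseteq> pm.span (higher_multiples n (pideal n A) \<union> A)"
  unfolding pideal_def[of n A]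
proof (rule pm.span_minimal)
  show "{mono_poly m * a | m a. m \<in> monomials n \<and> a \<in> A}
    \<subseteq> pm.span (higher_multiples n (pm.span {mono_poly m * a | m a. m \<in> monomials n \<and> a \<in> A}) \<union> A)"
    unfolding pideal_def[symmetric]
  proof clarify
    fix m a assume m: "m \<in> monomials n" and a: "a \<in> A"
    show "mono_poly m * a \<in> pm.span (higher_multiples n (pideal n A) \<union> A)"
    proof (cases "m = 0")
      case True
      then show ?thesis using a by (simp add: pm.span_base)
    next
      case False
      then have "mono_poly m * a \<in> higher_multiples n (pideal n A)"
        unfolding higher_multiples_def using m a pideal_base by (intro pm.span_base) blast
      then show ?thesis by (simp add: pm.span_base)
    qed
  qed
qed simp

text \<open>Nakayama's lemma. Modulo its product with the ideal of the origin, the ideal is spanned by \<open>T\<close>, hence by at most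
  \<open>card T\<close> elements of \<open>A\<close>. Substituting this description into itself moves the error to arbitrarily
  high order.\<close>
lemma few_generators:
  fixes T :: "'k::field mpolynomial set"
  assumes eq: "pideal n A = pideal n T" and T: "finite T"
  shows "\<exists>D\<subseteq>A. finite D \<and> card D \<le> card T \<and> pideal n A \<subseteq> pm.span (higher_multiples n (pideal n A) \<union> D) \<and>
    (\<forall>k. \<forall>p\<in>pideal n A. \<exists>q\<in>pideal n D. p - q \<in> high n k)"
proof -
  let ?J = "pideal n A" and ?H = "higher_multiples n (pideal n A)"
  have sH: "pm.subspace ?H" by (simp add: higher_multiples_def)
  have "A \<subseteq> pm.span (?H \<union> T)" using pideal_higher[of n T] pideal_base[of _ A n] unfolding eq[symmetric] by blast
  from relative_exchange[OF sH T this] obtain D where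
    D: "D \<subseteq> A" "finite D" "card D \<le> card T" "A \<subseteq> pm.span (?H \<union> D)" by blast
  have "pm.span (?H \<union> A) \<subseteq> pm.span (?H \<union> D)"
    using D(4) pm.span_superset[of "?H \<union> D"] by (intro pm.span_minimal) auto
  then have J: "?J \<subseteq> pm.span (?H \<union> D)" using pideal_higher[of n A] by blast
  have "\<exists>q\<in>pideal n D. p - q \<in> high n k" if "p \<in> ?J" for k p
    using that
  proof (induction k arbitrary: p)
    case 0 then show ?case using pideal_closed(1) by (auto intro!: bexI[of _ 0])
  next
    case (Suc k)
    let ?X = "{p. \<exists>q\<in>pideal n D. p - q \<in> high n (Suc k)}"
    have X: "pm.subspace ?X"
    proof (rule pm.subspaceI)
      show "0 \<in> ?X" using pideal_closed(1) pm.subspace_0[OF subspace_high] by (auto intro!: bexI[of _ 0])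
      show "x + y \<in> ?X" if xy: "x \<in> ?X" "y \<in> ?X" for x y
      proof -
        obtain q r where "q \<in> pideal n D" "r \<in> pideal n D" "x - q \<in> high n (Suc k)" "y - r \<in> high n (Suc k)"
          using xy by blast
        then have "q + r \<in> pideal n D" "(x + y) - (q + r) \<in> high n (Suc k)"
          using pideal_closed(2) pm.subspace_add[OF subspace_high, of "x - q" n "Suc k" "y - r"]
          by (auto simp: algebra_simps)
        then show ?thesis by blast
      qed
      show "pscale c x \<in> ?X" if x: "x \<in> ?X" for c x
      proof -
        obtain q where "q \<in> pideal n D" "x - q \<in> high n (Suc k)" using x by blast
        then have "pscale c q \<in> pideal n D" "pscale c x - pscale c q \<in> high n (Suc k)"
          using pideal_closed(5) pm.subspace_scale[OF subspace_high, of "x - q" n "Suc k" c]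
          by (auto simp: pm.scale_right_diff_distrib)
        then show ?thesis by blast
      qed
    qed
    have "?H \<subseteq> ?X"
      unfolding higher_multiples_def
    proof (rule pm.span_minimal[OF _ X], clarify)
      fix m p assume m: "m \<in> monomials n" "m \<noteq> 0" and p: "p \<in> ?J"
      obtain q where q: "q \<in> pideal n D" "p - q \<in> high n k" using Suc.IH p by blast
      have "mono_poly m \<in> (high n 1 :: 'k mpolynomial set)"
        using tdeg_zero_iff[OF m(1)] m(2) by (simp add: high_def mono_poly_def)
      then have "mono_poly m * p - mono_poly m * q \<in> high n (Suc k)"
        using high_mult[OF _ q(2), of "mono_poly m" 1] by (simp add: right_diff_distrib)
      then show "\<exists>q\<in>pideal n D. mono_poly m * p - q \<in> high n (Suc k)"
        using pideal_mono_mult[OF m(1) q(1)] by blast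
    qed
    moreover have "D \<subseteq> ?X"
      using pideal_base[of _ D n] pm.subspace_0[OF subspace_high] by (auto intro!: bexI)
    ultimately have "pm.span (?H \<union> D) \<subseteq> ?X" using X by (intro pm.span_minimal) auto
    then show ?case using J Suc.prems by blast
  qed
  then show ?thesis using D J by blast
qed

section \<open>Families of circuits with disjoint broken circuits\<close>

lemma combined_circuit_iff:
  "x \<in> combined_circuit E \<longleftrightarrow> (\<exists>C\<in>E. x \<in> C \<and> (\<forall>C'\<in>E. x \<in> C' \<longrightarrow> C' = C))"
proof -
  have "x \<in> \<Union>{D \<inter> D' | D D'. D \<in> E \<and> D' \<in> E \<and> D \<noteq> D'} \<longleftrightarrow>
      (\<exists>D\<in>E. \<exists>D'\<in>E. D \<noteq> D' \<and> x \<in> D \<and> x \<in> D')"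
    by auto
  then have "x \<in> combined_circuit E \<longleftrightarrow>
      (\<exists>C\<in>E. x \<in> C) \<and> \<not> (\<exists>D\<in>E. \<exists>D'\<in>E. D \<noteq> D' \<and> x \<in> D \<and> x \<in> D')"
    unfolding combined_circuit_def by simp
  then show ?thesis by metis
qed

lemma intersection_graph_sym: "(C, C') \<in> intersection_graph E \<Longrightarrow> (C', C) \<in> intersection_graph E"
  by (auto simp: intersection_graph_def)

definition connected_family :: "nat set set \<Rightarrow> bool" where
  "connected_family E \<longleftrightarrow> (\<forall>u\<in>E. \<forall>v\<in>E. (u, v) \<in> (intersection_graph E)\<^sup>*)"

lemma connected_family_insert:
  assumes "connected_family E" "A \<in> E" "C \<inter> A \<noteq> {}"
  shows "connected_family (insert C E)"
proof -
  let ?G = "intersection_graph (insert C E)"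
  have "(intersection_graph E)\<^sup>* \<subseteq> ?G\<^sup>*"
    by (rule rtrancl_mono) (auto simp: intersection_graph_def)
  then have E: "(u, v) \<in> ?G\<^sup>*" if "u \<in> E" "v \<in> E" for u v
    using assms(1) that unfolding connected_family_def by blast
  have "(C, A) \<in> ?G\<^sup>*" "(A, C) \<in> ?G\<^sup>*"
    using assms(2,3) by (cases "A = C"; auto simp: intersection_graph_def intro!: r_into_rtrancl)+
  then have "(u, A) \<in> ?G\<^sup>* \<and> (A, u) \<in> ?G\<^sup>*" if "u \<in> insert C E" for u
    using that E assms(2) by blast
  then show ?thesis unfolding connected_family_def by (meson rtrancl_trans)
qed

lemma connected_family_exit:
  assumes "connected_family E" "E' \<subseteq> E" "E' \<noteq> {}" "E' \<noteq> E"
  shows "\<exists>C\<in>E - E'. \<exists>A\<in>E'. C \<inter> A \<noteq> {}"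
proof (rule ccontr)
  assume neg: "\<not> ?thesis"
  obtain u where u: "u \<in> E'" using assms by blast
  obtain v where v: "v \<in> E" "v \<notin> E'" using assms by blast
  have "(u, v) \<in> (intersection_graph E)\<^sup>*" using assms u v unfolding connected_family_def by blast
  then have "v \<in> E'"
  proof (induction rule: rtrancl_induct)
    case (step y z)
    then show ?case using neg unfolding intersection_graph_def by blast
  qed (rule u)
  then show False using v by blast
qed

lemma graph_cycle_neighbours:
  assumes "graph_cycle V E p" "k < length p" "\<And>u v. (u, v) \<in> E \<Longrightarrow> (v, u) \<in> E"
  shows "\<exists>a\<in>set p. \<exists>b\<in>set p. a \<noteq> b \<and> (p ! k, a) \<in> E \<and> (p ! k, b) \<in> E"
proof -
  have p: "3 \<le> length p" "distinct p" "(last p, hd p) \<in> E"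
    and suc: "\<And>i. Suc i < length p \<Longrightarrow> (p ! i, p ! Suc i) \<in> E"
    using assms(1) unfolding graph_cycle_def successively_conv_nth by auto
  have hl: "hd p = p ! 0" "last p = p ! (length p - 1)" 
  proof -
    have "p \<noteq> []" using p(1) by auto
    then show "hd p = p ! 0" "last p = p ! (length p - 1)" by (simp_all add: hd_conv_nth last_conv_nth)
  qed
  define i j where "i = (if k = 0 then length p - 1 else k - 1)" and "j = (if Suc k = length p then 0 else Suc k)"
  have ij: "i < length p" "j < length p" "i \<noteq> j" using p(1) assms(2) by (auto simp: i_def j_def split: if_splits)
  have "(p ! i, p ! k) \<in> E"
    using p(3) hl suc[of "k - 1"] assms(2) by (auto simp: i_def)
  moreover have "(p ! k, p ! j) \<in> E"
  proof (cases "Suc k = length p")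
    case True
    then have "k = length p - 1" by simp
    then show ?thesis using p(3) hl True by (simp add: j_def)
  next
    case False
    then show ?thesis using suc[of k] assms(2) by (simp add: j_def)
  qed
  ultimately show ?thesis
    using ij p(2) assms(3) by (intro bexI[of _ "p ! i"] bexI[of _ "p ! j"]) (auto simp: nth_eq_iff_index_eq)
qed

text \<open>Disjointness makes such a family a rooted forest. An element \<open>x\<close> lies in the broken circuit of at most one
  member, the parent of all the members with minimum \<open>x\<close>; any other member through \<open>x\<close> has \<open>x\<close> as
  its minimum.\<close>
locale broken_forest =
  fixes \<rho> :: "nat \<Rightarrow> nat" and V :: "nat set" and D :: "nat set set"
  assumes inj: "inj_on \<rho> V" and finite_V: "finite V"
    and sub: "C \<in> D \<Longrightarrow> C \<subseteq> V" and card3: "C \<in> D \<Longrightarrow> 3 \<le> card C"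
    and disj: "C \<in> D \<Longrightarrow> C' \<in> D \<Longrightarrow> C \<noteq> C' \<Longrightarrow> (C - {first \<rho> C}) \<inter> (C' - {first \<rho> C'}) = {}"
begin

abbreviation bc :: "nat set \<Rightarrow> nat set" where
  "bc C \<equiv> C - {first \<rho> C}"

definition child :: "(nat set \<times> nat set) set" where
  "child = {(C, C'). C \<in> D \<and> C' \<in> D \<and> first \<rho> C' \<in> bc C}"

lemma finite_member: "C \<in> D \<Longrightarrow> finite C"
  using sub finite_V finite_subset by blast

lemma finite_D: "finite D"
  by (rule finite_subset[of _ "Pow V"]) (use sub finite_V in auto)

lemma first_member: "C \<in> D \<Longrightarrow> first \<rho> C \<in> C"
  using finite_member card3 by (intro first_in) fastforce+

lemma first_below: "C \<in> D \<Longrightarrow> x \<in> C \<Longrightarrow> \<rho> (first \<rho> C) \<le> \<rho> x"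
  using finite_member by (intro first_le)

lemma first_below_bc: "C \<in> D \<Longrightarrow> x \<in> bc C \<Longrightarrow> \<rho> (first \<rho> C) < \<rho> x"
  using first_less[OF inj sub finite_member] by blast

lemma card_bc: "C \<in> D \<Longrightarrow> 2 \<le> card (bc C)"
  using card3[of C] first_member[of C] finite_member[of C] by simp

lemma two_in_bc: "C \<in> D \<Longrightarrow> \<exists>x y. x \<in> bc C \<and> y \<in> bc C \<and> x \<noteq> y"
  using card_bc[of C] finite_member[of C] by (metis card_le_Suc0_iff_eq finite_Diff not_less_eq_eq numeral_2_eq_2)

lemma meet: "C \<in> D \<Longrightarrow> C' \<in> D \<Longrightarrow> C \<noteq> C' \<Longrightarrow> x \<in> C \<Longrightarrow> x \<in> C' \<Longrightarrow> x = first \<rho> C \<or> x = first \<rho> C'"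
  using disj by blast

lemma child_less: "(A, B) \<in> child \<Longrightarrow> \<rho> (first \<rho> A) < \<rho> (first \<rho> B)"
  unfolding child_def using first_below_bc by blast

lemma child_rtrancl_less: "(A, B) \<in> child\<^sup>* \<Longrightarrow> A = B \<or> \<rho> (first \<rho> A) < \<rho> (first \<rho> B)"
  by (induction rule: rtrancl_induct) (auto dest: child_less)

lemma single_valued_parent: "single_valued (child\<inverse>)"
  unfolding single_valued_def child_def using disj by blast

text \<open>Call a member of the subfamily a leaf if its broken circuit contains no minimum of another member. Then its
  broken circuit is covered only once. If there are two leaves, then one of the two broken circuits avoids the minimum of
  \<open>K\<close>; if there is only one, then the subfamily is a chain below a member whose own
  minimum is covered only once, and this minimum precedes the broken circuit of the leaf.\<close>
lemma broken_circuit_of_once_covered: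
  assumes E: "E \<subseteq> D" "E \<noteq> {}" and K: "combined_circuit E \<subseteq> K" "K \<subseteq> \<Union>E"
  shows "\<exists>C\<in>E. bc C \<subseteq> K - {first \<rho> K}"
proof (rule ccontr)
  assume neg: "\<not> ?thesis"
  let ?ch = "child \<inter> E \<times> E"
  have finE: "finite E" using E finite_D finite_subset by blast
  have "\<Union>E \<subseteq> V" using E sub by blast
  then have finK: "finite K" by (rule finite_subset[OF subset_trans[OF K(2)] finite_V])
  have leaf: "bc C \<subseteq> K" if "C \<in> E" "\<And>C'. C' \<in> E \<Longrightarrow> first \<rho> C' \<notin> bc C" for C
  proof
    fix x assume x: "x \<in> bc C"
    have "C' = C" if "C' \<in> E" "x \<in> C'" for C'
      using meet[of C C' x] x that E(1) \<open>C \<in> E\<close> \<open>\<And>C'. C' \<in> E \<Longrightarrow> first \<rho> C' \<notin> bc C\<close> by blast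
    then have "x \<in> combined_circuit E" using x \<open>C \<in> E\<close> unfolding combined_circuit_iff by blast
    then show "x \<in> K" using K by blast
  qed
  have leaf_first: "first \<rho> K \<in> bc C" if "C \<in> E" "\<And>C'. C' \<in> E \<Longrightarrow> first \<rho> C' \<notin> bc C" for C
    using leaf[OF that] neg that(1) by blast
  have "\<exists>L\<in>E. (C0, L) \<in> child\<^sup>* \<and> (\<forall>C'\<in>E. first \<rho> C' \<notin> bc L)" if C0: "C0 \<in> E" for C0
  proof -
    let ?S = "{L \<in> E. (C0, L) \<in> child\<^sup>*}"
    have S: "finite ?S" "?S \<noteq> {}" using finE C0 by auto
    let ?f = "\<lambda>L. \<rho> (first \<rho> L)"
    have "Max (?f ` ?S) \<in> ?f ` ?S" using S by (intro Max_in) auto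
    then obtain L where L0: "L \<in> ?S" "Max (?f ` ?S) = ?f L" by (rule imageE) simp
    have "?f L' \<le> Max (?f ` ?S)" if "L' \<in> ?S" for L' using S that by (intro Max_ge) auto
    then have L: "L \<in> ?S" "\<forall>L'\<in>?S. \<not> ?f L < ?f L'" using L0 by (auto simp: not_less)
    have "first \<rho> C' \<notin> bc L" if "C' \<in> E" for C'
    proof
      assume c: "first \<rho> C' \<in> bc L"
      then have "(L, C') \<in> child" unfolding child_def using L(1) that E(1) by blast
      then have "C' \<in> ?S" "\<rho> (first \<rho> L) < \<rho> (first \<rho> C')"
        using L(1) that child_less by (auto intro: rtrancl_into_rtrancl)
      then show False using L(2) by blast
    qed
    then show ?thesis using L(1) by blast
  qed
  then have ex_leaf: "\<And>C0. C0 \<in> E \<Longrightarrow> \<exists>L\<in>E. (C0, L) \<in> child\<^sup>* \<and> (\<forall>C'\<in>E. first \<rho> C' \<notin> bc L)" by blast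
  have leaf_unique: "L = L'"
    if "L \<in> E" "\<forall>C'\<in>E. first \<rho> C' \<notin> bc L" "L' \<in> E" "\<forall>C'\<in>E. first \<rho> C' \<notin> bc L'" for L L'
    using leaf_first[of L] leaf_first[of L'] that disj[of L L'] E(1) by blast
  obtain Cm where Cm: "Cm \<in> E" "\<And>C. C \<in> E \<Longrightarrow> \<rho> (first \<rho> Cm) \<le> \<rho> (first \<rho> C)"
    using finite_has_minimal[of "(\<lambda>L. \<rho> (first \<rho> L)) ` E"] finE E(2) by (auto) (metis nat_le_linear)
  let ?v = "first \<rho> Cm"
  obtain L where L: "L \<in> E" "(Cm, L) \<in> child\<^sup>*" "\<forall>C'\<in>E. first \<rho> C' \<notin> bc L"
    using ex_leaf Cm(1) by blast
  have firstK: "first \<rho> K \<in> bc L" using leaf_first L by blast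
  have "?v \<notin> K"
  proof
    assume "?v \<in> K"
    then have "\<rho> (first \<rho> K) \<le> \<rho> ?v" using first_le finK by blast
    moreover have "\<rho> ?v \<le> \<rho> (first \<rho> L)" using Cm(2) L(1) by blast
    moreover have "\<rho> (first \<rho> L) < \<rho> (first \<rho> K)" using first_below_bc firstK L(1) E(1) by blast
    ultimately show False by simp
  qed
  moreover have "?v \<in> Cm" using first_member Cm(1) E(1) by blast
  ultimately obtain C1 where C1: "C1 \<in> E" "C1 \<noteq> Cm" "?v \<in> C1"
    using K(1) Cm(1) unfolding subset_iff combined_circuit_iff by blast
  have "?v \<notin> bc C1" using first_below_bc[of C1 ?v] Cm(2)[OF C1(1)] C1(1) E(1) by fastforce
  then have v1: "first \<rho> C1 = ?v" using C1(3) by simp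
  obtain L1 where L1: "L1 \<in> E" "(C1, L1) \<in> child\<^sup>*" "\<forall>C'\<in>E. first \<rho> C' \<notin> bc L1"
    using ex_leaf C1(1) by blast
  have "L1 = L" using leaf_unique L L1 by blast
  then have "(L, Cm) \<in> (child\<inverse>)\<^sup>*" "(L, C1) \<in> (child\<inverse>)\<^sup>*"
    using L(2) L1(2) by (auto simp: rtrancl_converse)
  then have "(Cm, C1) \<in> (child\<inverse>)\<^sup>* \<or> (C1, Cm) \<in> (child\<inverse>)\<^sup>*"
    by (rule single_valued_confluent[OF single_valued_parent])
  then have "(C1, Cm) \<in> child\<^sup>* \<or> (Cm, C1) \<in> child\<^sup>*" by (auto simp: rtrancl_converse)
  then show False using child_rtrancl_less C1(2) v1 by fastforce
qed

text \<open>The family has no cycles: a connected subfamily meets any other member in at most one point. If the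
  larger of two common points is \<open>w\<close>, then all of the subfamily lies in the part of the forest that hangs
  below \<open>w\<close>.\<close>
lemma connected_meets_once:
  assumes E: "E \<subseteq> D" "connected_family E" and C: "C \<in> D" "C \<notin> E"
    and v: "v \<in> C" "v \<in> \<Union>E" and w: "w \<in> C" "w \<in> \<Union>E"
  shows "v = w"
proof -
  have main: False if vw: "v \<in> C" "v \<in> \<Union>E" "w \<in> C" "w \<in> \<Union>E" "\<rho> v < \<rho> w" for v w
  proof -
    define Z where "Z = {A \<in> D. \<exists>A0\<in>D. first \<rho> A0 = w \<and> (A0, A) \<in> child\<^sup>*}"
    have wC: "w \<in> bc C" using vw(5) first_below[OF C(1) vw(1)] vw(3) by auto
    have step: "B \<in> Z" if A: "A \<in> Z" and AB: "(A, B) \<in> intersection_graph E" for A B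
    proof -
      obtain A0 where A0: "A0 \<in> D" "first \<rho> A0 = w" "(A0, A) \<in> child\<^sup>*" "A \<in> D" using A unfolding Z_def by blast
      obtain x where x: "x \<in> A" "x \<in> B" "B \<in> E" "A \<noteq> B" using AB unfolding intersection_graph_def by blast
      have B: "B \<in> D" "B \<noteq> C" using x E C by blast+
      have into: "B \<in> Z" if "(A', B) \<in> child" "(A0, A') \<in> child\<^sup>*" for A'
        unfolding Z_def using A0(1,2) B(1) rtrancl_into_rtrancl[OF that(2,1)] by blast
      show ?thesis
      proof (cases "x = first \<rho> A")
        case False
        then have "x = first \<rho> B" using meet[OF A0(4) B(1)] x by blast
        then have "(A, B) \<in> child" unfolding child_def using A0(4) B(1) x False by blast
        then show ?thesis using into A0(3) by blast
      next
        case xA: True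
        show ?thesis
        proof (cases "A0 = A")
          case True
          then have xw: "x = w" using xA A0 by simp
          have "x = first \<rho> B"
          proof (rule ccontr)
            assume "x \<noteq> first \<rho> B"
            then show False using disj[OF B(1) C(1) B(2)] x(2) wC xw by blast
          qed
          then show ?thesis unfolding Z_def using B xw by blast
        next
          case False
          then obtain A' where A': "(A0, A') \<in> child\<^sup>*" "(A', A) \<in> child" using A0(3) by (meson rtranclE)
          then have xA': "A' \<in> D" "x \<in> bc A'" using xA unfolding child_def by auto
          show ?thesis
          proof (cases "x = first \<rho> B")
            case True
            then have "(A', B) \<in> child" unfolding child_def using xA' B by blast
            then show ?thesis using into A'(1) by blast
          next
            case False
            then have "A' = B" using disj[OF xA'(1) B(1)] xA'(2) x(2) by blast
            then show ?thesis unfolding Z_def using A'(1) A0 B by blast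
          qed
        qed
      qed
    qed
    obtain B where B: "B \<in> E" "w \<in> B" using vw by blast
    obtain A where A: "A \<in> E" "v \<in> A" using vw by blast
    have "w = first \<rho> B" using disj[of B C] B C E wC by blast
    then have BZ: "B \<in> Z" unfolding Z_def using B E by blast
    have "(B, A) \<in> (intersection_graph E)\<^sup>*" using E(2) A B unfolding connected_family_def by blast
    then have "A \<in> Z" by (induction rule: rtrancl_induct) (use BZ step in auto)
    then obtain A0 where A0: "first \<rho> A0 = w" "(A0, A) \<in> child\<^sup>*" "A \<in> D" unfolding Z_def by blast
    have "\<rho> w \<le> \<rho> (first \<rho> A)" using child_rtrancl_less[OF A0(2)] A0(1) by auto
    also have "\<dots> \<le> \<rho> v" using first_below A0(3) A(2) by blast
    finally show False using vw(5) by simp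
  qed
  have "v \<in> V" "w \<in> V" using v w C sub by blast+
  then show ?thesis using main[of v w] main[of w v] v w inj unfolding inj_on_def by (metis nat_neq_iff)
qed

text \<open>In a cycle consider the member whose minimum has the largest rank. Both of its neighbours meet it in this minimum,
  which is then covered three times.\<close>
lemma no_cycle_if_covered_twice:
  assumes E: "E \<subseteq> D"
    and twice: "\<And>x A B C. A \<in> E \<Longrightarrow> B \<in> E \<Longrightarrow> C \<in> E \<Longrightarrow> x \<in> A \<Longrightarrow> x \<in> B \<Longrightarrow> x \<in> C \<Longrightarrow> A = B \<or> A = C \<or> B = C"
  shows "\<not> graph_cycle E (intersection_graph E) p"
proof
  assume p: "graph_cycle E (intersection_graph E) p"
  have sp: "set p \<subseteq> E" "p \<noteq> []" using p unfolding graph_cycle_def by auto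
  obtain C where C: "C \<in> set p" "\<And>A. A \<in> set p \<Longrightarrow> \<rho> (first \<rho> A) \<le> \<rho> (first \<rho> C)"
    using finite_has_maximal[of "(\<lambda>L. \<rho> (first \<rho> L)) ` set p"] sp(2) by auto (metis nat_le_linear)
  obtain k where k: "k < length p" "C = p ! k" using C(1) by (auto simp: in_set_conv_nth)
  obtain A B where AB: "A \<in> set p" "B \<in> set p" "A \<noteq> B" "(C, A) \<in> intersection_graph E" "(C, B) \<in> intersection_graph E"
    using graph_cycle_neighbours[OF p k(1) intersection_graph_sym] k(2) by blast
  have "first \<rho> C \<in> A" if A: "A \<in> set p" "(C, A) \<in> intersection_graph E" for A
  proof -
    obtain x where x: "x \<in> C" "x \<in> A" "A \<noteq> C" "A \<in> D" "C \<in> D"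
      using A(2) E unfolding intersection_graph_def by blast
    have "x = first \<rho> C"
    proof (rule ccontr)
      assume "x \<noteq> first \<rho> C"
      then have "x = first \<rho> A" "x \<in> bc C" using meet x by blast+
      then show False using first_below_bc[OF x(5), of x] C(2)[OF A(1)] by simp
    qed
    then show ?thesis using x by simp
  qed
  then have "first \<rho> C \<in> A" "first \<rho> C \<in> B" using AB by blast+
  moreover have "first \<rho> C \<in> C" "A \<in> E" "B \<in> E" "C \<in> E" using first_member C(1) AB sp(1) E by blast+
  ultimately have "A = B \<or> A = C \<or> B = C" using twice by blast
  then show False using AB unfolding intersection_graph_def by blast
qed

end

lemma tree_covered_twice:
  assumes "tree_family E" "A \<in> E" "B \<in> E" "C \<in> E" "x \<in> A" "x \<in> B" "x \<in> C"
  shows "A = B \<or> A = C \<or> B = C"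
proof (rule ccontr)
  assume "\<not> ?thesis"
  then have "graph_cycle E (intersection_graph E) [A, B, C]"
    using assms unfolding graph_cycle_def intersection_graph_def by auto
  then show False using assms(1) unfolding tree_family_def graph_tree_def by blast
qed

lemma tree_family_connected: "tree_family E \<Longrightarrow> connected_family E" "tree_family E \<Longrightarrow> E \<noteq> {}"
  unfolding tree_family_def graph_tree_def connected_family_def by auto

section \<open>Sparse families have disjoint broken circuits for a suitable ordering\<close>

lemma extend_ranking:
  assumes "inj_on \<rho> P" "finite Q" "\<forall>x\<in>P. \<rho> x < b" "P \<inter> Q = {}"
  shows "\<exists>\<rho>' b'. inj_on \<rho>' (P \<union> Q) \<and> (\<forall>x\<in>P. \<rho>' x = \<rho> x) \<and> (\<forall>x\<in>Q. b \<le> \<rho>' x) \<and> (\<forall>x\<in>P \<union> Q. \<rho>' x < (b'::nat))"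
proof -
  obtain h :: "'a \<Rightarrow> nat" where h: "inj_on h Q" using finite_imp_inj_to_nat_seg[OF assms(2)] by blast
  define \<rho>' where "\<rho>' x = (if x \<in> P then \<rho> x else b + h x)" for x
  define b' where "b' = b + Suc (Max (insert 0 (h ` Q)))"
  have "inj_on \<rho>' (P \<union> Q)"
  proof (rule inj_onI)
    fix x y assume xy: "x \<in> P \<union> Q" "y \<in> P \<union> Q" "\<rho>' x = \<rho>' y"
    have less: "\<rho>' u < b" if "u \<in> P" for u using that assms(3) by (simp add: \<rho>'_def)
    have ge: "b \<le> \<rho>' u" if "u \<notin> P" for u using that by (simp add: \<rho>'_def)
    have iff: "x \<in> P \<longleftrightarrow> y \<in> P" using less[of x] less[of y] ge[of x] ge[of y] xy(3) by fastforce
    show "x = y"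
    proof (cases "x \<in> P")
      case True
      then have "\<rho> x = \<rho> y" "y \<in> P" using iff xy(3) by (auto simp: \<rho>'_def)
      then show ?thesis using inj_onD[OF assms(1)] True by blast
    next
      case False
      then have "h x = h y" "x \<in> Q" "y \<in> Q" using iff xy by (auto simp: \<rho>'_def)
      then show ?thesis using inj_onD[OF h] by blast
    qed
  qed
  moreover have "h x < Suc (Max (insert 0 (h ` Q)))" if "x \<in> Q" for x
    unfolding less_Suc_eq_le using that assms(2) by (intro Max_ge) simp_all
  then have "\<rho>' x < b'" if "x \<in> P \<union> Q" for x
    using that bspec[OF assms(3), of x] unfolding \<rho>'_def b'_def by (cases "x \<in> P") simp_all
  ultimately show ?thesis
    using assms(4) by (intro exI[of _ \<rho>'] exI[of _ b']) (auto simp: \<rho>'_def)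
qed

text \<open>Vertices are ordered one member of the family at a time, always preferring members that meet the set
  \<open>P\<close> of vertices that are already ordered. The set \<open>Y\<close> is the part of \<open>P\<close> that can still be
  met; any two of its points are linked through members that are already contained in \<open>P\<close>. So a
  member meeting \<open>P\<close> twice would close a cycle, which sparsity excludes.\<close>
lemma sparse_ordering:
  fixes D :: "nat set set"
  assumes V: "finite V" and D: "\<And>C. C \<in> D \<Longrightarrow> C \<subseteq> V" "\<And>C. C \<in> D \<Longrightarrow> 2 \<le> card C"
    and sparse: "\<And>T. T \<subseteq> V \<Longrightarrow> T \<noteq> {} \<Longrightarrow> card {C \<in> D. 2 \<le> card (C \<inter> T)} < card T"
  shows "\<exists>\<rho>. inj_on \<rho> V \<and> (\<forall>C\<in>D. \<forall>C'\<in>D. C \<noteq> C' \<longrightarrow> (C - {first \<rho> C}) \<inter> (C' - {first \<rho> C'}) = {})"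
proof -
  have finD: "finite D" by (rule finite_subset[of _ "Pow V"]) (use D V in auto)
  define link where "link E P u v \<longleftrightarrow> (\<exists>T\<subseteq>P. u \<in> T \<and> v \<in> T \<and> card T \<le> card {C \<in> E. 2 \<le> card (C \<inter> T)} + 1)"
    for E :: "nat set set" and P u v
  define ordered where "ordered \<rho> P \<longleftrightarrow> (\<forall>C\<in>D. \<forall>C'\<in>D. C \<subseteq> P \<and> C' \<subseteq> P \<and> C \<noteq> C' \<longrightarrow>
      (C - {first \<rho> C}) \<inter> (C' - {first \<rho> C'}) = {})" for \<rho> P
  have finC: "finite C" if "C \<in> D" for C using D(1)[OF that] V finite_subset by blast
  have not_linked: False if "E \<subseteq> D" "C \<in> D" "C \<notin> E" "P \<subseteq> V" and uv: "link E P u v" and "u \<noteq> v" "u \<in> C" "v \<in> C" for E C P u v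
  proof -
    obtain T where T: "T \<subseteq> P" "u \<in> T" "v \<in> T" "card T \<le> card {C \<in> E. 2 \<le> card (C \<inter> T)} + 1"
      using uv unfolding link_def by blast
    have "card {u, v} \<le> card (C \<inter> T)" using that T finC by (intro card_mono) auto
    then have "insert C {C \<in> E. 2 \<le> card (C \<inter> T)} \<subseteq> {C \<in> D. 2 \<le> card (C \<inter> T)}" using that by auto
    then have "card (insert C {C \<in> E. 2 \<le> card (C \<inter> T)}) \<le> card {C \<in> D. 2 \<le> card (C \<inter> T)}"
      using finD by (intro card_mono) auto
    moreover have "card (insert C {C \<in> E. 2 \<le> card (C \<inter> T)}) = card {C \<in> E. 2 \<le> card (C \<inter> T)} + 1"
      using that(1,3) finD finite_subset[of E D] by simp
    ultimately show False using sparse[of T] T that(4) by fastforce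
  qed
  have "\<exists>\<rho>'. inj_on \<rho>' V \<and> ordered \<rho>' V"
    if "P \<subseteq> V" "inj_on \<rho> P" "\<forall>x\<in>P. \<rho> x < (b::nat)" "ordered \<rho> P" "Y \<subseteq> P"
      "\<forall>C\<in>D. \<not> C \<subseteq> P \<longrightarrow> C \<inter> P \<subseteq> Y" "\<forall>u\<in>Y. \<forall>v\<in>Y. link {C \<in> D. C \<subseteq> P} P u v" for P \<rho> b Y
    using that
  proof (induction "card (V - P)" arbitrary: P \<rho> b Y rule: less_induct)
    case less
    note P = less.prems(1) and inj = less.prems(2) and b = less.prems(3) and ord = less.prems(4)
      and Y = less.prems(5) and meets = less.prems(6) and links = less.prems(7)
    let ?E = "{C \<in> D. C \<subseteq> P}"
    have finP: "finite P" by (rule finite_subset[OF P V])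
    show ?case
    proof (cases "P = V")
      case True then show ?thesis using inj ord by blast
    next
      case False
      show ?thesis
      proof (cases "\<exists>C\<in>D. \<not> C \<subseteq> P \<and> C \<inter> P \<noteq> {}")
        case True
        then obtain C0 p where C0: "C0 \<in> D" "\<not> C0 \<subseteq> P" "p \<in> C0" "p \<in> P" by blast
        have C0Y: "C0 \<inter> P \<subseteq> Y" using meets C0 by blast
        have single: "C0 \<inter> P = {p}"
        proof (rule ccontr)
          assume "C0 \<inter> P \<noteq> {p}"
          then obtain q where q: "q \<in> C0 \<inter> P" "q \<noteq> p" using C0 by blast
          have "link ?E P p q" using links C0Y C0 q by blast
          from not_linked[OF _ C0(1) _ P this] show False using q C0 by auto
        qed
        define Q where "Q = C0 - {p}"
        have Q: "finite Q" "P \<inter> Q = {}" "C0 = insert p Q" "p \<notin> Q"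
          using finC[OF C0(1)] single C0 unfolding Q_def by auto
        obtain \<rho>' b' where \<rho>': "inj_on \<rho>' (P \<union> Q)" "\<forall>x\<in>P. \<rho>' x = \<rho> x" "\<forall>x\<in>Q. b \<le> \<rho>' x" "\<forall>x\<in>P \<union> Q. \<rho>' x < b'"
          using extend_ranking[OF inj Q(1) b Q(2)] by (elim exE conjE) (rule that)
        let ?P = "P \<union> Q" and ?E' = "insert C0 ?E" and ?Y = "Y \<union> C0"
        have PV: "?P \<subseteq> V" using P D(1)[OF C0(1)] Q by blast
        have pY: "p \<in> Y" using C0Y C0 by blast
        have finE: "finite ?E" using finD by auto
        have link_old: "link ?E' ?P u v" if uv: "link ?E P u v" for u v
        proof -
          obtain T where T: "T \<subseteq> P" "u \<in> T" "v \<in> T" "card T \<le> card {C \<in> ?E. 2 \<le> card (C \<inter> T)} + 1"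
            using uv unfolding link_def by blast
          have "card {C \<in> ?E. 2 \<le> card (C \<inter> T)} \<le> card {C \<in> ?E'. 2 \<le> card (C \<inter> T)}"
            using finE by (intro card_mono) auto
          then show ?thesis unfolding link_def using T by (intro exI[of _ T]) auto
        qed
        have link_sym: "link E X u v \<Longrightarrow> link E X v u" for E X u v unfolding link_def by blast
        have link_new: "link ?E' ?P u v" if uv: "u \<in> Q" "v \<in> Y" for u v
        proof -
          obtain T where T: "T \<subseteq> P" "p \<in> T" "v \<in> T" "card T \<le> card {C \<in> ?E. 2 \<le> card (C \<inter> T)} + 1"
            using links pY uv unfolding link_def by blast
          have uT: "u \<notin> T" using T(1) uv Q by blast
          have finT: "finite T" using T(1) finP finite_subset by blast
          have "card (C \<inter> T) \<le> card (C \<inter> insert u T)" for C using finT by (intro card_mono) auto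
          then have "{C \<in> ?E. 2 \<le> card (C \<inter> T)} \<subseteq> {C \<in> ?E. 2 \<le> card (C \<inter> insert u T)}"
            using order_trans by blast
          then have c1: "card {C \<in> ?E. 2 \<le> card (C \<inter> T)} \<le> card {C \<in> ?E. 2 \<le> card (C \<inter> insert u T)}"
            using finD by (intro card_mono) auto
          have "card {u, p} \<le> card (C0 \<inter> insert u T)" using finT uv T Q by (intro card_mono) auto
          moreover have "u \<noteq> p" using uv Q by blast
          then have "card {u, p} = 2" by simp
          ultimately have "2 \<le> card (C0 \<inter> insert u T)" by linarith
          then have "{C \<in> ?E'. 2 \<le> card (C \<inter> insert u T)} = insert C0 {C \<in> ?E. 2 \<le> card (C \<inter> insert u T)}" by auto
          then have "card {C \<in> ?E'. 2 \<le> card (C \<inter> insert u T)} = card {C \<in> ?E. 2 \<le> card (C \<inter> insert u T)} + 1"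
            using C0(2) finD by simp
          then have "card (insert u T) \<le> card {C \<in> ?E'. 2 \<le> card (C \<inter> insert u T)} + 1"
            using c1 T(4) uT finT by simp
          then show ?thesis unfolding link_def using T uv by (intro exI[of _ "insert u T"]) auto
        qed
        have link_Q: "link ?E' ?P u v" if uv: "u \<in> Q" "v \<in> Q" for u v
        proof (cases "u = v")
          case True
          then show ?thesis unfolding link_def using uv by (intro exI[of _ "{u}"]) auto
        next
          case False
          have "card {u, v} \<le> card (C0 \<inter> {u, v})" using uv Q by (intro card_mono) auto
          then have "{C0} \<subseteq> {C \<in> ?E'. 2 \<le> card (C \<inter> {u, v})}" using False by auto
          then have "card {C0} \<le> card {C \<in> ?E'. 2 \<le> card (C \<inter> {u, v})}" using finD by (intro card_mono) auto
          then show ?thesis unfolding link_def using uv False by (intro exI[of _ "{u, v}"]) auto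
        qed
        have YQ: "?Y = Y \<union> Q" using Q pY by blast
        have links': "link ?E' ?P u v" if "u \<in> ?Y" "v \<in> ?Y" for u v
          using that links link_old link_new link_Q link_sym unfolding YQ by blast
        have E': "{C \<in> D. C \<subseteq> ?P} = ?E'"
        proof
          show "?E' \<subseteq> {C \<in> D. C \<subseteq> ?P}" using C0 Q by auto
          show "{C \<in> D. C \<subseteq> ?P} \<subseteq> ?E'"
          proof
            fix C assume C: "C \<in> {C \<in> D. C \<subseteq> ?P}"
            show "C \<in> ?E'"
            proof (rule ccontr)
              assume new: "C \<notin> ?E'"
              obtain u v where uv: "u \<in> C" "v \<in> C" "u \<noteq> v"
                using C D(2)[of C] finC[of C] by (metis (no_types, lifting) card_le_Suc0_iff_eq mem_Collect_eq not_less_eq_eq numeral_2_eq_2)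
              have "C \<inter> P \<subseteq> Y" using meets C new by blast
              then have "u \<in> ?Y" "v \<in> ?Y" using uv C Q(3) by blast+
              then have "link ?E' ?P u v" by (rule links')
              from not_linked[OF _ _ new PV this uv(3,1,2)] show False using C C0 by blast
            qed
          qed
        qed
        have first_same: "first \<rho>' C = first \<rho> C" if "C \<in> ?E" for C
        proof (rule first_eqI)
          have C: "C \<subseteq> P" "finite C" "C \<noteq> {}" using that finC D(2)[of C] by auto
          show "inj_on \<rho>' C" using \<rho>'(1) C(1) inj_on_subset by blast
          show "finite C" "first \<rho> C \<in> C" using C first_in by blast+
          show "\<rho>' (first \<rho> C) \<le> \<rho>' j" if "j \<in> C" for j
            using \<rho>'(2) C that first_in[OF C(2,3)] first_le[OF C(2) that] by (metis subsetD)
        qed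
        have first_C0: "first \<rho>' C0 = p"
        proof (rule first_eqI)
          show "inj_on \<rho>' C0" by (rule inj_on_subset[OF \<rho>'(1)]) (use Q C0 in auto)
          show "finite C0" "p \<in> C0" using C0 finC by auto
          show "\<rho>' p \<le> \<rho>' j" if "j \<in> C0" for j
            using that Q(3) \<rho>'(2,3) b C0(4) by (metis insertE le_trans less_imp_le order_refl)
        qed
        have ord': "ordered \<rho>' ?P"
          unfolding ordered_def
        proof (intro ballI impI)
          fix C C' assume a: "C \<in> D" "C' \<in> D" "C \<subseteq> ?P \<and> C' \<subseteq> ?P \<and> C \<noteq> C'"
          then have "C \<in> ?E'" "C' \<in> ?E'" using E' by blast+
          then consider "C \<in> ?E" "C' \<in> ?E" | "C = C0" "C' \<in> ?E" | "C \<in> ?E" "C' = C0" using a by blast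
          then show "(C - {first \<rho>' C}) \<inter> (C' - {first \<rho>' C'}) = {}"
          proof cases
            case 1
            then show ?thesis using ord a first_same unfolding ordered_def by auto
          next
            case 2
            then have "C - {first \<rho>' C} = Q" "C' \<subseteq> P" using first_C0 Q by auto
            then show ?thesis using Q(2) by blast
          next
            case 3
            then have "C' - {first \<rho>' C'} = Q" "C \<subseteq> P" using first_C0 Q by auto
            then show ?thesis using Q(2) by blast
          qed
        qed
        have "Q \<noteq> {}" using C0 Q by blast
        then have smaller: "card (V - ?P) < card (V - P)" using V Q PV by (intro psubset_card_mono) auto
        have m: "\<forall>C\<in>D. \<not> C \<subseteq> ?P \<longrightarrow> C \<inter> ?P \<subseteq> ?Y" using meets Q(3) by blast
        have YP: "?Y \<subseteq> ?P" using Y Q C0 by blast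
        have l: "\<forall>u\<in>?Y. \<forall>v\<in>?Y. link {C \<in> D. C \<subseteq> ?P} ?P u v" unfolding E' using links' by blast
        show ?thesis by (rule less.hyps[OF smaller PV \<rho>'(1,4) ord' YP m l])
      next
        case none: False
        obtain z where z: "z \<in> V" "z \<notin> P" using False P by blast
        obtain \<rho>' b' where \<rho>': "inj_on \<rho>' (P \<union> {z})" "\<forall>x\<in>P. \<rho>' x = \<rho> x" "\<forall>x\<in>P \<union> {z}. \<rho>' x < b'"
          using extend_ranking[OF inj _ b, of "{z}"] z by auto
        let ?P = "P \<union> {z}"
        have E': "C \<subseteq> P" if C: "C \<in> D" "C \<subseteq> ?P" for C
        proof (rule ccontr)
          assume "\<not> C \<subseteq> P"
          then have "C \<inter> P = {}" using none C by blast
          then have "C \<subseteq> {z}" using C by blast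
          then have "card C \<le> 1" using card_mono[of "{z}" C] by simp
          then show False using D(2)[OF C(1)] by simp
        qed
        have first_same: "first \<rho>' C = first \<rho> C" if "C \<in> D" "C \<subseteq> P" for C
        proof (rule first_eqI)
          have C: "finite C" "C \<noteq> {}" using that finC D(2)[of C] by auto
          show "inj_on \<rho>' C" using \<rho>'(1) that(2) inj_on_subset by blast
          show "finite C" "first \<rho> C \<in> C" using C first_in by blast+
          show "\<rho>' (first \<rho> C) \<le> \<rho>' j" if "j \<in> C" for j
            using \<rho>'(2) C that \<open>C \<subseteq> P\<close> first_in[OF C] first_le[OF C(1) that] by (metis subsetD)
        qed
        have ord': "ordered \<rho>' ?P" using ord E' first_same unfolding ordered_def by auto
        have PV: "?P \<subseteq> V" using P z by blast
        have smaller: "card (V - ?P) < card (V - P)" using V z by (intro psubset_card_mono) auto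
        have m: "\<forall>C\<in>D. \<not> C \<subseteq> ?P \<longrightarrow> C \<inter> ?P \<subseteq> {z}" using none by blast
        have l: "\<forall>u\<in>{z}. \<forall>v\<in>{z}. link {C \<in> D. C \<subseteq> ?P} ?P u v"
          unfolding link_def by (simp add: exI[of _ "{z}"])
        have YP: "{z} \<subseteq> ?P" by blast
        show ?thesis by (rule less.hyps[OF smaller PV \<rho>'(1,3) ord' YP m l])
      qed
    qed
  qed
  from this[of "{}" "\<lambda>_. 0" 0 "{}"] obtain \<rho> where "inj_on \<rho> V" "ordered \<rho> V"
    unfolding ordered_def using D(2) by fastforce
  then show ?thesis unfolding ordered_def using D(1) by blast
qed

section \<open>Relations carried by a forest of circuits\<close>

lemma lookup_combination:
  "lookup (\<Sum>C\<in>E. pscale (c C) (rel C)) x = (\<Sum>C\<in>E. c C * lookup (rel C) x)"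
  by (simp add: lookup_sum)

context relations
begin

definition minimal_bcs :: "(nat \<Rightarrow> nat) \<Rightarrow> nat set set" where
  "minimal_bcs \<rho> = {K - {first \<rho> K} | K. K \<in> circuits \<and> (\<forall>K'\<in>circuits. \<not> K' - {first \<rho> K'} \<subset> K - {first \<rho> K})}"

lemma broken_circuit_card:
  assumes "K \<in> circuits"
  shows "card (K - {first \<rho> K}) + 1 = card K" "2 \<le> card (K - {first \<rho> K})"
proof -
  have K: "finite K" "3 \<le> card K" using assms circuits_finite circuits_card by blast+
  then have "first \<rho> K \<in> K" by (intro first_in) auto
  then show "card (K - {first \<rho> K}) + 1 = card K" "2 \<le> card (K - {first \<rho> K})"
    using K by (simp_all add: card_Diff_singleton)
qed

lemma ex_minimal_bc:
  assumes "K \<in> circuits"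
  shows "\<exists>B\<in>minimal_bcs \<rho>. B \<subseteq> K - {first \<rho> K}"
  using assms
proof (induction "card (K - {first \<rho> K})" arbitrary: K rule: less_induct)
  case less
  show ?case
  proof (cases "\<exists>K'\<in>circuits. K' - {first \<rho> K'} \<subset> K - {first \<rho> K}")
    case True
    then obtain K' where K': "K' \<in> circuits" "K' - {first \<rho> K'} \<subset> K - {first \<rho> K}" by blast
    then have "card (K' - {first \<rho> K'}) < card (K - {first \<rho> K})"
      using circuits_finite[OF less.prems] by (intro psubset_card_mono) auto
    from less.hyps[OF this K'(1)] show ?thesis using K'(2) by blast
  next
    case False
    then have "K - {first \<rho> K} \<in> minimal_bcs \<rho>" unfolding minimal_bcs_def using less.prems by blast
    then show ?thesis by blast
  qed
qed

lemma minimal_bc_circuit: "B \<in> minimal_bcs \<rho> \<Longrightarrow> \<exists>K\<in>circuits. B = K - {first \<rho> K}"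
  unfolding minimal_bcs_def by blast

lemma minimal_bc_minimal: "B \<in> minimal_bcs \<rho> \<Longrightarrow> K \<in> circuits \<Longrightarrow> K - {first \<rho> K} \<subseteq> B \<Longrightarrow> K - {first \<rho> K} = B"
  unfolding minimal_bcs_def by blast

lemma finite_minimal_bcs: "finite (minimal_bcs \<rho>)"
  by (rule finite_subset[of _ "(\<lambda>K. K - {first \<rho> K}) ` circuits"]) (auto simp: minimal_bcs_def finite_circuits)

lemma minimal_bc_sub: "B \<in> minimal_bcs \<rho> \<Longrightarrow> B \<subseteq> {1..n}"
  using minimal_bc_circuit circuits_sub by blast

lemma minimal_bc_finite: "B \<in> minimal_bcs \<rho> \<Longrightarrow> finite B"
  by (rule finite_subset[OF minimal_bc_sub]) simp_all

lemma minimal_bc_card: "B \<in> minimal_bcs \<rho> \<Longrightarrow> 2 \<le> card B"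
  using minimal_bc_circuit[of B \<rho>] broken_circuit_card(2) by auto

lemma nbc_iff: "nbc \<rho> B \<longleftrightarrow> B \<subseteq> {1..n} \<and> (\<forall>A\<in>minimal_bcs \<rho>. \<not> A \<subseteq> B)"
  unfolding nbc_def using ex_minimal_bc minimal_bc_circuit by (metis order_trans)

lemma disjoint_minimal_bcsI:
  assumes "D \<subseteq> circuits"
    and disj: "\<And>C C'. C \<in> D \<Longrightarrow> C' \<in> D \<Longrightarrow> C \<noteq> C' \<Longrightarrow> (C - {first \<rho> C}) \<inter> (C' - {first \<rho> C'}) = {}"
    and cover: "\<And>K. K \<in> circuits \<Longrightarrow> \<exists>C\<in>D. C - {first \<rho> C} \<subseteq> K - {first \<rho> K}"
  shows "pairwise disjnt (minimal_bcs \<rho>)"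
proof -
  have "\<exists>C\<in>D. B = C - {first \<rho> C}" if B: "B \<in> minimal_bcs \<rho>" for B
  proof -
    obtain K where K: "K \<in> circuits" "B = K - {first \<rho> K}" using minimal_bc_circuit[OF B] by blast
    obtain C where C: "C \<in> D" "C - {first \<rho> C} \<subseteq> B" using cover[OF K(1)] K(2) by blast
    then have "C - {first \<rho> C} = B" using minimal_bc_minimal[OF B] assms(1) by blast
    then show ?thesis using C(1) by blast
  qed
  then show ?thesis unfolding pairwise_def disjnt_def using disj by metis
qed

text \<open>Suppose that two circuits have the same minimal broken circuit \<open>B\<close> but different minima \<open>i\<close>, \<open>j\<close>. Eliminating an
  element of \<open>B\<close> gives a circuit whose broken circuit contains a minimal one other than \<open>B\<close>. The latter is disjoint from
  \<open>B\<close>, hence equal to \<open>{i, j}\<close>, and the minimum of the new circuit precedes \<open>i\<close> and \<open>j\<close>, which is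
  impossible.\<close>
lemma circuits_of_minimal_bc_unique:
  assumes inj: "inj_on \<rho> {1..n}" and disj: "pairwise disjnt (minimal_bcs \<rho>)"
    and K: "K \<in> circuits" "K - {first \<rho> K} \<in> minimal_bcs \<rho>"
    and K': "K' \<in> circuits" "K' - {first \<rho> K'} = K - {first \<rho> K}"
  shows "K' = K"
proof (rule ccontr)
  assume "K' \<noteq> K"
  let ?i = "first \<rho> K" and ?j = "first \<rho> K'" and ?B = "K - {first \<rho> K}"
  have fin: "finite K" "finite K'" using K K' circuits_finite by blast+
  have i: "?i \<in> K" and j: "?j \<in> K'"
    using circuits_card[OF K(1)] circuits_card[OF K'(1)] fin by (intro first_in; auto)+
  have KK: "K = insert ?i ?B" "K' = insert ?j ?B"
    using insert_Diff[OF i] insert_Diff[OF j] unfolding K'(2) by simp_all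
  have ij: "?i \<noteq> ?j"
  proof
    assume "?i = ?j"
    then have "K' = K" using KK by simp
    then show False using \<open>K' \<noteq> K\<close> by contradiction
  qed
  have "?B \<noteq> {}" using minimal_bc_card[OF K(2)] by (metis card.empty not_numeral_le_zero)
  then obtain b where b: "b \<in> ?B" by blast
  obtain r where r: "r \<in> F" "keys r = K" using circuit_relation[OF K(1)] by blast
  obtain r' where r': "r' \<in> F" "keys r' = K'" using circuit_relation[OF K'(1)] by blast
  have jB: "?j \<notin> ?B" unfolding K'(2)[symmetric] by simp
  have "?i \<notin> insert ?j ?B" "?j \<notin> insert ?i ?B" using ij jB by simp_all
  then have nij: "?i \<notin> K'" "?j \<notin> K" using KK by argo+
  define s where "s = pscale (lookup r b) r' - pscale (lookup r' b) r"
  have s: "s \<in> F" unfolding s_def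
    using r r' by (intro pm.subspace_diff[OF subspace_F] pm.subspace_scale[OF subspace_F])
  have lr: "lookup r b \<noteq> 0" "lookup r ?j = 0" "lookup r' ?j \<noteq> 0"
  proof -
    have "b \<in> keys r" "?j \<notin> keys r" unfolding r(2) using b nij(2) by simp_all
    then show "lookup r b \<noteq> 0" "lookup r ?j = 0" by (simp_all add: in_keys_iff)
    have "?j \<in> keys r'" unfolding r'(2) by (rule j)
    then show "lookup r' ?j \<noteq> 0" by (simp add: in_keys_iff)
  qed
  have "lookup s ?j \<noteq> 0" using lr by (simp add: s_def lookup_minus)
  then have s0: "s \<noteq> 0" by auto
  have sb: "lookup s b = 0" by (simp add: s_def lookup_minus)
  have srr: "keys s \<subseteq> keys r \<union> keys r'" by (auto simp: s_def in_keys_iff lookup_minus)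
  have sk: "keys s \<subseteq> {?i, ?j} \<union> (?B - {b})"
  proof -
    have "b \<notin> keys s" using sb by (simp add: in_keys_iff)
    moreover have "keys r \<union> keys r' = {?i, ?j} \<union> ?B" unfolding r(2) r'(2) using KK by blast
    ultimately show "keys s \<subseteq> {?i, ?j} \<union> (?B - {b})" using srr by auto
  qed
  obtain L where L: "L \<in> circuits" "L \<subseteq> keys s" using ex_circuit_subset[OF s s0] by blast
  obtain A where A: "A \<in> minimal_bcs \<rho>" "A \<subseteq> L - {first \<rho> L}" using ex_minimal_bc[OF L(1)] by blast
  have "A \<noteq> ?B" using A L sk b ij nij by blast
  then have AB: "A \<inter> ?B = {}" using pairwiseD[OF disj A(1) K(2)] by (simp add: disjnt_def)
  have "A \<subseteq> {?i, ?j} \<union> (?B - {b})" using A(2) L(2) sk by blast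
  then have Aij: "A \<subseteq> {?i, ?j}" using AB by blast
  have "2 \<le> card A" by (rule minimal_bc_card[OF A(1)])
  then have "\<not> card A < card {?i, ?j}" using ij by simp
  then have "A = {?i, ?j}" using Aij by (meson card_subset_eq finite.emptyI finite.insertI card_mono le_antisym not_less)
  then have ijL: "?i \<in> L - {first \<rho> L}" "?j \<in> L - {first \<rho> L}" using A(2) by blast+
  have Ln: "L \<subseteq> {1..n}" "finite L" using L circuits_sub circuits_finite by blast+
  let ?m = "first \<rho> L"
  have m: "?m \<in> L" using ijL(1) Ln by (intro first_in) auto
  have "\<rho> ?m < \<rho> ?i" "\<rho> ?m < \<rho> ?j" using first_less[OF inj Ln] ijL by auto
  moreover have "?m \<in> {?i, ?j} \<union> (?B - {b})" using subsetD[OF sk] subsetD[OF L(2) m] .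
  then have "?m = ?i \<or> ?m = ?j \<or> ?m \<in> K" by blast
  then have "\<rho> ?i \<le> \<rho> ?m \<or> \<rho> ?j \<le> \<rho> ?m" using first_le[OF fin(1), of ?m \<rho>] by auto
  ultimately show False by linarith
qed

end

locale forest_relations = relations n F + broken_forest \<rho> "{1..n}" D
  for n and F :: "(nat \<Rightarrow>\<^sub>0 'k::field) set" and \<rho> D +
  fixes rel :: "nat set \<Rightarrow> (nat \<Rightarrow>\<^sub>0 'k)"
  assumes rel_F: "C \<in> D \<Longrightarrow> rel C \<in> F" and rel_keys: "C \<in> D \<Longrightarrow> keys (rel C) = C"
begin

abbreviation comb :: "(nat set \<Rightarrow> 'k) \<Rightarrow> nat set set \<Rightarrow> (nat \<Rightarrow>\<^sub>0 'k)" where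
  "comb c E \<equiv> \<Sum>C\<in>E. pscale (c C) (rel C)"

lemma finite_sub: "E \<subseteq> D \<Longrightarrow> finite E"
  using finite_D by (rule rev_finite_subset)

lemma comb_F: "E \<subseteq> D \<Longrightarrow> comb c E \<in> F"
  using rel_F by (intro pm.subspace_sum[OF subspace_F] pm.subspace_scale[OF subspace_F]) blast

lemma rel_lookup: "C \<in> D \<Longrightarrow> lookup (rel C) x = 0 \<longleftrightarrow> x \<notin> C"
  using rel_keys[of C] by (auto simp: in_keys_iff)

lemma comb_once:
  assumes "E \<subseteq> D" "C \<in> E" "\<And>C'. C' \<in> E \<Longrightarrow> x \<in> C' \<Longrightarrow> C' = C"
  shows "lookup (comb c E) x = c C * lookup (rel C) x"
proof -
  have "lookup (comb c E) x = (\<Sum>C'\<in>E. if C' = C then c C * lookup (rel C) x else 0)"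
    unfolding lookup_combination
  proof (rule sum.cong)
    fix C' assume C': "C' \<in> E"
    show "c C' * lookup (rel C') x = (if C' = C then c C * lookup (rel C) x else 0)"
    proof (cases "C' = C")
      case False
      then have "x \<notin> C'" using assms(3) C' by blast
      moreover have "C' \<in> D" using C' assms(1) by blast
      ultimately show ?thesis using rel_lookup False by auto
    qed simp
  qed simp
  then show ?thesis using assms finite_sub[OF assms(1)] by simp
qed

lemma comb_twice:
  assumes "E \<subseteq> D" "A \<in> E" "B \<in> E" "A \<noteq> B" "\<And>C. C \<in> E \<Longrightarrow> x \<in> C \<Longrightarrow> C = A \<or> C = B"
  shows "lookup (comb c E) x = c A * lookup (rel A) x + c B * lookup (rel B) x"
proof -
  have "comb c E = pscale (c A) (rel A) + comb c (E - {A})"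
    using assms(2) finite_sub[OF assms(1)] by (rule sum.remove[rotated])
  moreover have "lookup (comb c (E - {A})) x = c B * lookup (rel B) x"
    by (rule comb_once) (use assms in auto)
  ultimately show ?thesis by (simp add: lookup_add)
qed

lemma comb_keys_sub: "E \<subseteq> D \<Longrightarrow> keys (comb c E) \<subseteq> \<Union>E"
proof
  fix x assume E: "E \<subseteq> D" and x: "x \<in> keys (comb c E)"
  show "x \<in> \<Union>E"
  proof (rule ccontr)
    assume "x \<notin> \<Union>E"
    then have "lookup (rel C) x = 0" if "C \<in> E" for C
      using rel_lookup[of C x] that E by blast
    then have "lookup (comb c E) x = 0" unfolding lookup_combination by simp
    then show False using x by (simp add: in_keys_iff)
  qed
qed

lemma combined_sub_keys:
  assumes "E \<subseteq> D" "\<And>C. C \<in> E \<Longrightarrow> c C \<noteq> 0"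
  shows "combined_circuit E \<subseteq> keys (comb c E)"
proof
  fix x assume "x \<in> combined_circuit E"
  then obtain C where C: "C \<in> E" "x \<in> C" "\<And>C'. C' \<in> E \<Longrightarrow> x \<in> C' \<Longrightarrow> C' = C"
    unfolding combined_circuit_iff by blast
  have "lookup (comb c E) x = c C * lookup (rel C) x" by (rule comb_once[OF assms(1) C(1,3)])
  moreover have "lookup (rel C) x \<noteq> 0" using rel_lookup[of C x] C assms(1) by blast
  ultimately show "x \<in> keys (comb c E)" using assms(2)[OF C(1)] by (simp add: in_keys_iff)
qed

lemma comb_broken:
  assumes "E \<subseteq> D" "E \<noteq> {}" "\<And>C. C \<in> E \<Longrightarrow> c C \<noteq> 0"
  shows "\<exists>C\<in>E. bc C \<subseteq> keys (comb c E) - {first \<rho> (keys (comb c E))}"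
  by (rule broken_circuit_of_once_covered[OF assms(1,2) combined_sub_keys comb_keys_sub]) (use assms in auto)

lemma comb_nonzero:
  assumes "E \<subseteq> D" "E \<noteq> {}" "\<And>C. C \<in> E \<Longrightarrow> c C \<noteq> 0"
  shows "comb c E \<noteq> 0"
proof
  assume z: "comb c E = 0"
  have "\<exists>C\<in>E. bc C \<subseteq> keys (comb c E) - {first \<rho> (keys (comb c E))}"
    by (rule comb_broken[OF assms])
  then obtain C where C: "C \<in> E" "bc C \<subseteq> {}" unfolding z by auto
  then have "2 \<le> card (bc C)" using card_bc assms(1) by blast
  then show False using C(2) by (metis card.empty not_numeral_le_zero subset_empty)
qed

lemma comb_support: "E \<subseteq> D \<Longrightarrow> comb c E = comb c {C \<in> E. c C \<noteq> 0}"
  by (rule sum.mono_neutral_right) (auto dest: finite_sub)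

lemma rel_inj: "inj_on rel D"
  by (rule inj_onI) (metis rel_keys)

text \<open>A combination with nonzero coefficients contains the broken circuit of a leaf in its support.\<close>
lemma independent_rel: "pm.independent (rel ` D)"
proof (rule pm.independent_if_scalars_zero)
  show "finite (rel ` D)" using finite_D by simp
  fix f x assume s: "(\<Sum>x\<in>rel ` D. pscale (f x) x) = 0" and x: "x \<in> rel ` D"
  define c where "c C = f (rel C)" for C
  have "comb c D = 0" using s by (simp add: sum.reindex[OF rel_inj] c_def)
  then have z: "comb c {C \<in> D. c C \<noteq> 0} = 0" using comb_support[OF order_refl, of c] by argo
  have "{C \<in> D. c C \<noteq> 0} = {}"
  proof (rule ccontr)
    assume "{C \<in> D. c C \<noteq> 0} \<noteq> {}"
    then have "comb c {C \<in> D. c C \<noteq> 0} \<noteq> 0" by (intro comb_nonzero) auto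
    then show False using z by contradiction
  qed
  then show "f x = 0" using x unfolding c_def by auto
qed

text \<open>A relation is determined by its coefficients outside of \<open>B\<close>, so \<open>F\<close> has dimension at most \<open>n - card B\<close>.\<close>
lemma spans_by_dimension:
  assumes B: "B \<subseteq> {1..n}" "\<And>r. r \<in> F \<Longrightarrow> keys r \<subseteq> B \<Longrightarrow> r = 0" and card: "n \<le> card B + card D"
    and r: "r \<in> F"
  shows "\<exists>c. r = comb c D"
proof -
  let ?X = "rel ` D" and ?A = "{1..n} - B"
  have "r \<in> pm.span ?X"
  proof (rule ccontr)
    assume n: "r \<notin> pm.span ?X"
    then have ind: "pm.independent (insert r ?X)" using independent_rel by (rule pm.independent_insertI)
    have "insert r ?X \<subseteq> F" using r rel_F by blast
    then have sF: "pm.span (insert r ?X) \<subseteq> F" using subspace_F by (rule pm.span_minimal)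
    have fA: "finite ?A" by simp
    interpret P: Vector_Spaces.linear pscale pscale "proj ?A :: (nat \<Rightarrow>\<^sub>0 'k) \<Rightarrow> _" by (rule linear_proj[OF fA])
    have inj: "inj_on (proj ?A) (pm.span (insert r ?X))"
    proof (rule inj_onI)
      fix x y assume xy: "x \<in> pm.span (insert r ?X)" "y \<in> pm.span (insert r ?X)" "proj ?A x = proj ?A y"
      have d: "x - y \<in> F" using xy(1,2) sF pm.span_diff by blast
      have "proj ?A (x - y) = 0" using xy(3) P.diff[of x y] by simp
      then have "lookup (x - y) i = 0" if "i \<in> ?A" for i
        using lookup_proj[OF fA, of "x - y" i] that by simp
      then have "i \<notin> keys (x - y)" if "i \<in> ?A" for i using that by (simp add: in_keys_iff)
      then have "keys (x - y) \<subseteq> B" using keys_F[OF d] by blast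
      then have "x - y = 0" using B(2)[OF d] by blast
      then show "x = y" by simp
    qed
    have "pm.independent (proj ?A ` insert r ?X)"
      by (rule P.independent_injective_image[OF ind inj])
    moreover have "proj ?A ` insert r ?X \<subseteq> pm.span ((\<lambda>m. single m 1) ` ?A)"
      using proj_in_span by (rule image_subsetI)
    ultimately have "card (proj ?A ` insert r ?X) \<le> card ((\<lambda>m. single m (1::'k)) ` ?A)"
      by (rule conjunct2[OF pm.independent_span_bound[OF finite_imageI[OF fA]]])
    also have "\<dots> \<le> card ?A" by (rule card_image_le[OF fA])
    also have "\<dots> = n - card B" using B(1) by (simp add: card_Diff_subset finite_subset)
    finally have "card (proj ?A ` insert r ?X) \<le> n - card B" .
    moreover have "card (proj ?A ` insert r ?X) = card (insert r ?X)"
      by (rule card_image[OF inj_on_subset[OF inj pm.span_superset]])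
    moreover have "card (insert r ?X) = card D + 1"
      using n pm.span_superset[of ?X] finite_D by (subst card_insert_disjoint) (auto simp: card_image[OF rel_inj])
    ultimately show False using card by linarith
  qed
  then obtain u where "r = (\<Sum>v\<in>?X. pscale (u v) v)"
    using pm.span_finite[OF finite_imageI[OF finite_D]] by blast
  then have "r = comb (u \<circ> rel) D" by (simp add: sum.reindex[OF rel_inj])
  then show ?thesis by blast
qed

end

locale spanning_forest = forest_relations n F \<rho> D rel
  for n and F :: "(nat \<Rightarrow>\<^sub>0 'k::field) set" and \<rho> D rel +
  assumes spans: "r \<in> F \<Longrightarrow> \<exists>c. r = (\<Sum>C\<in>D. pscale (c C) (rel C))"
begin

lemma spans_nonzero:
  assumes "r \<in> F" "r \<noteq> 0"
  shows "\<exists>E c. E \<subseteq> D \<and> E \<noteq> {} \<and> (\<forall>C\<in>E. c C \<noteq> 0) \<and> r = comb c E"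
proof -
  obtain c where c: "r = comb c D" using spans[OF assms(1)] by blast
  let ?E = "{C \<in> D. c C \<noteq> 0}"
  have "r = comb c ?E" using c comb_support[of D c] by simp
  moreover from this have "?E \<noteq> {}" using assms(2) by (metis sum.empty)
  ultimately show ?thesis by (intro exI[of _ ?E] exI[of _ c]) auto
qed

lemma broken_circuit_cover:
  assumes "K \<in> circuits"
  shows "\<exists>C\<in>D. bc C \<subseteq> K - {first \<rho> K}"
proof -
  obtain r where r: "r \<in> F" "r \<noteq> 0" "keys r = K" using circuit_relation[OF assms] by blast
  obtain E c where E: "E \<subseteq> D" "E \<noteq> {}" "\<forall>C\<in>E. c C \<noteq> 0" "r = comb c E" using spans_nonzero[OF r(1,2)] by blast
  have "\<exists>C\<in>E. bc C \<subseteq> keys r - {first \<rho> (keys r)}" unfolding E(4) by (rule comb_broken) (use E in auto)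
  then show ?thesis using E(1) r(3) by blast
qed

text \<open>A circuit inside a member \<open>C\<close> contains the broken circuit of some member, which then shares two points with \<open>C\<close>
  and so equals \<open>C\<close>.\<close>
lemma members_are_circuits: "D \<subseteq> circuits"
proof
  fix C assume C: "C \<in> D"
  have "rel C \<noteq> 0" using rel_keys[OF C] card3[OF C] by auto
  then obtain K where K: "K \<in> circuits" "K \<subseteq> C" using ex_circuit_subset[OF rel_F[OF C]] rel_keys[OF C] by blast
  obtain C' where C': "C' \<in> D" "bc C' \<subseteq> K - {first \<rho> K}" using broken_circuit_cover[OF K(1)] by blast
  have "C' = C"
  proof (rule ccontr)
    assume ne: "C' \<noteq> C"
    obtain x y where xy: "x \<in> bc C'" "y \<in> bc C'" "x \<noteq> y" using two_in_bc[OF C'(1)] by blast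
    then have "x \<in> C" "y \<in> C" using C' K by blast+
    then have "x = first \<rho> C" "y = first \<rho> C" using meet[OF C'(1) C ne] xy by blast+
    then show False using xy(3) by simp
  qed
  then have "card (bc C) \<le> card (K - {first \<rho> K})"
    using C'(2) circuits_finite[OF K(1)] by (intro card_mono) auto
  then have "card C \<le> card K"
    using broken_circuit_card(1)[OF K(1), of \<rho>] first_member[OF C] finite_member[OF C] by (simp add: card_Diff_singleton)
  then have "K = C" using K(2) finite_member[OF C] by (metis card_mono card_subset_eq le_antisym)
  then show "C \<in> circuits" using K(1) by simp
qed

lemma disjoint_minimal_bcs: "pairwise disjnt (minimal_bcs \<rho>)"
  by (rule disjoint_minimal_bcsI[OF members_are_circuits disj broken_circuit_cover])

text \<open>Along a tree the coefficients can be chosen one member after the other so that every common point cancels: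
  a new member meets the previous ones in a single point.\<close>
lemma tree_coefficients:
  assumes E: "E \<subseteq> D" "connected_family E" "E \<noteq> {}"
    and twice: "\<And>x A B C. A \<in> E \<Longrightarrow> B \<in> E \<Longrightarrow> C \<in> E \<Longrightarrow> x \<in> A \<Longrightarrow> x \<in> B \<Longrightarrow> x \<in> C \<Longrightarrow> A = B \<or> A = C \<or> B = C"
  shows "\<exists>c. (\<forall>C\<in>E. c C \<noteq> 0) \<and> (\<forall>A\<in>E. \<forall>B\<in>E. \<forall>x. A \<noteq> B \<and> x \<in> A \<and> x \<in> B \<longrightarrow>
    c A * lookup (rel A) x + c B * lookup (rel B) x = 0)"
proof -
  define good where "good c E' \<longleftrightarrow> (\<forall>C\<in>E'. c C \<noteq> 0) \<and> (\<forall>A\<in>E'. \<forall>B\<in>E'. \<forall>x. A \<noteq> B \<and> x \<in> A \<and> x \<in> B \<longrightarrow>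
    c A * lookup (rel A) x + c B * lookup (rel B) x = 0)" for c E'
  have "\<exists>c. good c E" if "E' \<subseteq> E" "E' \<noteq> {}" "connected_family E'" "good c E'" for E' c
    using that
  proof (induction "card (E - E')" arbitrary: E' c rule: less_induct)
    case less
    note E' = less.prems
    show ?case
    proof (cases "E' = E")
      case True then show ?thesis using E' by blast
    next
      case False
      obtain C A where CA: "C \<in> E" "C \<notin> E'" "A \<in> E'" "C \<inter> A \<noteq> {}"
        using connected_family_exit[OF E(2) E'(1,2) False] by blast
      obtain x where x: "x \<in> C" "x \<in> A" using CA(4) by blast
      have CD: "C \<in> D" "A \<in> D" "E' \<subseteq> D" using CA E E' by blast+
      have AC: "A \<noteq> C" using CA by blast
      define c' where "c' = c(C := - (c A * lookup (rel A) x) / lookup (rel C) x)"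
      have nz: "lookup (rel A) x \<noteq> 0" "lookup (rel C) x \<noteq> 0" "c A \<noteq> 0"
        using rel_lookup CD x E'(4) CA(3) unfolding good_def by blast+
      have new: "c' B * lookup (rel B) y + c' C * lookup (rel C) y = 0"
        if B: "B \<in> E'" "y \<in> B" "y \<in> C" for B y
      proof -
        have "y = x" by (rule connected_meets_once[OF CD(3) E'(3) CD(1) CA(2)]) (use B x CA in auto)
        then have "B = A" using twice[of A B C x] AC B x CA E'(1) by blast
        then show ?thesis using nz AC \<open>y = x\<close> by (simp add: c'_def)
      qed
      have old: "c' B = c B" if "B \<in> E'" for B using that CA(2) unfolding c'_def by auto
      have "good c' (insert C E')"
        unfolding good_def
      proof (intro conjI ballI allI impI)
        fix B assume "B \<in> insert C E'"
        then show "c' B \<noteq> 0" using E'(4) old nz unfolding good_def c'_def by auto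
      next
        fix B1 B2 y assume b: "B1 \<in> insert C E'" "B2 \<in> insert C E'" "B1 \<noteq> B2 \<and> y \<in> B1 \<and> y \<in> B2"
        then consider "B1 \<in> E'" "B2 \<in> E'" | "B1 = C" "B2 \<in> E'" | "B1 \<in> E'" "B2 = C" by blast
        then show "c' B1 * lookup (rel B1) y + c' B2 * lookup (rel B2) y = 0"
        proof cases
          case 1 then show ?thesis using E'(4) b old unfolding good_def by simp
        next
          case 2 then show ?thesis using new[of B2 y] b by (simp add: add.commute)
        next
          case 3 then show ?thesis using new[of B1 y] b by simp
        qed
      qed
      moreover have "connected_family (insert C E')" by (rule connected_family_insert[OF E'(3) CA(3,4)])
      moreover have "card (E - insert C E') < card (E - E')"
        using finite_sub[OF E(1)] CA by (intro psubset_card_mono) auto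
      moreover have "insert C E' \<subseteq> E" using CA E'(1) by blast
      ultimately show ?thesis using less.hyps by blast
    qed
  qed
  moreover obtain C where C: "C \<in> E" using E(3) by blast
  moreover have "good (\<lambda>_. 1) {C}" unfolding good_def by auto
  moreover have "connected_family {C}" unfolding connected_family_def by simp
  ultimately have "\<exists>c. good c E" by blast
  then show ?thesis unfolding good_def by blast
qed

text \<open>A relation supported on the points covered exactly once by a tree involves only members of the tree, and the
  cancellations force its coefficients to be proportional to the chosen ones.\<close>
lemma tree_combined_circuit:
  assumes E: "E \<subseteq> D" "connected_family E" "E \<noteq> {}"
    and twice: "\<And>x A B C. A \<in> E \<Longrightarrow> B \<in> E \<Longrightarrow> C \<in> E \<Longrightarrow> x \<in> A \<Longrightarrow> x \<in> B \<Longrightarrow> x \<in> C \<Longrightarrow> A = B \<or> A = C \<or> B = C"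
  shows "combined_circuit E \<in> circuits"
proof -
  have "\<exists>c. (\<forall>C\<in>E. c C \<noteq> 0) \<and> (\<forall>A\<in>E. \<forall>B\<in>E. \<forall>x. A \<noteq> B \<and> x \<in> A \<and> x \<in> B \<longrightarrow>
      c A * lookup (rel A) x + c B * lookup (rel B) x = 0)"
    by (rule tree_coefficients[OF E]) (rule twice)
  then obtain c where c0: "\<forall>C\<in>E. c C \<noteq> 0" "\<forall>A\<in>E. \<forall>B\<in>E. \<forall>x. A \<noteq> B \<and> x \<in> A \<and> x \<in> B \<longrightarrow>
      c A * lookup (rel A) x + c B * lookup (rel B) x = 0"
    by (elim exE conjE) (rule that)
  have c: "\<And>C. C \<in> E \<Longrightarrow> c C \<noteq> 0"
    "\<And>A B x. A \<in> E \<Longrightarrow> B \<in> E \<Longrightarrow> A \<noteq> B \<Longrightarrow> x \<in> A \<Longrightarrow> x \<in> B \<Longrightarrow> c A * lookup (rel A) x + c B * lookup (rel B) x = 0"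
    using c0 by simp_all
  have two: "lookup (comb d E) x = d A * lookup (rel A) x + d B * lookup (rel B) x"
    if "A \<in> E" "B \<in> E" "A \<noteq> B" "x \<in> A" "x \<in> B" for d A B x
    by (rule comb_twice[OF E(1) that(1-3)]) (use twice that in blast)
  have k: "keys (comb c E) = combined_circuit E"
  proof
    show "combined_circuit E \<subseteq> keys (comb c E)" by (rule combined_sub_keys[OF E(1) c(1)])
    show "keys (comb c E) \<subseteq> combined_circuit E"
    proof
      fix x assume x: "x \<in> keys (comb c E)"
      then obtain A where A: "A \<in> E" "x \<in> A" using comb_keys_sub[OF E(1)] by blast
      have "B = A" if "B \<in> E" "x \<in> B" for B
      proof (rule ccontr)
        assume "B \<noteq> A"
        then have "lookup (comb c E) x = 0" using two[of B A x c] c(2)[of B A x] A that by simp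
        then show False using x by (simp add: in_keys_iff)
      qed
      then show "x \<in> combined_circuit E" unfolding combined_circuit_iff using A by blast
    qed
  qed
  have "keys (comb c E) \<in> circuits"
  proof (rule circuitI[OF comb_F[OF E(1)] comb_nonzero[OF E(1,3) c(1)]])
    fix s assume s: "s \<in> F" "s \<noteq> 0" "keys s \<subseteq> keys (comb c E)"
    obtain d where d: "s = comb d D" using spans[OF s(1)] by blast
    let ?G = "{C \<in> D - E. d C \<noteq> 0}"
    have split: "comb d D = comb d E + comb d (D - E)"
      using sum.subset_diff[OF E(1) finite_D] by (simp add: add.commute)
    have eqG: "comb d (D - E) = comb d ?G" by (rule comb_support) blast
    have emptyG: "?G = {}"
    proof (rule ccontr)
      assume G: "?G \<noteq> {}"
      have eq: "comb d ?G = s - comb d E" using split d eqG by simp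
      have "keys (comb d ?G) \<subseteq> keys s \<union> keys (comb d E)" unfolding eq by (auto simp: in_keys_iff lookup_minus)
      moreover have "keys s \<subseteq> \<Union>E" using s(3) comb_keys_sub[OF E(1)] by blast
      ultimately have sub: "keys (comb d ?G) \<subseteq> \<Union>E" using comb_keys_sub[OF E(1)] by blast
      obtain C where C: "C \<in> ?G" "bc C \<subseteq> keys (comb d ?G)"
        using comb_broken[of ?G d] G by blast
      obtain x y where xy: "x \<in> bc C" "y \<in> bc C" "x \<noteq> y" using two_in_bc C(1) by blast
      have "x = y" by (rule connected_meets_once[OF E(1,2), of C]) (use C sub xy in auto)
      then show False using xy(3) by simp
    qed
    have "comb d (D - E) = 0" unfolding eqG emptyG by simp
    then have sE: "s = comb d E" using split d by simp
    have edge: "d A / c A = d B / c B" if AB: "(A, B) \<in> intersection_graph E" for A B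
    proof -
      obtain x where x: "A \<in> E" "B \<in> E" "A \<noteq> B" "x \<in> A" "x \<in> B" using AB unfolding intersection_graph_def by blast
      have "x \<notin> combined_circuit E"
      proof
        assume "x \<in> combined_circuit E"
        then obtain C where C: "\<forall>C'\<in>E. x \<in> C' \<longrightarrow> C' = C" unfolding combined_circuit_iff by blast
        have "A = C" using C x(1,4) by blast
        moreover have "B = C" using C x(2,5) by blast
        ultimately show False using x(3) by blast
      qed
      then have "x \<notin> keys s" using s(3) unfolding k by blast
      then have 1: "d A * lookup (rel A) x + d B * lookup (rel B) x = 0"
        using two[OF x, of d] sE by (simp add: in_keys_iff)
      have 2: "c A * lookup (rel A) x + c B * lookup (rel B) x = 0" by (rule c(2)[OF x])
      have nz: "lookup (rel A) x \<noteq> 0" "lookup (rel B) x \<noteq> 0" "c A \<noteq> 0" "c B \<noteq> 0"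
        using rel_lookup x E(1) c(1) by blast+
      have a: "lookup (rel A) x = - (c B * lookup (rel B) x) / c A" using 2 nz by (simp add: field_simps eq_neg_iff_add_eq_0)
      have "d A * (- (c B * lookup (rel B) x) / c A) + d B * lookup (rel B) x = 0" using 1 a by simp
      then have "(d B - d A * c B / c A) * lookup (rel B) x = 0" by (simp add: field_simps)
      then have "d B = d A * c B / c A" using nz by simp
      then show ?thesis using nz by (simp add: field_simps)
    qed
    obtain C0 where C0: "C0 \<in> E" using E(3) by blast
    let ?l = "d C0 / c C0"
    have ratio: "d C = ?l * c C" if "C \<in> E" for C
    proof -
      have "(C0, C) \<in> (intersection_graph E)\<^sup>*" using E(2) C0 that unfolding connected_family_def by blast
      then have "d C / c C = ?l" by (induction rule: rtrancl_induct) (auto dest: edge)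
      then show ?thesis using c(1)[OF that] by (simp add: field_simps)
    qed
    have "s = (\<Sum>C\<in>E. pscale (?l * c C) (rel C))" unfolding sE by (rule sum.cong) (simp_all add: ratio)
    also have "\<dots> = pscale ?l (comb c E)" by (simp add: pm.scale_sum_right)
    finally have sl: "s = pscale ?l (comb c E)" .
    then have "?l \<noteq> 0" using s(2) by (metis pm.scale_zero_left)
    then show "keys s = keys (comb c E)" unfolding sl by simp
  qed
  then show ?thesis using k by simp
qed

text \<open>Conversely, a relation is a combination of forest relations. Starting from any member used, members
  are added as long as some point outside of the support is covered just once; in the relation itself it is
  cancelled by a further member. The result is a tree whose combined circuit is contained in
  the support.\<close>
lemma circuit_is_combined:
  assumes K: "K \<in> circuits"
  shows "\<exists>E\<subseteq>D. tree_family E \<and> K = combined_circuit E"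
proof -
  obtain r where r: "r \<in> F" "r \<noteq> 0" "keys r = K" using circuit_relation[OF K] by blast
  obtain E c where E: "E \<subseteq> D" "E \<noteq> {}" "\<forall>C\<in>E. c C \<noteq> 0" "r = comb c E" using spans_nonzero[OF r(1,2)] by blast
  define good where "good E' \<longleftrightarrow> (\<forall>x A B. A \<in> E' \<and> B \<in> E' \<and> x \<in> A \<and> x \<in> B \<and> x \<in> K \<longrightarrow> A = B) \<and>
    (\<forall>x A B C. A \<in> E' \<and> B \<in> E' \<and> C \<in> E' \<and> x \<in> A \<and> x \<in> B \<and> x \<in> C \<longrightarrow> A = B \<or> A = C \<or> B = C)" for E' :: "nat set set"
  have good_twice: "A = B \<or> A = C \<or> B = C"
    if "good E'" "A \<in> E'" "B \<in> E'" "C \<in> E'" "x \<in> A" "x \<in> B" "x \<in> C" for E' x A B C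
    using conjunct2[OF that(1)[unfolded good_def]] that(2-) by meson
  have "\<exists>E''\<subseteq>E. E'' \<noteq> {} \<and> connected_family E'' \<and> good E'' \<and> combined_circuit E'' \<subseteq> K"
    if "E' \<subseteq> E" "E' \<noteq> {}" "connected_family E'" "good E'" for E'
    using that
  proof (induction "card (E - E')" arbitrary: E' rule: less_induct)
    case less
    note E' = less.prems
    show ?case
    proof (cases "combined_circuit E' \<subseteq> K")
      case True then show ?thesis using E' by blast
    next
      case False
      then obtain x A where x: "x \<notin> K" "A \<in> E'" "x \<in> A" "\<And>B. B \<in> E' \<Longrightarrow> x \<in> B \<Longrightarrow> B = A"
        unfolding subset_iff combined_circuit_iff by blast
      have AE: "A \<in> E" "A \<in> D" using x E' E by blast+
      have "\<exists>C\<in>E. x \<in> C \<and> C \<noteq> A"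
      proof (rule ccontr)
        assume "\<not> ?thesis"
        then have "lookup (comb c E) x = c A * lookup (rel A) x" by (intro comb_once[OF E(1) AE(1)]) blast
        moreover have "lookup (comb c E) x = 0"
          using x(1) unfolding r(3)[symmetric] E(4) by (simp only: in_keys_iff not_not)
        ultimately show False using E(3) AE rel_lookup[OF AE(2), of x] x(3) by simp
      qed
      then obtain C where C: "C \<in> E" "x \<in> C" "C \<noteq> A" by blast
      have CE': "C \<notin> E'" using x(4) C by blast
      have E'D: "E' \<subseteq> D" by (rule subset_trans[OF E'(1) E(1)])
      have CD: "C \<in> D" by (rule subsetD[OF E(1) C(1)])
      have meet_x: "y = x" if "y \<in> C" "B \<in> E'" "y \<in> B" for y B
        by (rule connected_meets_once[OF E'D E'(3) CD CE' that(1) UnionI[OF that(2,3)] C(2) UnionI[OF x(2,3)]])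
      let ?E = "insert C E'"
      have "good ?E"
        unfolding good_def
      proof (intro conjI allI impI)
        fix y B1 B2 assume a: "B1 \<in> ?E \<and> B2 \<in> ?E \<and> y \<in> B1 \<and> y \<in> B2 \<and> y \<in> K"
        show "B1 = B2"
        proof (cases "B1 \<in> E' \<and> B2 \<in> E'")
          case True then show ?thesis using E'(4) a unfolding good_def by blast
        next
          case False
          show ?thesis
          proof (rule ccontr)
            assume "B1 \<noteq> B2"
            then have "y = x" using False a meet_x by blast
            then show False using a x(1) by blast
          qed
        qed
      next
        fix y B1 B2 B3 assume a: "B1 \<in> ?E \<and> B2 \<in> ?E \<and> B3 \<in> ?E \<and> y \<in> B1 \<and> y \<in> B2 \<and> y \<in> B3"
        show "B1 = B2 \<or> B1 = B3 \<or> B2 = B3"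
        proof (cases "B1 \<in> E' \<and> B2 \<in> E' \<and> B3 \<in> E'")
          case True
          then show ?thesis using a by (intro good_twice[OF E'(4), of B1 B2 B3 y]) simp_all
        next
          case False
          show ?thesis
          proof (rule ccontr)
            assume ne: "\<not> ?thesis"
            have "B1 = C \<or> B2 = C \<or> B3 = C" using False a by blast
            then have yC: "y \<in> C" using a by blast
            have "B1 \<noteq> C \<or> B2 \<noteq> C" using ne by blast
            then obtain B where "B \<in> E'" "y \<in> B" using a by blast
            then have yx: "y = x" by (rule meet_x[OF yC])
            have "B = C \<or> B = A" if "B \<in> ?E" "y \<in> B" for B
              using that x(4) unfolding yx by blast
            then have "B1 = C \<or> B1 = A" "B2 = C \<or> B2 = A" "B3 = C \<or> B3 = A" using a by blast+
            then show False using ne by metis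
          qed
        qed
      qed
      moreover have "connected_family ?E" by (rule connected_family_insert[OF E'(3) x(2)]) (use C x in blast)
      moreover have "card (E - ?E) < card (E - E')"
        using finite_sub[OF E(1)] C CE' by (intro psubset_card_mono) auto
      moreover have "?E \<subseteq> E" using C E'(1) by blast
      ultimately show ?thesis using less.hyps by blast
    qed
  qed
  moreover obtain C where C: "C \<in> E" using E(2) by blast
  moreover have "good {C}" unfolding good_def by blast
  moreover have "connected_family {C}" unfolding connected_family_def by simp
  ultimately obtain E' where E': "E' \<subseteq> E" "E' \<noteq> {}" "connected_family E'" "good E'" "combined_circuit E' \<subseteq> K"
    by blast
  have E'D: "E' \<subseteq> D" using E' E by blast
  have twice: "A = B \<or> A = C \<or> B = C" if "A \<in> E'" "B \<in> E'" "C \<in> E'" "x \<in> A" "x \<in> B" "x \<in> C" for x A B C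
    by (rule good_twice[OF E'(4) that])
  have "combined_circuit E' \<in> circuits" by (rule tree_combined_circuit[OF E'D E'(3,2) twice])
  then obtain s where "s \<in> F" "s \<noteq> 0" "keys s = combined_circuit E'" using circuit_relation by blast
  then have eqK: "combined_circuit E' = K" using circuit_minimal[OF K] E'(5) by metis
  have no_cycle: "\<not> graph_cycle E' (intersection_graph E') p" for p
    by (rule no_cycle_if_covered_twice[OF E'D]) (rule twice)
  have "tree_family E'"
    unfolding tree_family_def graph_tree_def
    using E'(2,3) no_cycle unfolding connected_family_def by blast
  then show ?thesis using E'D eqK by blast
qed

lemma circuits_eq_combined: "circuits = {combined_circuit E | E. E \<subseteq> D \<and> tree_family E}"
proof
  show "circuits \<subseteq> {combined_circuit E | E. E \<subseteq> D \<and> tree_family E}" using circuit_is_combined by blast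
  show "{combined_circuit E | E. E \<subseteq> D \<and> tree_family E} \<subseteq> circuits"
  proof clarify
    fix E assume E: "E \<subseteq> D" "tree_family E"
    show "combined_circuit E \<in> circuits"
      by (rule tree_combined_circuit[OF E(1) tree_family_connected[OF E(2)] tree_covered_twice[OF E(2)]])
  qed
qed

end

context relations
begin

abbreviation minimal_circuits :: "(nat \<Rightarrow> nat) \<Rightarrow> nat set set" where
  "minimal_circuits \<rho> \<equiv> {K \<in> circuits. K - {first \<rho> K} \<in> minimal_bcs \<rho>}"

lemma weight_less:
  assumes inj: "inj_on \<rho> A" and A: "finite A" "\<And>x. x \<in> A \<Longrightarrow> \<rho> x < k"
  shows "(\<Sum>x\<in>A. 2 ^ \<rho> x) < (2 ^ k :: nat)"
proof -
  have "(\<Sum>x\<in>A. 2 ^ \<rho> x) = (\<Sum>i\<in>\<rho> ` A. 2 ^ i :: nat)" by (simp add: sum.reindex[OF inj])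
  also have "\<dots> \<le> (\<Sum>i\<in>{..<k}. 2 ^ i)" using A by (intro sum_mono2) auto
  also have "\<dots> < 2 ^ k" by (induction k) auto
  finally show ?thesis .
qed

lemma minimal_circuits_disjoint:
  assumes "inj_on \<rho> {1..n}" "pairwise disjnt (minimal_bcs \<rho>)"
    "C \<in> minimal_circuits \<rho>" "C' \<in> minimal_circuits \<rho>" "C \<noteq> C'"
  shows "(C - {first \<rho> C}) \<inter> (C' - {first \<rho> C'}) = {}"
proof -
  have "C' - {first \<rho> C'} \<noteq> C - {first \<rho> C}"
    using circuits_of_minimal_bc_unique[OF assms(1,2), of C C'] assms(3-5) by blast
  then have "disjnt (C' - {first \<rho> C'}) (C - {first \<rho> C})"
    using assms(3,4) by (intro pairwiseD[OF assms(2)]) simp_all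
  then show ?thesis by (simp add: disjnt_def Int_commute)
qed

text \<open>The support of a relation contains the broken circuit of one of these circuits, in particular the element of
  largest rank of the circuit. Eliminating this element only adds elements of smaller rank, which decreases
  the weight.\<close>
lemma minimal_circuits_span:
  assumes inj: "inj_on \<rho> {1..n}" and rel: "\<And>C. C \<in> minimal_circuits \<rho> \<Longrightarrow> rel C \<in> F \<and> keys (rel C) = C"
    and r: "r \<in> F"
  shows "r \<in> pm.span (rel ` minimal_circuits \<rho>)"
  using r
proof (induction "\<Sum>x\<in>keys r. 2 ^ \<rho> x :: nat" arbitrary: r rule: less_induct)
  case less
  show ?case
  proof (cases "r = 0")
    case True then show ?thesis by (simp add: pm.span_zero)
  next
    case False
    obtain K where K: "K \<in> circuits" "K \<subseteq> keys r" using ex_circuit_subset less.prems False by blast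
    obtain B where B: "B \<in> minimal_bcs \<rho>" "B \<subseteq> K - {first \<rho> K}" using ex_minimal_bc[OF K(1)] by blast
    obtain C where C: "C \<in> circuits" "B = C - {first \<rho> C}" using minimal_bc_circuit[OF B(1)] by blast
    have Cm: "C \<in> minimal_circuits \<rho>" using C B by blast
    have fB: "finite B" "B \<noteq> {}" using minimal_bc_finite[OF B(1)] minimal_bc_card[OF B(1)] by auto
    have fC: "finite C" "C \<subseteq> {1..n}" using C circuits_finite circuits_sub by blast+
    have injC: "inj_on \<rho> C" using inj fC(2) by (rule inj_on_subset)
    have "Max (\<rho> ` B) \<in> \<rho> ` B" using fB by (intro Max_in) auto
    then obtain t where t0: "t \<in> B" "Max (\<rho> ` B) = \<rho> t" by (rule imageE) simp
    have top: "\<rho> x < \<rho> t" if x: "x \<in> C" "x \<noteq> t" for x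
    proof -
      have tC: "t \<in> C" "t \<noteq> first \<rho> C" using t0 C by auto
      have "\<rho> x \<le> \<rho> t"
      proof (cases "x = first \<rho> C")
        case True then show ?thesis using first_le[OF fC(1) tC(1)] by simp
      next
        case False
        then have "x \<in> B" using x C by blast
        then show ?thesis using Max_ge[of "\<rho> ` B" "\<rho> x"] fB t0(2) by simp
      qed
      moreover have "\<rho> x \<noteq> \<rho> t" using inj_onD[OF injC] x tC by blast
      ultimately show ?thesis by simp
    qed
    have tC: "t \<in> C" using t0 C by auto
    have tr: "t \<in> keys r" using t0 B K by blast
    note rC = rel[OF Cm]
    define a where "a = lookup r t / lookup (rel C) t"
    have nz: "lookup (rel C) t \<noteq> 0" using rC tC by (metis in_keys_iff)
    let ?s = "r - pscale a (rel C)"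
    have s: "?s \<in> F" using rC less.prems by (intro pm.subspace_diff[OF subspace_F] pm.subspace_scale[OF subspace_F]) auto
    have st: "t \<notin> keys ?s" using nz by (simp add: in_keys_iff lookup_minus a_def)
    have "keys ?s \<subseteq> keys r \<union> keys (rel C)" by (auto simp: in_keys_iff lookup_minus)
    then have sk: "keys ?s \<subseteq> (keys r - {t}) \<union> (C - {t})" using st rC by blast
    have "(\<Sum>x\<in>keys ?s. 2 ^ \<rho> x :: nat) \<le> (\<Sum>x\<in>(keys r - {t}) \<union> (C - {t}). 2 ^ \<rho> x)"
      using sk fC by (intro sum_mono2) auto
    also have "\<dots> \<le> (\<Sum>x\<in>keys r - {t}. 2 ^ \<rho> x) + (\<Sum>x\<in>C - {t}. 2 ^ \<rho> x)"
      using fC by (subst sum_Un_nat) auto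
    also have "\<dots> < (\<Sum>x\<in>keys r - {t}. 2 ^ \<rho> x) + 2 ^ \<rho> t"
      using weight_less[of \<rho> "C - {t}" "\<rho> t"] injC fC top by (auto intro: inj_on_subset)
    also have "\<dots> = (\<Sum>x\<in>keys r. 2 ^ \<rho> x)" using tr by (simp add: sum.remove[of "keys r" t])
    finally have "?s \<in> pm.span (rel ` minimal_circuits \<rho>)" using less.hyps s by blast
    moreover have "pscale a (rel C) \<in> pm.span (rel ` minimal_circuits \<rho>)"
      using Cm by (intro pm.span_scale pm.span_base) blast
    ultimately have "?s + pscale a (rel C) \<in> pm.span (rel ` minimal_circuits \<rho>)" by (rule pm.span_add)
    then show ?thesis by simp
  qed
qed

lemma minimal_circuits_spanning_forest:
  assumes inj: "inj_on \<rho> {1..n}" and disj: "pairwise disjnt (minimal_bcs \<rho>)"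
  shows "\<exists>rel. spanning_forest n F \<rho> (minimal_circuits \<rho>) rel"
proof -
  have "\<exists>rel. \<forall>C\<in>minimal_circuits \<rho>. rel C \<in> F \<and> keys (rel C) = C"
    using circuit_relation by (intro bchoice) blast
  then obtain rel where rel: "\<And>C. C \<in> minimal_circuits \<rho> \<Longrightarrow> rel C \<in> F \<and> keys (rel C) = C" by blast
  have "spanning_forest n F \<rho> (minimal_circuits \<rho>) rel"
  proof unfold_locales
    show "inj_on \<rho> {1..n}" by (rule inj)
    show "finite {1..n}" by simp
    show "C \<subseteq> {1..n}" "3 \<le> card C" if "C \<in> minimal_circuits \<rho>" for C
      using that circuits_sub circuits_card by blast+
    show "(C - {first \<rho> C}) \<inter> (C' - {first \<rho> C'}) = {}"
      if "C \<in> minimal_circuits \<rho>" "C' \<in> minimal_circuits \<rho>" "C \<noteq> C'" for C C'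
      by (rule minimal_circuits_disjoint[OF inj disj that])
    show "rel C \<in> F" "keys (rel C) = C" if "C \<in> minimal_circuits \<rho>" for C using rel that by blast+
    have inj_rel: "inj_on rel (minimal_circuits \<rho>)"
    proof (rule inj_onI)
      fix C C' assume CC: "C \<in> minimal_circuits \<rho>" "C' \<in> minimal_circuits \<rho>" "rel C = rel C'"
      have "C = keys (rel C)" "C' = keys (rel C')" using rel[OF CC(1)] rel[OF CC(2)] by simp_all
      then show "C = C'" using CC(3) by argo
    qed
    have fin: "finite (minimal_circuits \<rho>)" using finite_circuits by simp
    fix r assume rF: "r \<in> F"
    have "r \<in> pm.span (rel ` minimal_circuits \<rho>)"
    proof (rule minimal_circuits_span[OF inj _ rF])
      show "rel C \<in> F \<and> keys (rel C) = C" if "C \<in> minimal_circuits \<rho>" for C by (rule rel[OF that])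
    qed
    then obtain u where "r = (\<Sum>v\<in>rel ` minimal_circuits \<rho>. pscale (u v) v)"
      unfolding pm.span_finite[OF finite_imageI[OF fin]] by (rule imageE)
    then have "r = (\<Sum>C\<in>minimal_circuits \<rho>. pscale ((u \<circ> rel) C) (rel C))" by (simp add: sum.reindex[OF inj_rel])
    then show "\<exists>c. r = (\<Sum>C\<in>minimal_circuits \<rho>. pscale (c C) (rel C))" by blast
  qed
  then show ?thesis by blast
qed

text \<open>The same ordering serves both sides. From left to right the simple family consists of the circuits whose broken
  circuits are minimal. From right to left simplicity makes the broken circuits of the family disjoint, and every broken
  circuit contains one of them.\<close>
theorem disjoint_iff_simple:
  assumes inj: "inj_on \<rho> {1..n}"
  shows "pairwise disjnt (minimal_bcs \<rho>) \<longleftrightarrow>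
    (\<exists>D\<subseteq>circuits. simple_family (rank_order n \<rho>) D \<and> circuits = {combined_circuit E | E. E \<subseteq> D \<and> tree_family E})"
proof
  assume disj: "pairwise disjnt (minimal_bcs \<rho>)"
  let ?D = "minimal_circuits \<rho>"
  obtain rel where "spanning_forest n F \<rho> ?D rel" using minimal_circuits_spanning_forest[OF inj disj] by blast
  then interpret S: spanning_forest n F \<rho> ?D rel .
  have "simple_family (rank_order n \<rho>) ?D"
    unfolding simple_family_def
  proof (intro ballI impI)
    fix C C' assume C: "C \<in> ?D" and C': "C' \<in> ?D" and a: "C \<noteq> C' \<and> C \<inter> C' \<noteq> {}"
    have mw: "min_wrt (rank_order n \<rho>) X = first \<rho> X" if "X \<in> ?D" for X
      using that by (intro min_wrt_rank_order[OF inj S.sub[OF that]]) (use S.card3[OF that] in auto)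
    obtain x where x: "x \<in> C" "x \<in> C'" using a by blast
    have "y = x" if y: "y \<in> C" "y \<in> C'" for y
    proof (rule S.connected_meets_once[of "{C'}" C])
      show "connected_family {C'}" unfolding connected_family_def by simp
    qed (use C C' a x y in auto)
    then have "C \<inter> C' = {x}" using x by blast
    moreover have "x = first \<rho> C \<or> x = first \<rho> C'" using S.meet[OF C C' _ x] a by blast
    ultimately show "C \<inter> C' = {min_wrt (rank_order n \<rho>) C} \<or> C \<inter> C' = {min_wrt (rank_order n \<rho>) C'}"
      using mw[OF C] mw[OF C'] by auto
  qed
  then show "\<exists>D\<subseteq>circuits. simple_family (rank_order n \<rho>) D \<and> circuits = {combined_circuit E | E. E \<subseteq> D \<and> tree_family E}"
    using S.circuits_eq_combined by (intro exI[of _ ?D]) blast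
next
  assume "\<exists>D\<subseteq>circuits. simple_family (rank_order n \<rho>) D \<and> circuits = {combined_circuit E | E. E \<subseteq> D \<and> tree_family E}"
  then obtain D where D: "D \<subseteq> circuits" and simple: "simple_family (rank_order n \<rho>) D"
    and eq: "circuits = {combined_circuit E | E. E \<subseteq> D \<and> tree_family E}" by blast
  have mw: "min_wrt (rank_order n \<rho>) C = first \<rho> C" if "C \<in> D" for C
  proof (rule min_wrt_rank_order[OF inj])
    show "C \<subseteq> {1..n}" using that D circuits_sub by blast
    show "C \<noteq> {}" using that D circuits_card by fastforce
  qed
  have disj: "(C - {first \<rho> C}) \<inter> (C' - {first \<rho> C'}) = {}" if C: "C \<in> D" "C' \<in> D" "C \<noteq> C'" for C C'
  proof (rule ccontr)
    assume "(C - {first \<rho> C}) \<inter> (C' - {first \<rho> C'}) \<noteq> {}"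
    then obtain x where x: "x \<in> C \<inter> C'" "x \<noteq> first \<rho> C" "x \<noteq> first \<rho> C'" by blast
    then have "C \<inter> C' = {first \<rho> C} \<or> C \<inter> C' = {first \<rho> C'}"
      using simple C mw[OF C(1)] mw[OF C(2)] unfolding simple_family_def by (metis empty_iff)
    then show False using x by blast
  qed
  interpret broken_forest \<rho> "{1..n}" D
  proof
    show "inj_on \<rho> {1..n}" by (rule inj)
    show "finite {1..n}" by simp
    show "C \<subseteq> {1..n}" "3 \<le> card C" if "C \<in> D" for C
      using that D circuits_sub circuits_card by blast+
  qed (rule disj)
  show "pairwise disjnt (minimal_bcs \<rho>)"
  proof (rule disjoint_minimal_bcsI[OF D disj])
    fix K assume "K \<in> circuits"
    then obtain E where E: "E \<subseteq> D" "tree_family E" "K = combined_circuit E" using eq by blast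
    have "K \<subseteq> \<Union>E" unfolding E(3) combined_circuit_def by blast
    then have "\<exists>C\<in>E. bc C \<subseteq> K - {first \<rho> K}"
      using E(3) by (intro broken_circuit_of_once_covered[OF E(1) tree_family_connected(2)[OF E(2)]]) simp_all
    then show "\<exists>C\<in>D. bc C \<subseteq> K - {first \<rho> K}" using E(1) by blast
  qed
qed

end

section \<open>Complete intersections\<close>

lemma regular_sequenceD:
  fixes fs :: "'k::field mpolynomial list"
  assumes "regular_sequence (polynomial_ring n) fs"
  shows "set fs \<subseteq> polys n"
    "genideal (polynomial_ring n) (set fs) = pideal n (set fs)"
    "\<And>i g. i < length fs \<Longrightarrow> g \<in> polys n \<Longrightarrow> fs ! i * g \<in> pideal n (set (take i fs)) \<Longrightarrow>
      g \<in> pideal n (set (take i fs))"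
proof -
  show fs: "set fs \<subseteq> polys n" using assms unfolding regular_sequence_def by simp
  show "genideal (polynomial_ring n) (set fs) = pideal n (set fs)" by (rule genideal_polynomial_ring[OF fs])
  have take: "genideal (polynomial_ring n) (set (take i fs)) = pideal n (set (take i fs))" for i
    by (rule genideal_polynomial_ring[OF subset_trans[OF set_take_subset fs]])
  fix i g assume "i < length fs" "g \<in> polys n" "fs ! i * g \<in> pideal n (set (take i fs))"
  then show "g \<in> pideal n (set (take i fs))"
    using assms unfolding regular_sequence_def take by simp
qed

lemma keys_multiple_sub: "keys (multiple N r) \<subseteq> (\<lambda>t. N - var_exp t) ` keys r"
proof -
  have "keys (pscale (lookup r t) (mono_poly (N - var_exp t) :: 'a mpolynomial)) \<subseteq> {N - var_exp t}" for t
    using keys_pscale_subset[of "lookup r t" "mono_poly (N - var_exp t)"] by (simp add: mono_poly_def)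
  then show ?thesis
    unfolding multiple_def
    using Poly_Mapping.keys_sum[of "\<lambda>t. pscale (lookup r t) (mono_poly (N - var_exp t) :: 'a mpolynomial)" "keys r"]
    by blast
qed

lemma keys_sqf_minus: "finite A \<Longrightarrow> t \<in> A \<Longrightarrow> keys (sqf A - var_exp t) = A - {t}"
  by (simp add: sqf_minus_var keys_sqf)

lemma mono_poly_multiple_in_pideal:
  assumes "mdvd a m" "m \<in> monomials n" "mono_poly a \<in> pideal n G"
  shows "mono_poly m \<in> pideal n G"
proof -
  have "mono_poly (m - a) * mono_poly a \<in> pideal n G"
    by (rule pideal_mono_mult[OF diff_in_monomials[OF assms(2)] assms(3)])
  then show ?thesis using mdvd_add_diff[OF assms(1)] by (simp add: mono_poly_mult add.commute)
qed

lemma mono_poly_high: "m \<in> monomials n \<Longrightarrow> m \<noteq> 0 \<Longrightarrow> mono_poly m \<in> high n 1"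
  using tdeg_zero_iff[of m n] by (simp add: high_def mono_poly_def)

context relations
begin

lemma nbc_empty: "nbc \<rho> {}"
  unfolding nbc_def
proof (intro conjI ballI)
  fix K assume "K \<in> circuits"
  then have "2 \<le> card (K - {first \<rho> K})" by (rule broken_circuit_card(2))
  then show "\<not> K - {first \<rho> K} \<subseteq> {}" by (metis card.empty not_numeral_le_zero subset_empty)
qed simp

lemma finite_nbc: "nbc \<rho> B \<Longrightarrow> finite B"
  unfolding nbc_def by (meson finite_subset finite_atLeastAtMost)

lemma ex_max_nbc: "\<exists>B. nbc \<rho> B \<and> (\<forall>B'. nbc \<rho> B' \<longrightarrow> card B' \<le> card B)"
proof -
  let ?S = "card ` {B. nbc \<rho> B}"
  have "finite {B. nbc \<rho> B}" by (rule finite_subset[of _ "Pow {1..n}"]) (auto simp: nbc_def)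
  then have fin: "finite ?S" by simp
  have "?S \<noteq> {}" using nbc_empty by blast
  then have "Max ?S \<in> ?S" by (rule Max_in[OF fin])
  then obtain B where B: "nbc \<rho> B" "Max ?S = card B" by blast
  have "card B' \<le> card B" if "nbc \<rho> B'" for B'
    using Max_ge[OF fin, of "card B'"] that B(2) by simp
  then show ?thesis using B(1) by blast
qed

lemma ex_ordered_relations:
  assumes "inj_on \<rho> {1..n}"
  shows "\<exists>R. ordered_relations n F R \<rho>"
proof -
  obtain R where R: "induced_monomial_order n (rank_order n \<rho>) R"
    using ex_induced_monomial_order[OF assms] by blast
  then have "monomial_order n R" unfolding induced_monomial_order_def by blast
  then have "ordered_relations n F R \<rho>"
    using assms R by unfold_locales auto
  then show ?thesis by blast
qed

lemma boundary_keys: "keys (relation_boundary r) \<subseteq> (\<lambda>t. sqf (keys r) - var_exp t) ` keys r"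
  unfolding multiple_sqf by (rule keys_multiple_sub)

lemma boundary_high:
  assumes "r \<in> F" "r \<noteq> 0"
  shows "relation_boundary r \<in> high n 1"
proof -
  have "1 \<le> tdeg n m" if m: "m \<in> keys (relation_boundary r)" for m
  proof -
    obtain t where t: "t \<in> keys r" "m = sqf (keys r) - var_exp t" using m boundary_keys by blast
    have "m \<in> monomials n" using m boundary_in_polys[OF assms(1)] unfolding polys_def by blast
    moreover have "keys m \<noteq> {}"
    proof
      assume "keys m = {}"
      then have "keys r \<subseteq> {t}" using t keys_sqf_minus[OF finite_keys t(1)] by auto
      then have "card (keys r) \<le> 1" using card_mono[of "{t}"] by simp
      then show False using card_F[OF assms] by simp
    qed
    ultimately show ?thesis using tdeg_zero_iff[of m n] by auto
  qed
  then show ?thesis unfolding high_def by blast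
qed

lemma ot_ideal_nonzero: "ot_ideal = pideal n (relation_boundary ` (F - {0}))"
proof
  have "relation_boundary r \<in> pideal n (relation_boundary ` (F - {0}))" if "r \<in> F" for r
  proof (cases "r = 0")
    case True then show ?thesis by (simp add: relation_boundary_def pideal_closed(1))
  next
    case False then show ?thesis using that by (intro pideal_base) blast
  qed
  then show "ot_ideal \<subseteq> pideal n (relation_boundary ` (F - {0}))"
    unfolding ot_ideal_def pideal_subset_iff by blast
  show "pideal n (relation_boundary ` (F - {0})) \<subseteq> ot_ideal"
    unfolding ot_ideal_def by (rule pideal_mono) blast
qed

end

context ordered_relations
begin

text \<open>Modulo \<open>G\<close> the polynomial ring is spanned by the nbc monomials that avoid \<open>T\<close>; so \<open>G\<close> cannot be small.\<close>
lemma nbc_spanning_bound: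
  assumes G: "finite G" "G \<subseteq> polys n" "G \<subseteq> high n 1"
    and ideal: "\<And>k p. p \<in> ot_ideal \<Longrightarrow> \<exists>q\<in>pideal n G. p - q \<in> high n k"
    and T: "\<And>m. m \<in> monomials n \<Longrightarrow> keys m \<inter> T \<noteq> {} \<Longrightarrow> mono_poly m \<in> pideal n G"
    and s: "\<And>B. nbc \<rho> B \<Longrightarrow> B \<inter> T = {} \<Longrightarrow> card B \<le> s"
  shows "n \<le> s + card G"
proof -
  let ?N = "{m \<in> monomials n. nbc \<rho> (keys m) \<and> keys m \<inter> T = {}}"
  show ?thesis
  proof (rule spanning_bound[OF G, of ?N])
    show "?N \<subseteq> monomials n" by blast
    show "card (keys m) \<le> s" if "m \<in> ?N" for m using that s by blast
    fix k and p :: "'a mpolynomial" assume "p \<in> polys n"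
    then have "p \<in> pm.span (ot_ideal \<union> nbc_monos)" using nbc_span by blast
    then obtain a b where ab: "p = a + b" "a \<in> pm.span ot_ideal" "b \<in> pm.span nbc_monos"
      unfolding pm.span_Un by blast
    have a: "a \<in> ot_ideal" using ab(2) by (simp add: ot_ideal_def pm.span_eq_iff[THEN iffD2])
    have "nbc_monos \<subseteq> pideal n G \<union> mono_poly ` ?N" unfolding nbc_monos_def using T by blast
    then have "b \<in> pm.span (pideal n G \<union> mono_poly ` ?N)" using ab(3) pm.span_mono by blast
    then obtain q' a' where q': "b = q' + a'" "q' \<in> pm.span (pideal n G)" "a' \<in> pm.span (mono_poly ` ?N)"
      unfolding pm.span_Un by blast
    have q'G: "q' \<in> pideal n G" using q'(2) by (simp add: pm.span_eq_iff[THEN iffD2])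
    obtain q where q: "q \<in> pideal n G" "a - q \<in> high n k" using ideal[OF a] by blast
    have "q + q' \<in> pideal n G" by (rule pideal_closed(2)[OF q(1) q'G])
    moreover have "p - (q + q') - a' \<in> high n k" using q(2) by (simp add: ab(1) q'(1))
    ultimately show "\<exists>q\<in>pideal n G. \<exists>a\<in>pm.span (mono_poly ` ?N). p - q - a \<in> high n k" using q'(3) by blast
  qed
qed

lemma regular_nbc_bound:
  assumes fs: "regular_sequence (polynomial_ring n) fs" "ot_ideal = pideal n (set fs)" and B: "nbc \<rho> B"
  shows "card B + length fs \<le> n"
proof (rule regular_bound[OF regular_sequenceD(1,3)[OF fs(1)]])
  show sub: "B \<subseteq> {1..n}" using B unfolding nbc_def by blast
  fix p :: "'a mpolynomial" assume p: "p \<in> pm.span (mono_poly ` {m. keys m \<subseteq> B})" "p \<in> pideal n (set fs)"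
  have "mono_poly ` {m. keys m \<subseteq> B} \<subseteq> nbc_monos"
  proof clarify
    fix m :: "nat \<Rightarrow>\<^sub>0 nat" assume m: "keys m \<subseteq> B"
    then have "m \<in> monomials n" "nbc \<rho> (keys m)" using sub nbc_subset[OF B] by (auto simp: monomials_def)
    then show "mono_poly m \<in> nbc_monos" unfolding nbc_monos_def by blast
  qed
  then have "p \<in> pm.span nbc_monos" using p(1) pm.span_mono by blast
  then show "p = 0" by (rule nbc_independent) (use p(2) fs(2) in simp)
qed

lemma lm_boundary_circuit:
  assumes "B \<in> minimal_bcs \<rho>"
  shows "\<exists>f\<in>ot_ideal. f \<in> polys n \<and> f \<noteq> 0 \<and> lm f = sqf B"
proof -
  obtain K where K: "K \<in> circuits" "B = K - {first \<rho> K}" using minimal_bc_circuit[OF assms] by blast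
  obtain r where r: "r \<in> F" "r \<noteq> 0" "keys r = K" using circuit_relation[OF K(1)] by blast
  have "relation_boundary r \<in> ot_ideal" unfolding ot_ideal_def using r by (intro pideal_base) blast
  moreover have "lm (relation_boundary r) = sqf B" "relation_boundary r \<noteq> 0"
    using lm_boundary[OF r(1,2)] r(3) K(2) by simp_all
  ultimately show ?thesis using boundary_in_polys[OF r(1)] by blast
qed

lemma leading_minimal_bc:
  assumes "p \<in> ot_ideal" "p \<noteq> 0"
  shows "\<exists>B\<in>minimal_bcs \<rho>. mdvd (sqf B) (lm p)"
proof -
  obtain K where K: "K \<in> circuits" "K - {first \<rho> K} \<subseteq> keys (lm p)" using leading_broken_circuit[OF assms] by blast
  obtain B where "B \<in> minimal_bcs \<rho>" "B \<subseteq> K - {first \<rho> K}" using ex_minimal_bc[OF K(1)] by blast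
  then show ?thesis using K(2) mdvd_sqf[OF minimal_bc_finite] by blast
qed

lemma initial_ideal_ot: "initial_ideal n R ot_ideal = pideal n (mono_poly ` sqf ` minimal_bcs \<rho> :: 'a mpolynomial set)"
proof -
  let ?L = "{mono_poly (leading_monomial R p) | p. p \<in> ot_ideal \<and> p \<noteq> 0} :: 'a mpolynomial set"
  have lm_mon: "lm p \<in> monomials n" if "p \<in> ot_ideal" "p \<noteq> 0" for p :: "'a mpolynomial"
    using lm_in_monomials ot_ideal_sub that by blast
  then have "?L \<subseteq> polys n" by auto
  then have "initial_ideal n R ot_ideal = pideal n ?L"
    unfolding initial_ideal_def by (rule genideal_polynomial_ring)
  also have "pideal n ?L = pideal n (mono_poly ` sqf ` minimal_bcs \<rho>)"
  proof (rule subset_antisym)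
    show "pideal n ?L \<subseteq> pideal n (mono_poly ` sqf ` minimal_bcs \<rho>)"
      unfolding pideal_subset_iff
    proof clarify
      fix p :: "'a mpolynomial" assume p: "p \<in> ot_ideal" "p \<noteq> 0"
      obtain B where B: "B \<in> minimal_bcs \<rho>" "mdvd (sqf B) (lm p)" using leading_minimal_bc[OF p] by blast
      show "mono_poly (lm p) \<in> pideal n (mono_poly ` sqf ` minimal_bcs \<rho>)"
        by (rule mono_poly_multiple_in_pideal[OF B(2) lm_mon[OF p]]) (use B(1) in \<open>intro pideal_base, blast\<close>)
    qed
    show "pideal n (mono_poly ` sqf ` minimal_bcs \<rho>) \<subseteq> pideal n ?L"
      unfolding pideal_subset_iff
    proof clarify
      fix B assume "B \<in> minimal_bcs \<rho>"
      then obtain f where "f \<in> ot_ideal" "f \<noteq> 0" "lm f = sqf B" using lm_boundary_circuit by blast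
      then have "mono_poly (sqf B) \<in> ?L" by force
      then show "mono_poly (sqf B) \<in> pideal n ?L" by (rule pideal_base)
    qed
  qed
  finally show ?thesis .
qed

text \<open>Only the leading monomials of the \<open>f B\<close> matter, so that this applies both to boundaries of circuits and to the
  monomials of the broken circuits.\<close>
lemma disjoint_regular:
  fixes f :: "nat set \<Rightarrow> 'a mpolynomial"
  assumes disj: "pairwise disjnt (minimal_bcs \<rho>)"
    and f: "\<And>B. B \<in> minimal_bcs \<rho> \<Longrightarrow> f B \<in> polys n \<and> f B \<noteq> 0 \<and> lm (f B) = sqf B"
  shows "\<exists>fs. regular_sequence (polynomial_ring n) fs \<and> set fs = f ` minimal_bcs \<rho>"
proof -
  obtain Bs where Bs: "set Bs = minimal_bcs \<rho>" "distinct Bs"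
    using finite_distinct_list[OF finite_minimal_bcs] by blast
  have "regular_sequence (polynomial_ring n) (map f Bs)"
  proof (rule coprime_leading_regular)
    show "set (map f Bs) \<subseteq> polys n" "0 \<notin> set (map f Bs)" using f Bs(1) by auto
    fix i j assume ij: "i < j" "j < length (map f Bs)"
    have B: "Bs ! i \<in> minimal_bcs \<rho>" "Bs ! j \<in> minimal_bcs \<rho>" "Bs ! i \<noteq> Bs ! j"
      using ij Bs nth_mem[of i Bs] nth_mem[of j Bs] by (auto simp: nth_eq_iff_index_eq)
    have "Bs ! i \<inter> Bs ! j = {}" using pairwiseD[OF disj B] by (simp add: disjnt_def)
    then show "keys (lm (map f Bs ! i)) \<inter> keys (lm (map f Bs ! j)) = {}"
      using ij f[OF B(1)] f[OF B(2)] keys_sqf[OF minimal_bc_finite] B by simp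
  next
    fix g assume "g \<in> set (map f Bs)"
    then obtain B where B: "B \<in> minimal_bcs \<rho>" "g = f B" using Bs(1) by auto
    have "keys (sqf B) = B" by (rule keys_sqf[OF minimal_bc_finite[OF B(1)]])
    moreover have "B \<noteq> {}" using minimal_bc_card[OF B(1)] by auto
    ultimately show "lm g \<noteq> 0" using f[OF B(1)] B(2) by auto
  qed
  then show ?thesis using Bs(1) by (intro exI[of _ "map f Bs"]) simp
qed

theorem disjoint_imp_complete_intersection:
  assumes disj: "pairwise disjnt (minimal_bcs \<rho>)"
  shows "complete_intersection (polynomial_ring n) ot_ideal"
proof -
  have "\<exists>f. \<forall>B\<in>minimal_bcs \<rho>. f B \<in> ot_ideal \<and> f B \<in> polys n \<and> f B \<noteq> 0 \<and> lm (f B) = sqf B"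
    using lm_boundary_circuit by (intro bchoice) blast
  then obtain f where f: "\<And>B. B \<in> minimal_bcs \<rho> \<Longrightarrow> f B \<in> ot_ideal \<and> f B \<in> polys n \<and> f B \<noteq> 0 \<and> lm (f B) = sqf B"
    by blast
  obtain fs where fs: "regular_sequence (polynomial_ring n) fs" "set fs = f ` minimal_bcs \<rho>"
    using disjoint_regular[OF disj, of f] f by blast
  have "ot_ideal = pideal n (f ` minimal_bcs \<rho>)"
  proof (rule pideal_eqI_leading[OF ot_ideal_def])
    show "relation_boundary ` F \<subseteq> polys n" using boundary_in_polys by blast
    show "f ` minimal_bcs \<rho> \<subseteq> ot_ideal" "0 \<notin> f ` minimal_bcs \<rho>" using f by auto
    fix p :: "'a mpolynomial" assume "p \<in> ot_ideal" "p \<noteq> 0"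
    then obtain B where B: "B \<in> minimal_bcs \<rho>" "mdvd (sqf B) (lm p)" using leading_minimal_bc by blast
    then show "\<exists>g\<in>f ` minimal_bcs \<rho>. mdvd (lm g) (lm p)"
      using f[OF B(1)] by (intro bexI[OF _ imageI[OF B(1)]]) simp
  qed
  then show ?thesis
    unfolding complete_intersection_def using fs regular_sequenceD(2)[OF fs(1)] by metis
qed

theorem disjoint_imp_initial_complete_intersection:
  assumes disj: "pairwise disjnt (minimal_bcs \<rho>)"
  shows "complete_intersection (polynomial_ring n) (initial_ideal n R ot_ideal)"
proof -
  have "sqf B \<in> monomials n" if "B \<in> minimal_bcs \<rho>" for B
    using sqf_in_monomials[OF minimal_bc_finite[OF that]] minimal_bc_sub[OF that] by blast
  then obtain fs :: "'a mpolynomial list" where fs: "regular_sequence (polynomial_ring n) fs"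
    "set fs = (\<lambda>B. mono_poly (sqf B)) ` minimal_bcs \<rho>"
    using disjoint_regular[OF disj, of "\<lambda>B. mono_poly (sqf B)"] by auto
  have "initial_ideal n R ot_ideal = pideal n (set fs)"
    unfolding initial_ideal_ot fs(2) by (simp add: image_image)
  then show ?thesis
    unfolding complete_intersection_def using fs(1) regular_sequenceD(2)[OF fs(1)] by metis
qed

text \<open>If two minimal broken circuits share an element \<open>v\<close>, then \<open>x\<^sub>v\<close> together with the remaining generators
  generates an ideal that contains the initial ideal and has fewer generators than the regular sequence.\<close>
theorem initial_complete_intersection_imp_disjoint:
  assumes "complete_intersection (polynomial_ring n) (initial_ideal n R ot_ideal)"
  shows "pairwise disjnt (minimal_bcs \<rho>)"
proof (rule pairwiseI, rule ccontr)
  let ?M = "mono_poly ` sqf ` minimal_bcs \<rho> :: 'a mpolynomial set"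
  let ?J = "pideal n ?M"
  obtain fs where fs: "regular_sequence (polynomial_ring n) fs" "?J = pideal n (set fs)"
    using assms regular_sequenceD(2) unfolding complete_intersection_def initial_ideal_ot by metis
  fix A B assume A: "A \<in> minimal_bcs \<rho>" and B: "B \<in> minimal_bcs \<rho>" and AB: "A \<noteq> B" and "\<not> disjnt A B"
  then obtain v where v: "v \<in> A" "v \<in> B" unfolding disjnt_def by blast
  have sq_mon: "sqf X \<in> monomials n" if "X \<in> minimal_bcs \<rho>" for X
    using sqf_in_monomials[OF minimal_bc_finite[OF that]] minimal_bc_sub[OF that] by blast
  have sq_inj: "X = Y" if "X \<in> minimal_bcs \<rho>" "Y \<in> minimal_bcs \<rho>" "sqf X = sqf Y" for X Y
    using keys_sqf[OF minimal_bc_finite[OF that(1)]] keys_sqf[OF minimal_bc_finite[OF that(2)]] unfolding that(3) by argo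
  have J_keys: "?J \<subseteq> {p. keys p \<subseteq> {m. \<exists>X\<in>minimal_bcs \<rho>. X \<subseteq> keys m}}"
  proof (rule pideal_minimal[OF _ subspace_keys])
    show "?M \<subseteq> {p. keys p \<subseteq> {m. \<exists>X\<in>minimal_bcs \<rho>. X \<subseteq> keys m}}"
      using keys_sqf[OF minimal_bc_finite] by (auto simp: mono_poly_def)
    fix m and q :: "'a mpolynomial" assume q: "q \<in> {p. keys p \<subseteq> {m. \<exists>X\<in>minimal_bcs \<rho>. X \<subseteq> keys m}}"
    have "\<exists>X\<in>minimal_bcs \<rho>. X \<subseteq> keys u" if u: "u \<in> keys (mono_poly m * q)" for u
    proof -
      obtain w where w: "u = m + w" "w \<in> keys q"
        using u Poly_Mapping.keys_mult[of "mono_poly m" q] by (auto simp: mono_poly_def)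
      obtain X where "X \<in> minimal_bcs \<rho>" "X \<subseteq> keys w" using q w(2) by blast
      then show ?thesis unfolding w(1) keys_add_nat by blast
    qed
    then show "mono_poly m * q \<in> {p. keys p \<subseteq> {m. \<exists>X\<in>minimal_bcs \<rho>. X \<subseteq> keys m}}" by blast
  qed
  \<comment> \<open>No generator is redundant, so there are at most as many as elements of the regular sequence.\<close>
  obtain D where D: "D \<subseteq> ?M" "finite D" "card D \<le> card (set fs)" "?J \<subseteq> pm.span (higher_multiples n ?J \<union> D)"
    using few_generators[OF fs(2)] by blast
  have "?M \<subseteq> D"
  proof (rule ccontr)
    assume "\<not> ?M \<subseteq> D"
    then obtain X where X: "X \<in> minimal_bcs \<rho>" "mono_poly (sqf X) \<notin> D" by blast
    let ?Z = "{p :: 'a mpolynomial. keys p \<subseteq> - {sqf X}}"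
    have "D \<subseteq> ?Z"
    proof
      fix d assume d: "d \<in> D"
      then obtain Y where "Y \<in> minimal_bcs \<rho>" "d = mono_poly (sqf Y)" using D(1) by blast
      moreover from this have "sqf Y \<noteq> sqf X" using X(2) d by auto
      ultimately show "d \<in> ?Z" by (simp add: mono_poly_def)
    qed
    moreover have "higher_multiples n ?J \<subseteq> ?Z"
      unfolding higher_multiples_def
    proof (rule pm.span_minimal[OF _ subspace_keys], clarify)
      fix m and p :: "'a mpolynomial" assume m: "m \<in> monomials n" "m \<noteq> 0" and p: "p \<in> ?J"
        and k: "sqf X \<in> keys (mono_poly m * p)"
      obtain u where u: "sqf X = m + u" "u \<in> keys p"
        using k Poly_Mapping.keys_mult[of "mono_poly m" p] by (auto simp: mono_poly_def)
      obtain Y where Y: "Y \<in> minimal_bcs \<rho>" "Y \<subseteq> keys u" using J_keys p u(2) by blast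
      have kX: "keys m \<union> keys u = X"
        using keys_sqf[OF minimal_bc_finite[OF X(1)]] u(1) keys_add_nat[of m u] by simp
      obtain K where K: "K \<in> circuits" "Y = K - {first \<rho> K}" using minimal_bc_circuit[OF Y(1)] by blast
      have "Y = X" using minimal_bc_minimal[OF X(1) K(1)] K(2) Y(2) kX by blast
      obtain i where i: "i \<in> keys m" using m(2) by (metis all_not_in_conv keys_eq_empty)
      then have iu: "i \<in> keys u" using kX Y(2) \<open>Y = X\<close> by blast
      have "lookup (sqf X) i = lookup m i + lookup u i" using u(1) by (simp add: lookup_add)
      moreover have "lookup (sqf X) i \<le> 1" by (simp add: lookup_sqf[OF minimal_bc_finite[OF X(1)]])
      moreover have "lookup m i \<noteq> 0" "lookup u i \<noteq> 0" using i iu by (simp_all add: in_keys_iff)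
      ultimately show False by linarith
    qed
    ultimately have "higher_multiples n ?J \<union> D \<subseteq> ?Z" by (rule Un_least[rotated])
    then have "pm.span (higher_multiples n ?J \<union> D) \<subseteq> ?Z" using subspace_keys by (rule pm.span_minimal)
    moreover have "mono_poly (sqf X) \<in> ?J" using X(1) by (intro pideal_base) blast
    ultimately have "mono_poly (sqf X) \<in> ?Z" using D(4) by blast
    then show False by (simp add: mono_poly_def)
  qed
  then have "card ?M \<le> card D" by (rule card_mono[OF D(2)])
  moreover have "card ?M = card (minimal_bcs \<rho>)"
  proof -
    have "inj_on (\<lambda>X. mono_poly (sqf X) :: 'a mpolynomial) (minimal_bcs \<rho>)"
      by (rule inj_onI) (simp add: mono_poly_def sq_inj)
    then show ?thesis by (simp add: image_image card_image)
  qed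
  ultimately have few: "card (minimal_bcs \<rho>) \<le> length fs" using D(3) card_length[of fs] by linarith
  define G where "G = insert (mono_poly (var_exp v)) ((\<lambda>X. mono_poly (sqf X) :: 'a mpolynomial) ` (minimal_bcs \<rho> - {A} - {B}))"
  have v_n: "v \<in> {1..n}" using v(1) minimal_bc_sub[OF A] by blast
  have JG: "?J \<subseteq> pideal n G"
    unfolding pideal_subset_iff
  proof clarify
    fix X assume X: "X \<in> minimal_bcs \<rho>"
    show "mono_poly (sqf X) \<in> pideal n G"
    proof (cases "X = A \<or> X = B")
      case True
      then have "mdvd (var_exp v) (sqf X)"
        using v lookup_sqf[OF minimal_bc_finite[OF X]] by (auto simp: mdvd_def lookup_var_exp)
      then show ?thesis
        by (rule mono_poly_multiple_in_pideal[OF _ sq_mon[OF X]]) (simp add: G_def pideal_base)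
    next
      case False
      then show ?thesis using X unfolding G_def by (intro pideal_base) blast
    qed
  qed
  have card_G: "card G + 1 \<le> card (minimal_bcs \<rho>)"
  proof -
    have "card G \<le> Suc (card ((\<lambda>X. mono_poly (sqf X) :: 'a mpolynomial) ` (minimal_bcs \<rho> - {A} - {B})))"
      unfolding G_def using finite_minimal_bcs by (simp add: card_insert_if)
    also have "\<dots> \<le> Suc (card (minimal_bcs \<rho> - {A} - {B}))"
      using finite_minimal_bcs by (simp add: card_image_le)
    finally have "card G \<le> Suc (card (minimal_bcs \<rho> - {A} - {B}))" .
    moreover have "card (minimal_bcs \<rho>) = Suc (Suc (card (minimal_bcs \<rho> - {A} - {B})))"
      using A B AB finite_minimal_bcs by (metis card.remove finite_Diff insertE insert_Diff)
    ultimately show ?thesis by linarith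
  qed
  obtain C where C: "nbc \<rho> C" "\<And>C'. nbc \<rho> C' \<Longrightarrow> card C' \<le> card C" using ex_max_nbc by blast
  let ?N = "{m \<in> monomials n. nbc \<rho> (keys m)}"
  have "n \<le> card C + card G"
  proof (rule spanning_bound[of G n ?N])
    show "finite G" unfolding G_def using finite_minimal_bcs by simp
    show "G \<subseteq> polys n" unfolding G_def using sq_mon v_n by (auto simp: var_in_monomials)
    have "sqf X \<noteq> 0" if "X \<in> minimal_bcs \<rho>" for X
      using keys_sqf[OF minimal_bc_finite[OF that]] minimal_bc_card[OF that] by auto
    moreover have "var_exp v \<noteq> 0" by (metis keys_var_exp keys_zero insert_not_empty)
    ultimately show "G \<subseteq> high n 1"
      unfolding G_def using sq_mon var_in_monomials[OF v_n] mono_poly_high by blast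
    show "?N \<subseteq> monomials n" by blast
    show "card (keys m) \<le> card C" if "m \<in> ?N" for m using that C(2) by blast
    fix k and p :: "'a mpolynomial" assume "p \<in> polys n"
    have "mono_poly ` monomials n \<subseteq> pideal n G \<union> mono_poly ` ?N"
    proof clarify
      fix m assume m: "m \<in> monomials n" and "mono_poly m \<notin> mono_poly ` ?N"
      then have "\<not> nbc \<rho> (keys m)" by blast
      then obtain X where X: "X \<in> minimal_bcs \<rho>" "X \<subseteq> keys m"
        unfolding nbc_iff using m by (auto simp: monomials_def)
      have "mono_poly (sqf X) \<in> pideal n G" using JG X(1) pideal_base[of _ ?M n] by blast
      then show "mono_poly m \<in> pideal n G"
        using mono_poly_multiple_in_pideal[OF _ m] mdvd_sqf[OF minimal_bc_finite[OF X(1)]] X(2) by blast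
    qed
    then have "p \<in> pm.span (pideal n G \<union> mono_poly ` ?N)"
      using \<open>p \<in> polys n\<close> pm.span_mono unfolding polys_eq_span by blast
    then obtain q a where qa: "p = q + a" "q \<in> pm.span (pideal n G)" "a \<in> pm.span (mono_poly ` ?N)"
      unfolding pm.span_Un by blast
    have "q \<in> pideal n G" using qa(2) by (simp add: pm.span_eq_iff[THEN iffD2])
    moreover have "p - q - a \<in> high n k" using pm.subspace_0[OF subspace_high] by (simp add: qa(1))
    ultimately show "\<exists>q\<in>pideal n G. \<exists>a\<in>pm.span (mono_poly ` ?N). p - q - a \<in> high n k" using qa(3) by blast
  qed
  moreover have "card C + length fs \<le> n"
  proof (rule regular_bound[OF regular_sequenceD(1,3)[OF fs(1)]])
    show "C \<subseteq> {1..n}" using C(1) unfolding nbc_def by blast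
    fix p :: "'a mpolynomial" assume p: "p \<in> pm.span (mono_poly ` {m. keys m \<subseteq> C})" "p \<in> pideal n (set fs)"
    have 1: "keys p \<subseteq> {m. keys m \<subseteq> C}" by (rule span_monos_keys[OF p(1)])
    have 2: "keys p \<subseteq> {m. \<exists>X\<in>minimal_bcs \<rho>. X \<subseteq> keys m}" using J_keys p(2) fs(2) by blast
    have "keys p = {}"
    proof (rule ccontr)
      assume "keys p \<noteq> {}"
      then obtain m where "m \<in> keys p" by blast
      then obtain X where "X \<in> minimal_bcs \<rho>" "X \<subseteq> C" using 1 2 by blast
      then show False using C(1) unfolding nbc_iff by blast
    qed
    then show "p = 0" by simp
  qed
  ultimately show False using few card_G by linarith
qed

end

context relations
begin

text \<open>The generators of a complete intersection form a sparse hypergraph. Otherwise the variables in \<open>T\<close>, together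
  with the generators whose supports meet \<open>T\<close> at most once, would generate an ideal that contains the Orlik-Terao ideal
  and has no more generators than the regular sequence. But modulo the variables in \<open>T\<close> the dimension drops, because nbc
  sets that avoid the first element of the ordering are never maximal.\<close>
lemma generators_sparse:
  assumes fs: "regular_sequence (polynomial_ring n) fs" "ot_ideal = pideal n (set fs)"
    and DR: "DR \<subseteq> F - {0}" "finite DR" "card DR \<le> length fs"
    and gen: "\<And>k p. p \<in> ot_ideal \<Longrightarrow> \<exists>q\<in>pideal n (relation_boundary ` DR). p - q \<in> high n k"
    and T: "T \<subseteq> {1..n}" "T \<noteq> {}"
  shows "card {r \<in> DR. 2 \<le> card (keys r \<inter> T)} < card T"
proof (rule ccontr)
  let ?DT = "{r \<in> DR. 2 \<le> card (keys r \<inter> T)}"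
  assume neg: "\<not> card ?DT < card T"
  obtain v where v: "v \<in> T" using T(2) by blast
  have v_n: "v \<in> {1..n}" using v T(1) by blast
  \<comment> \<open>With \<open>v\<close> first, no broken circuit contains \<open>v\<close>, so \<open>v\<close> can be added to every nbc set.\<close>
  define \<rho> where "\<rho> x = (if x = v then 0 else x)" for x :: nat
  have inj: "inj_on \<rho> {1..n}" unfolding inj_on_def \<rho>_def by auto
  obtain R where "ordered_relations n F R \<rho>" using ex_ordered_relations[OF inj] by blast
  then interpret ordered_relations n F R \<rho> .
  define G where "G = (\<lambda>x. mono_poly (var_exp x)) ` T \<union> relation_boundary ` (DR - ?DT)"
  have finT: "finite T" by (rule finite_subset[OF T(1)]) simp
  have varG: "mono_poly m \<in> pideal n G" if m: "m \<in> monomials n" "keys m \<inter> T \<noteq> {}" for m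
  proof -
    obtain x where x: "x \<in> keys m" "x \<in> T" using m(2) by blast
    have "mdvd (var_exp x) m" using x(1) by (auto simp: mdvd_def lookup_var_exp in_keys_iff)
    then show ?thesis
      by (rule mono_poly_multiple_in_pideal[OF _ m(1)]) (use x(2) in \<open>auto simp: G_def intro!: pideal_base\<close>)
  qed
  have "relation_boundary r \<in> pideal n G" if r: "r \<in> DR" for r
  proof (cases "r \<in> ?DT")
    case False
    then show ?thesis using r unfolding G_def by (intro pideal_base) blast
  next
    case True
    have rF: "r \<in> F" using r DR by blast
    have "mono_poly m \<in> pideal n G" if m: "m \<in> keys (relation_boundary r)" for m
    proof (rule varG)
      show "m \<in> monomials n" using m boundary_in_polys[OF rF] unfolding polys_def by blast
      obtain t where t: "t \<in> keys r" "m = sqf (keys r) - var_exp t" using m boundary_keys by blast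
      have km: "keys m = keys r - {t}" unfolding t(2) by (rule keys_sqf_minus[OF finite_keys t(1)])
      have "\<not> keys r \<inter> T \<subseteq> {t}"
      proof
        assume "keys r \<inter> T \<subseteq> {t}"
        then have "card (keys r \<inter> T) \<le> 1" using card_mono[of "{t}"] by simp
        then show False using True by simp
      qed
      then show "keys m \<inter> T \<noteq> {}" unfolding km by blast
    qed
    then show ?thesis
      by (subst mpoly_expand) (intro pideal_closed(6) pideal_closed(5), blast)
  qed
  then have sub: "pideal n (relation_boundary ` DR) \<subseteq> pideal n G" unfolding pideal_subset_iff by blast
  have bound: "card B + 1 + length fs \<le> n" if B: "nbc \<rho> B" "B \<inter> T = {}" for B
  proof -
    have vB: "v \<notin> B" using B(2) v by blast
    have "\<not> K - {first \<rho> K} \<subseteq> insert v B" if K: "K \<in> circuits" for K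
    proof
      assume sub: "K - {first \<rho> K} \<subseteq> insert v B"
      have "v \<notin> K - {first \<rho> K}"
      proof
        assume "v \<in> K - {first \<rho> K}"
        then have "\<rho> (first \<rho> K) < \<rho> v" using first_less[OF inj circuits_sub[OF K] circuits_finite[OF K]] by blast
        then show False by (simp add: \<rho>_def)
      qed
      then have "K - {first \<rho> K} \<subseteq> B" using sub by blast
      then show False using B(1) K unfolding nbc_def by blast
    qed
    then have "nbc \<rho> (insert v B)" using B(1) v_n unfolding nbc_def by blast
    then have "card (insert v B) + length fs \<le> n" by (rule regular_nbc_bound[OF fs])
    then show ?thesis using vB finite_nbc[OF B(1)] by simp
  qed
  have "n \<le> (n - length fs - 1) + card G"
  proof (rule nbc_spanning_bound[where T = T])
    show "finite G" unfolding G_def using finT DR(2) by simp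
    show "G \<subseteq> polys n"
      unfolding G_def using T(1) DR(1) boundary_in_polys var_in_monomials by auto
    have "var_exp x \<noteq> 0" for x by (metis keys_var_exp keys_zero insert_not_empty)
    then show "G \<subseteq> high n 1"
      unfolding G_def using T(1) DR(1) boundary_high var_in_monomials mono_poly_high by blast
    show "\<exists>q\<in>pideal n G. p - q \<in> high n k" if "p \<in> ot_ideal" for k p
      using gen[OF that, of k] sub by blast
    show "card B \<le> n - length fs - 1" if "nbc \<rho> B" "B \<inter> T = {}" for B
      using bound[OF that] by linarith
  qed (rule varG)
  moreover have "1 + length fs \<le> n" using bound[OF nbc_empty] by simp
  moreover have "card G \<le> length fs"
  proof -
    have "card G \<le> card ((\<lambda>x. mono_poly (var_exp x) :: 'k mpolynomial) ` T) + card (relation_boundary ` (DR - ?DT))"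
      unfolding G_def by (rule card_Un_le)
    also have "\<dots> \<le> card T + card (DR - ?DT)"
      by (rule add_mono) (rule card_image_le, use finT DR(2) in simp)+
    also have "card (DR - ?DT) = card DR - card ?DT" using DR(2) by (intro card_Diff_subset) auto
    also have "card ?DT \<le> card DR" using DR(2) by (intro card_mono) auto
    then have "card T + (card DR - card ?DT) \<le> card DR" using neg by linarith
    finally show ?thesis using DR(3) by linarith
  qed
  ultimately show False by linarith
qed

text \<open>The generators selected by Nakayama's lemma are sparse, so for some ordering their supports have disjoint broken
  circuits. Counting modulo the generators shows that they are at least as many as the elements outside of a
  largest nbc set. No nonzero relation is supported on an nbc set, so they are at least as many as the dimension
  of the relation space, and therefore span it.\<close>
theorem complete_intersection_imp_disjoint:
  assumes "complete_intersection (polynomial_ring n) ot_ideal"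
  shows "\<exists>\<rho>. inj_on \<rho> {1..n} \<and> pairwise disjnt (minimal_bcs \<rho>)"
proof -
  obtain fs where fs: "regular_sequence (polynomial_ring n) fs" "ot_ideal = pideal n (set fs)"
    using assms regular_sequenceD(2) unfolding complete_intersection_def by metis
  obtain D0 where D0: "D0 \<subseteq> relation_boundary ` (F - {0})" "finite D0" "card D0 \<le> card (set fs)"
    "\<forall>k. \<forall>p\<in>pideal n (relation_boundary ` (F - {0})). \<exists>q\<in>pideal n D0. p - q \<in> high n k"
    using few_generators[of n "relation_boundary ` (F - {0})" "set fs"] fs(2) ot_ideal_nonzero by auto
  obtain DR where DR: "DR \<subseteq> F - {0}" "inj_on relation_boundary DR" "D0 = relation_boundary ` DR"
    using D0(1) subset_image_inj[of D0 relation_boundary "F - {0}"] by blast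
  have finDR: "finite DR" using D0(2) finite_imageD[OF _ DR(2)] unfolding DR(3) by blast
  have "card DR = card D0" unfolding DR(3) by (rule card_image[OF DR(2), symmetric])
  then have cardDR: "card DR \<le> length fs" using D0(3) card_length[of fs] by linarith
  have gen: "\<exists>q\<in>pideal n (relation_boundary ` DR). p - q \<in> high n k" if "p \<in> ot_ideal" for k p
    using D0(4) that unfolding ot_ideal_nonzero DR(3) by blast
  have sparse: "card {r \<in> DR. 2 \<le> card (keys r \<inter> T)} < card T" if "T \<subseteq> {1..n}" "T \<noteq> {}" for T
    by (rule generators_sparse[OF fs DR(1) finDR cardDR gen that])
  have cardk: "3 \<le> card (keys r)" "keys r \<subseteq> {1..n}" if "r \<in> DR" for r
    using that DR(1) card_F keys_F by blast+
  have inj_keys: "inj_on keys DR"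
  proof (rule inj_onI, rule ccontr)
    fix r s assume rs: "r \<in> DR" "s \<in> DR" "keys r = keys s" "r \<noteq> s"
    obtain T where T: "T \<subseteq> keys r" "card T = 2"
      using obtain_subset_with_card_n[of 2 "keys r"] cardk(1)[OF rs(1)] by force
    have "keys r \<inter> T = T" "keys s \<inter> T = T" using T(1) rs(3) by blast+
    then have "{r, s} \<subseteq> {r \<in> DR. 2 \<le> card (keys r \<inter> T)}" using rs T(2) by auto
    then have "card {r, s} \<le> card {r \<in> DR. 2 \<le> card (keys r \<inter> T)}" using finDR by (intro card_mono) auto
    moreover have "card {r \<in> DR. 2 \<le> card (keys r \<inter> T)} < card T"
    proof (rule sparse)
      show "T \<subseteq> {1..n}" using T(1) cardk(2)[OF rs(1)] by blast
      show "T \<noteq> {}" using T(2) by auto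
    qed
    ultimately show False using rs(4) T(2) by simp
  qed
  let ?D = "keys ` DR"
  have "\<exists>\<rho>. inj_on \<rho> {1..n} \<and> (\<forall>C\<in>?D. \<forall>C'\<in>?D. C \<noteq> C' \<longrightarrow> (C - {first \<rho> C}) \<inter> (C' - {first \<rho> C'}) = {})"
  proof (rule sparse_ordering)
    show "C \<subseteq> {1..n}" "2 \<le> card C" if "C \<in> ?D" for C
      using that cardk by fastforce+
    fix T :: "nat set" assume T: "T \<subseteq> {1..n}" "T \<noteq> {}"
    have "{C \<in> ?D. 2 \<le> card (C \<inter> T)} = keys ` {r \<in> DR. 2 \<le> card (keys r \<inter> T)}" by blast
    then have "card {C \<in> ?D. 2 \<le> card (C \<inter> T)} \<le> card {r \<in> DR. 2 \<le> card (keys r \<inter> T)}"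
      using finDR by (simp add: card_image_le)
    then show "card {C \<in> ?D. 2 \<le> card (C \<inter> T)} < card T" using sparse[OF T] by linarith
  qed simp
  then obtain \<rho> where inj: "inj_on \<rho> {1..n}"
    and disj0: "\<forall>C\<in>?D. \<forall>C'\<in>?D. C \<noteq> C' \<longrightarrow> (C - {first \<rho> C}) \<inter> (C' - {first \<rho> C'}) = {}"
    by (elim exE conjE) (rule that)
  have disj: "(C - {first \<rho> C}) \<inter> (C' - {first \<rho> C'}) = {}" if "C \<in> ?D" "C' \<in> ?D" "C \<noteq> C'" for C C'
    using bspec[OF bspec[OF disj0 that(1)] that(2)] that(3) by (rule mp)
  define rel where "rel = inv_into DR keys"
  have rel: "rel C \<in> DR" "keys (rel C) = C" if "C \<in> ?D" for C
    unfolding rel_def using inv_into_into[OF that] f_inv_into_f[OF that] by blast+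
  interpret forest_relations n F \<rho> ?D rel
  proof unfold_locales
    show "inj_on \<rho> {1..n}" by (rule inj)
    show "finite {1..n}" by simp
    show "C \<subseteq> {1..n}" "3 \<le> card C" if "C \<in> ?D" for C using that cardk by auto
    show "(C - {first \<rho> C}) \<inter> (C' - {first \<rho> C'}) = {}" if "C \<in> ?D" "C' \<in> ?D" "C \<noteq> C'" for C C'
      by (rule disj[OF that])
    show "rel C \<in> F" "keys (rel C) = C" if "C \<in> ?D" for C using rel[OF that] DR(1) by blast+
  qed
  obtain R where "ordered_relations n F R \<rho>" using ex_ordered_relations[OF inj] by blast
  then interpret O: ordered_relations n F R \<rho> .
  obtain B where B: "nbc \<rho> B" "\<And>B'. nbc \<rho> B' \<Longrightarrow> card B' \<le> card B" using ex_max_nbc by blast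
  have "n \<le> card B + card (relation_boundary ` DR)"
  proof (rule O.nbc_spanning_bound[where T = "{}"])
    show "finite (relation_boundary ` DR)" using finDR by simp
    show "relation_boundary ` DR \<subseteq> polys n" "relation_boundary ` DR \<subseteq> high n 1"
      using DR(1) boundary_in_polys boundary_high by blast+
  qed (use gen B(2) in auto)
  also have "card (relation_boundary ` DR) = card ?D"
    using card_image[OF DR(2)] card_image[OF inj_keys] by simp
  finally have dim: "n \<le> card B + card ?D" .
  have B_indep: "r = 0" if r: "r \<in> F" "keys r \<subseteq> B" for r
  proof (rule ccontr)
    assume "r \<noteq> 0"
    then obtain K where "K \<in> circuits" "K \<subseteq> keys r" using ex_circuit_subset[OF r(1)] by blast
    then show False using B(1) r(2) unfolding nbc_def by blast
  qed
  have "B \<subseteq> {1..n}" using B(1) unfolding nbc_def by blast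
  then interpret spanning_forest n F \<rho> ?D rel
    by unfold_locales (rule spans_by_dimension[OF _ B_indep dim])
  show ?thesis using inj disjoint_minimal_bcs by blast
qed

end

section \<open>Arrangements\<close>

lemma relation_space_sum:
  assumes "r \<in> relation_space n \<alpha>" "keys r \<subseteq> C" "C \<subseteq> {1..n}"
  shows "(\<Sum>j\<in>C. lookup r j * \<alpha> j v) = 0"
proof -
  have "lookup r j * \<alpha> j v = 0" if "j \<in> {1..n} - C" for j
    using that assms(2) by (metis DiffD2 in_keys_iff mult_zero_left subsetD)
  then have "(\<Sum>j\<in>{1..n}. lookup r j * \<alpha> j v) = (\<Sum>j\<in>C. lookup r j * \<alpha> j v)"
    using assms(3) by (intro sum.mono_neutral_right) blast+
  then show ?thesis using assms(1) by (simp add: relation_space_def)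
qed

text \<open>A relation with a single entry would make a functional zero and its kernel the whole space; one with
  two entries would make two hyperplanes equal.\<close>
lemma relation_space_relations:
  fixes scale :: "'k::field \<Rightarrow> 'v::ab_group_add \<Rightarrow> 'v" and \<alpha> :: "nat \<Rightarrow> 'v \<Rightarrow> 'k"
  assumes hyperplane: "\<And>i. i \<in> {1..n} \<Longrightarrow> linear_hyperplane scale (H i)"
    and distinct: "inj_on H {1..n}"
    and kernel: "\<And>i. i \<in> {1..n} \<Longrightarrow> {v. \<alpha> i v = 0} = H i"
  shows "relations n (relation_space n \<alpha>)"
proof
  show "pm.subspace (relation_space n \<alpha>)"
  proof (rule pm.subspaceI)
    show "0 \<in> relation_space n \<alpha>" by (simp add: relation_space_def)
    show "x + y \<in> relation_space n \<alpha>" if "x \<in> relation_space n \<alpha>" "y \<in> relation_space n \<alpha>" for x y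
      using that Poly_Mapping.keys_add[of x y]
      by (auto simp: relation_space_def lookup_add distrib_right sum.distrib)
    show "pscale c x \<in> relation_space n \<alpha>" if "x \<in> relation_space n \<alpha>" for c x
      using that keys_pscale_subset[of c x]
      by (auto simp: relation_space_def mult.assoc simp flip: sum_distrib_left)
  qed
  show "keys r \<subseteq> {1..n}" if "r \<in> relation_space n \<alpha>" for r
    using that by (simp add: relation_space_def)
  show "3 \<le> card (keys r)" if r: "r \<in> relation_space n \<alpha>" "r \<noteq> 0" for r
  proof (rule ccontr)
    assume "\<not> 3 \<le> card (keys r)"
    moreover have "card (keys r) \<noteq> 0" using r(2) by simp
    ultimately consider "card (keys r) = 1" | "card (keys r) = 2" by linarith
    then show False
    proof cases
      case 1
      then obtain i where i: "keys r = {i}" by (auto simp: card_1_singleton_iff)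
      have i_n: "i \<in> {1..n}" using i r(1) by (auto simp: relation_space_def)
      have z: "lookup r i * \<alpha> i v = 0" for v
        using relation_space_sum[OF r(1), of "{i}" v] i i_n by simp
      have "lookup r i \<noteq> 0" using i by (metis in_keys_iff singletonI)
      then have "H i = UNIV" using z kernel[OF i_n] by auto
      then show False using hyperplane[OF i_n] unfolding linear_hyperplane_def by simp
    next
      case 2
      then obtain i j where ij: "keys r = {i, j}" "i \<noteq> j" by (auto simp: card_2_iff)
      have n: "i \<in> {1..n}" "j \<in> {1..n}" using ij r(1) by (auto simp: relation_space_def)
      have z: "lookup r i * \<alpha> i v + lookup r j * \<alpha> j v = 0" for v
        using relation_space_sum[OF r(1), of "{i, j}" v] ij n by simp
      have nz: "lookup r i \<noteq> 0" "lookup r j \<noteq> 0" using ij by (metis in_keys_iff insertCI)+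
      have "\<alpha> i v = 0 \<longleftrightarrow> \<alpha> j v = 0" for v using z[of v] nz by auto
      then have "H i = H j" using kernel[OF n(1)] kernel[OF n(2)] by auto
      then show False using distinct n ij(2) unfolding inj_on_def by blast
    qed
  qed
qed

lemma dependent_iff_relation:
  assumes C: "C \<subseteq> {1..n}"
  shows "C \<notin> arrangement_indep n \<alpha> \<longleftrightarrow> (\<exists>r\<in>relation_space n \<alpha>. r \<noteq> 0 \<and> keys r \<subseteq> C)"
proof
  have finC: "finite C" by (rule finite_subset[OF C]) simp
  assume "C \<notin> arrangement_indep n \<alpha>"
  then obtain c i where c: "\<And>v. (\<Sum>i\<in>C. c i * \<alpha> i v) = 0" and i: "i \<in> C" "c i \<noteq> 0"
    using C unfolding arrangement_indep_def independent_family_def by blast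
  define r where "r = (\<Sum>j\<in>C. single j (c j))"
  have l: "lookup r j = (if j \<in> C then c j else 0)" for j
  proof -
    have "lookup r j = (\<Sum>l\<in>C. if l = j then c j else 0)"
      unfolding r_def lookup_sum by (rule sum.cong) (auto simp: lookup_single when_def)
    then show ?thesis using finC by simp
  qed
  have k: "keys r \<subseteq> C" by (auto simp: in_keys_iff l split: if_splits)
  have "(\<Sum>j\<in>{1..n}. lookup r j * \<alpha> j v) = 0" for v
  proof -
    have "(\<Sum>j\<in>{1..n}. lookup r j * \<alpha> j v) = (\<Sum>j\<in>C. lookup r j * \<alpha> j v)"
      using C by (intro sum.mono_neutral_right) (auto simp: l)
    also have "\<dots> = (\<Sum>j\<in>C. c j * \<alpha> j v)" by (rule sum.cong) (auto simp: l)
    finally show ?thesis using c by simp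
  qed
  then have "r \<in> relation_space n \<alpha>" using k C by (simp add: relation_space_def)
  moreover have "r \<noteq> 0" using l[of i] i by auto
  ultimately show "\<exists>r\<in>relation_space n \<alpha>. r \<noteq> 0 \<and> keys r \<subseteq> C" using k by blast
next
  assume "\<exists>r\<in>relation_space n \<alpha>. r \<noteq> 0 \<and> keys r \<subseteq> C"
  then obtain r where r: "r \<in> relation_space n \<alpha>" "r \<noteq> 0" "keys r \<subseteq> C" by blast
  have "(\<Sum>j\<in>C. lookup r j * \<alpha> j v) = 0" for v by (rule relation_space_sum[OF r(1,3) C])
  moreover obtain i where i: "i \<in> keys r" using r(2) by (metis all_not_in_conv keys_eq_empty)
  moreover have "i \<in> C" "lookup r i \<noteq> 0" using i r(3) by (auto simp: in_keys_iff)
  ultimately have "\<not> independent_family \<alpha> C"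
    unfolding independent_family_def by blast
  then show "C \<notin> arrangement_indep n \<alpha>" unfolding arrangement_indep_def by simp
qed

lemma arrangement_circuits_eq:
  assumes "relations n (relation_space n \<alpha>)"
  shows "arrangement_circuits n \<alpha> = relations.circuits (relation_space n \<alpha>)"
proof -
  interpret relations n "relation_space n \<alpha>" by (rule assms)
  show ?thesis
  proof
    show "arrangement_circuits n \<alpha> \<subseteq> circuits"
    proof
      fix C assume "C \<in> arrangement_circuits n \<alpha>"
      then have C: "C \<subseteq> {1..n}" "C \<notin> arrangement_indep n \<alpha>" "\<And>D. D \<subset> C \<Longrightarrow> D \<in> arrangement_indep n \<alpha>"
        unfolding arrangement_circuits_def matroid_circuits_def by blast+
      have min: "keys s = C" if "s \<in> relation_space n \<alpha>" "s \<noteq> 0" "keys s \<subseteq> C" for s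
      proof (rule ccontr)
        assume "keys s \<noteq> C"
        then have "keys s \<in> arrangement_indep n \<alpha>" using C(3) that(3) by blast
        then show False using dependent_iff_relation[OF keys_F[OF that(1)]] that by blast
      qed
      obtain r where r: "r \<in> relation_space n \<alpha>" "r \<noteq> 0" "keys r \<subseteq> C"
        using dependent_iff_relation[OF C(1)] C(2) by blast
      have "keys r = C" by (rule min[OF r])
      then show "C \<in> circuits" using circuitI[OF r(1,2)] min by blast
    qed
    show "circuits \<subseteq> arrangement_circuits n \<alpha>"
    proof
      fix C assume C: "C \<in> circuits"
      obtain r where r: "r \<in> relation_space n \<alpha>" "keys r = C" "r \<noteq> 0" using circuit_relation[OF C] by blast
      have "D \<in> arrangement_indep n \<alpha>" if D: "D \<subset> C" for D
      proof (rule ccontr)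
        assume "D \<notin> arrangement_indep n \<alpha>"
        moreover have "D \<subseteq> {1..n}" using D circuits_sub[OF C] by blast
        ultimately obtain s where s: "s \<in> relation_space n \<alpha>" "s \<noteq> 0" "keys s \<subseteq> D"
          using dependent_iff_relation by blast
        then have "keys s = C" using circuit_minimal[OF C] D by blast
        then show False using s(3) D by blast
      qed
      moreover have "C \<notin> arrangement_indep n \<alpha>"
        using dependent_iff_relation[OF circuits_sub[OF C]] r by blast
      ultimately show "C \<in> arrangement_circuits n \<alpha>"
        unfolding arrangement_circuits_def matroid_circuits_def using circuits_sub[OF C] by blast
    qed
  qed
qed

lemma (in relations) minimal_broken_circuits_eq:
  assumes "inj_on \<rho> {1..n}"
  shows "minimal_broken_circuits (rank_order n \<rho>) circuits = minimal_bcs \<rho>"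
proof -
  have "min_wrt (rank_order n \<rho>) K = first \<rho> K" if "K \<in> circuits" for K
    using circuits_card[OF that] by (intro min_wrt_rank_order[OF assms circuits_sub[OF that]]) auto
  then have "broken_circuits (rank_order n \<rho>) circuits = (\<lambda>K. K - {first \<rho> K}) ` circuits"
    unfolding broken_circuits_def by (intro image_cong) simp_all
  then show ?thesis unfolding minimal_broken_circuits_def minimal_bcs_def by auto
qed

theorem theorem4p16:
  fixes scale :: "'k::field \<Rightarrow> 'v::ab_group_add \<Rightarrow> 'v"
    and Basis :: "'v set"
    and n :: nat
    and H :: "nat \<Rightarrow> 'v set"
    and \<alpha> :: "nat \<Rightarrow> 'v \<Rightarrow> 'k"
  assumes fin_dim: "finite_dimensional_vector_space scale Basis"
    and hyperplane: "\<And>i. i \<in> {1..n} \<Longrightarrow> linear_hyperplane scale (H i)"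
    and distinct: "inj_on H {1..n}"
    and essential: "(\<Inter>i\<in>{1..n}. H i) = {0}"
    and functional: "\<And>i. i \<in> {1..n} \<Longrightarrow> Vector_Spaces.linear scale (*) (\<alpha> i)"
    and kernel: "\<And>i. i \<in> {1..n} \<Longrightarrow> {v. \<alpha> i v = 0} = H i"
  defines "S \<equiv> (polynomial_ring n :: 'k mpolynomial ring)"
    and "I \<equiv> orlik_terao_ideal n \<alpha>"
    and "\<CC> \<equiv> arrangement_circuits n \<alpha>"
  shows
    "(complete_intersection S I \<longleftrightarrow>
       (\<exists>r. linear_order_on {1..n} r \<and>
          (\<forall>R. induced_monomial_order n r R \<longrightarrow> complete_intersection S (initial_ideal n R I))))
     \<and>
     (complete_intersection S I \<longleftrightarrow>
       (\<exists>r. linear_order_on {1..n} r \<and> pairwise disjnt (minimal_broken_circuits r \<CC>)))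
     \<and>
     (complete_intersection S I \<longleftrightarrow>
       (\<exists>r. linear_order_on {1..n} r \<and>
          (\<exists>\<DD>. \<DD> \<subseteq> \<CC> \<and> simple_family r \<DD> \<and>
             \<CC> = {combined_circuit \<DD>' | \<DD>'. \<DD>' \<subseteq> \<DD> \<and> tree_family \<DD>'})))"
proof -
  have rel: "relations n (relation_space n \<alpha>)"
    by (rule relation_space_relations[OF hyperplane distinct kernel])
  interpret relations n "relation_space n \<alpha>" by (rule rel)
  have C: "\<CC> = circuits" unfolding \<CC>_def by (rule arrangement_circuits_eq[OF rel])
  have I: "I = ot_ideal"
    unfolding I_def orlik_terao_ideal_def ot_ideal_def
    by (rule genideal_polynomial_ring) (use boundary_in_polys in blast)
  have orders: "(\<exists>r. linear_order_on {1..n} r \<and> P r) \<longleftrightarrow> (\<exists>\<rho>. inj_on \<rho> {1..n} \<and> P (rank_order n \<rho>))" for P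
    using ex_rank_order linear_order_rank_order by metis
  have 1: "complete_intersection S I \<longleftrightarrow> (\<exists>\<rho>. inj_on \<rho> {1..n} \<and> pairwise disjnt (minimal_bcs \<rho>))"
  proof
    assume "complete_intersection S I"
    then show "\<exists>\<rho>. inj_on \<rho> {1..n} \<and> pairwise disjnt (minimal_bcs \<rho>)"
      unfolding S_def I by (rule complete_intersection_imp_disjoint)
  next
    assume "\<exists>\<rho>. inj_on \<rho> {1..n} \<and> pairwise disjnt (minimal_bcs \<rho>)"
    then obtain \<rho> where \<rho>: "inj_on \<rho> {1..n}" "pairwise disjnt (minimal_bcs \<rho>)" by blast
    obtain R where "ordered_relations n (relation_space n \<alpha>) R \<rho>" using ex_ordered_relations[OF \<rho>(1)] by blast
    then show "complete_intersection S I"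
      unfolding S_def I using \<rho>(2) by (rule ordered_relations.disjoint_imp_complete_intersection)
  qed
  have 2: "pairwise disjnt (minimal_bcs \<rho>) \<longleftrightarrow>
      (\<forall>R. induced_monomial_order n (rank_order n \<rho>) R \<longrightarrow> complete_intersection S (initial_ideal n R I))"
    if \<rho>: "inj_on \<rho> {1..n}" for \<rho>
  proof
    assume disj: "pairwise disjnt (minimal_bcs \<rho>)"
    show "\<forall>R. induced_monomial_order n (rank_order n \<rho>) R \<longrightarrow> complete_intersection S (initial_ideal n R I)"
    proof (intro allI impI)
      fix R assume R: "induced_monomial_order n (rank_order n \<rho>) R"
      then have "monomial_order n R" unfolding induced_monomial_order_def by blast
      then interpret ordered_relations n "relation_space n \<alpha>" R \<rho>
        using \<rho> R by unfold_locales auto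
      show "complete_intersection S (initial_ideal n R I)"
        unfolding S_def I by (rule disjoint_imp_initial_complete_intersection[OF disj])
    qed
  next
    assume ci: "\<forall>R. induced_monomial_order n (rank_order n \<rho>) R \<longrightarrow> complete_intersection S (initial_ideal n R I)"
    obtain R where "ordered_relations n (relation_space n \<alpha>) R \<rho>" using ex_ordered_relations[OF \<rho>] by blast
    then interpret O: ordered_relations n "relation_space n \<alpha>" R \<rho> .
    have "complete_intersection S (initial_ideal n R I)" using ci O.induced by blast
    then show "pairwise disjnt (minimal_bcs \<rho>)"
      unfolding S_def I by (rule O.initial_complete_intersection_imp_disjoint)
  qed
  have 3: "minimal_broken_circuits (rank_order n \<rho>) \<CC> = minimal_bcs \<rho>" if "inj_on \<rho> {1..n}" for \<rho>
    unfolding C by (rule minimal_broken_circuits_eq[OF that])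
  have 4: "pairwise disjnt (minimal_bcs \<rho>) \<longleftrightarrow> (\<exists>\<DD>. \<DD> \<subseteq> \<CC> \<and> simple_family (rank_order n \<rho>) \<DD> \<and>
      \<CC> = {combined_circuit \<DD>' | \<DD>'. \<DD>' \<subseteq> \<DD> \<and> tree_family \<DD>'})" if "inj_on \<rho> {1..n}" for \<rho>
    unfolding C by (rule disjoint_iff_simple[OF that])
  show ?thesis
    unfolding orders 1 using 2 3 4 by (simp cong: conj_cong)
qed

end
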